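(* Let $(\alpha,\beta)\in\Gamma$ be a point with $\alpha,\beta>0$, $\alpha<L/2$ and $\beta<M/2$. Assume $f\in C^2[\alpha,L)$ with $f'<0$ and $f''>0$ on $[\alpha,L)$, and $g\in C^2[\beta,M)$ with $g'<0$ and $g''>0$ on $[\beta,M)$. Suppose there is a partition $\alpha=\alpha_0<\alpha_1<\dots<\alpha_m=L$ such that $f''$ is monotonic on each subinterval $(\alpha_i,\alpha_{i+1})$, and a partition $\beta=\beta_0<\beta_1<\dots<\beta_n=M$ such that $g''$ is monotonic on each subinterval $(\beta_i,\beta_{i+1})$. Assume moreover that there are functions $\delta:(0,\infty)\to(0,L/2-\alpha)$ and $\epsilon:(0,\infty)\to(0,M/2-\beta)$ and positive constants $a_1,a_2,b_1,b_2$ such that, as $r\to\infty$, $$\delta(r)=O(r^{-2a_1}),\qquad \frac{1}{f''(L-\delta(r))}=O(r^{1-4a_2}),$$ $$\epsilon(r)=O(r^{-2b_1}),\qquad \frac{1}{g''(M-\epsilon(r))}=O(r^{1-4b_2}).$$ Assume finally that $L=M$. Let $e=\min\left(\tfrac16,a_1,a_2,b_1,b_2\right)$. Then the optimal stretch factor for minimizing $\mathcal{N}(r,s)$ approaches $1$ as $r\to\infty$, with $$\mathcal{S}(r)\subset\left[1-O(r^{-e}),\,1+O(r^{-e})\right],$$ that is, there are constants $C,r_0>0$ such that $|s-1|\le Cr^{-e}$ for all $r\ge r_0$ and all $s\in\mathcal{S}(r)$. Further, as $r\to\infty$, $$\min_{s>0}\mathcal{N}(r,s)=r^2\operatorname{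Area}(\Gamma)+rL+O(r^{1-2e}).$$
   Context: Let $L,M>0$ and let $\Gamma$ be a convex, strictly decreasing curve in the first quadrant with $x$-intercept $L$ and $y$-intercept $M$: $\Gamma$ is the graph of $y=f(x)$, where $f:[0,L]\to[0,M]$ is a continuous, convex, strictly decreasing function with $f(0)=M$ and $f(L)=0$. Let $g:[0,M]\to[0,L]$ be the inverse function of $f$ (also convex and strictly decreasing). $\operatorname{Area}(\Gamma)=\int_0^L f(x)\,dx$ is the area enclosed by $\Gamma$ and the coordinate axes. For $r,s>0$, $r\Gamma(s)$ is the graph of $x\mapsto rs\,f(sx/r)$ on $0\le x\le rL/s$. The number of nonnegative-integer lattice points inside or on $r\Gamma(s)$ is $$\mathcal{N}(r,s)=\#\{(j,k)\in\mathbb{Z}_+\times\mathbb{Z}_+: js/r\le L,\ k\le rs\,f(js/r)\},\qquad \mathbb{Z}_+=\{0,1,2,\dots\}.$$ For each $r>0$, $\mathcal{S}(r)=\operatorname{argmin}_{s>0}\mathcal{N}(r,s)$ is the set of $s>0$ at which $s\mapsto\mathcal{N}(r,s)$ attains its minimum. *)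

theory Defs
  imports "HOL-Analysis.Analysis" "HOL-Library.Landau_Symbols"
begin

text \<open>
  Twice continuously differentiable on \<open>S\<close>, with first and second derivatives \<open>f'\<close> and \<open>f''\<close>.
  Derivatives are taken within \<open>S\<close>, hence one-sided at an endpoint belonging to \<open>S\<close>.
\<close>

definition has_C2_derivs_on ::
    "(real \<Rightarrow> real) \<Rightarrow> (real \<Rightarrow> real) \<Rightarrow> (real \<Rightarrow> real) \<Rightarrow> real set \<Rightarrow> bool" where
  "has_C2_derivs_on f f' f'' S \<longleftrightarrow>
     (\<forall>x\<in>S. (f has_real_derivative f' x) (at x within S)) \<and>
     (\<forall>x\<in>S. (f' has_real_derivative f'' x) (at x within S)) \<and>
     continuous_on S f''"

definition piecewise_monotonic :: "(real \<Rightarrow> real) \<Rightarrow> (nat \<Rightarrow> real) \<Rightarrow> nat \<Rightarrow> bool" where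
  "piecewise_monotonic h p m \<longleftrightarrow>
     (\<forall>i<m. p i < p (Suc i) \<and>
        (mono_on {p i<..<p (Suc i)} h \<or> antimono_on {p i<..<p (Suc i)} h))"

definition lattice_count :: "real \<Rightarrow> (real \<Rightarrow> real) \<Rightarrow> real \<Rightarrow> real \<Rightarrow> nat" where
  "lattice_count L f r s =
     card {(j::nat, k::nat). real j * s / r \<le> L \<and> real k \<le> r * s * f (real j * s / r)}"

definition optimal_stretches :: "real \<Rightarrow> (real \<Rightarrow> real) \<Rightarrow> real \<Rightarrow> real set" where
  "optimal_stretches L f r = {s. is_arg_min (lattice_count L f r) (\<lambda>s. s > 0) s}"

text \<open>The infimum is taken in the natural numbers over a nonempty set, so it is attained.\<close>

definition min_lattice_count :: "real \<Rightarrow> (real \<Rightarrow> real) \<Rightarrow> real \<Rightarrow> nat" where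
  "min_lattice_count L f r = (INF s\<in>{0<..}. lattice_count L f r s)"

end

theory Submission
  imports Defs
begin

text \<open>
  Let \<open>saw x = frac x - 1/2\<close>. Counting the lattice points below the stretched curve column by column to
  the right of \<open>(\<alpha>, \<beta>)\<close>, row by row above it, and directly in the remaining rectangle, and comparing
  sums of a convex function with its integral by the trapezoidal rule, one finds
  \<open>N(r, s) = r\<^sup>2 Area + r (L / s + M s) / 2\<close> up to \<open>O(1)\<close> and the sum of \<open>saw\<close> along the two arcs,
  uniformly for \<open>1/3 \<le> s \<le> 3\<close>. Along an arc with second differences of size \<open>\<mu>\<close>, van der Corput's method
  (smoothing of \<open>saw\<close>, Fourier expansion, Kusmin--Landau) bounds the sum of \<open>n\<close> terms by
  \<open>O(n \<mu> powr (1/3) + \<mu> powr (-1/2))\<close>. Where \<open>f''\<close> decreases to 0 near the intercept the arc is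
  decomposed dyadically, and the last piece of length \<open>\<delta> r\<close> is estimated trivially. This makes all error
  terms \<open>O(r powr (1 - 2 e))\<close>.

  Convexity alone gives \<open>N(r, s) \<ge> r\<^sup>2 Area + r L max(s, 1 / s) / 2\<close>, so that a minimizing \<open>s\<close> eventually
  lies in \<open>[1/3, 3]\<close>; there the comparison of \<open>N(r, s)\<close> with \<open>N(r, 1)\<close> forces
  \<open>(s - 1)\<^sup>2 / (2 s) = O(r powr (- 2 e))\<close>.
\<close>

section \<open>A cosine series\<close>

text \<open>Columns are used only beyond \<open>\<alpha>\<close> and rows only beyond
  \<open>f \<alpha>\<close> because \<open>f\<close> and \<open>g\<close> may be arbitrarily steep
  near 0. Each remaining arc has bounded slope, but its curvature at the intercept may vanish or
  blow up. Monotonicity of \<open>f''\<close> near \<open>L\<close> separates these cases. An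
  increasing \<open>f''\<close> stays away from 0, and only the total change of slope enters; this
  is why the basic estimate keeps the range \<open>W\<close> of the first differences apart from the
  lower bound \<open>\<mu>\<close> for their growth. A decreasing \<open>f''\<close> is bounded
  above, which allows dyadic pieces. The stretched arc has about r columns and second differences of
  size 1/r, so \<open>n * \<mu> powr (1/3)\<close> is r^(2/3) = r^(1 - 2/6): this is the origin of
  1/6. At the cut, \<open>\<mu> powr (-1/2)\<close> is about (r / f'')^(1/2) = O(r^(1 - 2 a2)), and
  the discarded piece has O(r^(1 - 2 a1)) columns. The interval [1/3, 3] is invariant under s ->
  1/s, which exchanges rows and columns. The main term is quadratic in s - 1 near its minimum, so an
  error of exponent 2e in the count leaves only e for the stretch factor.\<close>

lemma dirichlet_kernel:
  fixes x :: real
  shows "sin (pi * x) * (1 + 2 * (\<Sum>i<N. cos (2 * pi * real (Suc i) * x))) = sin (real (2 * N + 1) * pi * x)"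
proof (induction N)
  case 0
  then show ?case by simp
next
  case (Suc N)
  have "sin (real (2 * Suc N + 1) * pi * x) - sin (real (2 * N + 1) * pi * x)
      = sin (2 * pi * real (Suc N) * x + pi * x) - sin (2 * pi * real (Suc N) * x - pi * x)"
    by (simp add: algebra_simps)
  also have "\<dots> = 2 * sin (pi * x) * cos (2 * pi * real (Suc N) * x)"
    unfolding sin_add sin_diff by simp
  finally show ?case
    using Suc by (simp add: algebra_simps)
qed

text \<open>Up to a factor, the left-hand side is an antiderivative of the Dirichlet kernel
  vanishing at 1/2; one integration by parts gains \<open>1 / (2 * N + 1)\<close> away from the
  integers.\<close>

lemma sawtooth_partial_sum_bound:
  fixes x y :: real
  assumes y: "0 < y" "y \<le> 1/2" and x: "y \<le> x" "x \<le> 1 - y"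
  shows "\<bar>pi\<^sup>2 * (2 * x - 1) + 2 * pi * (\<Sum>i<N. sin (2 * pi * real (Suc i) * x) / real (Suc i))\<bar>
           \<le> 4 * pi\<^sup>2 / (sin (pi * y))\<^sup>2 / real (2 * N + 1)"
proof -
  define M where "M = real (2 * N + 1)"
  have M: "M > 0" by (simp add: M_def)
  define c where "c = sin (pi * y)"
  have c0: "c > 0" unfolding c_def using y by (intro sin_gt_zero) (auto simp: field_simps)
  have c1: "c \<le> 1" unfolding c_def by simp
  have c: "c \<le> sin (pi * t)" if "y \<le> t" "t \<le> 1 - y" for t
  proof (cases "t \<le> 1/2")
    case True
    then show ?thesis unfolding c_def using that mult_pos_pos[OF pi_gt_zero y(1)]
        mult_left_mono[of y t pi] mult_left_mono[of t "1/2" pi]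
      by (intro sin_monotone_2pi_le) (auto intro: order_trans[of _ 0])
  next
    case False
    then have "sin (pi * y) \<le> sin (pi * (1 - t))"
      using that mult_pos_pos[OF pi_gt_zero y(1)]
        mult_left_mono[of y "1 - t" pi] mult_left_mono[of "1 - t" "1/2" pi]
      by (intro sin_monotone_2pi_le) (auto intro: order_trans[of _ 0])
    then show ?thesis by (simp add: c_def right_diff_distrib)
  qed
  define E where "E = (\<lambda>x. pi\<^sup>2 * (2 * x - 1) + 2 * pi * (\<Sum>i<N. sin (2 * pi * real (Suc i) * x) / real (Suc i)))"
  \<comment> \<open>\<open>R\<close> is \<open>E\<close> without the boundary term of the
    integration by parts. Its derivative no longer contains the kernel, only a term of size
    \<open>1 / M\<close>.\<close>
  define R where "R = (\<lambda>x. E x + 2 * pi * cos (M * pi * x) / (M * sin (pi * x)))"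
  define R' where "R' = (\<lambda>x. - 2 * pi\<^sup>2 * cos (M * pi * x) * cos (pi * x) / (M * (sin (pi * x))\<^sup>2))"
  have dR: "(R has_real_derivative R' t) (at t within {y..1-y})" if t: "t \<in> {y..1-y}" for t
  proof -
    have s: "sin (pi * t) > 0" using c[of t] c0 t by auto
    have "((\<lambda>x. sin (2 * pi * real (Suc i) * x) / real (Suc i)) has_real_derivative
        2 * pi * cos (2 * pi * real (Suc i) * t)) (at t within {y..1-y})" for i
      by (auto intro!: derivative_eq_intros simp del: of_nat_Suc)
    then have "((\<lambda>x. 2 * pi * (\<Sum>i<N. sin (2 * pi * real (Suc i) * x) / real (Suc i))) has_real_derivative
        2 * pi * (\<Sum>i<N. 2 * pi * cos (2 * pi * real (Suc i) * t))) (at t within {y..1-y})"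
      by (intro DERIV_sum DERIV_cmult)
    moreover have "((\<lambda>x. pi\<^sup>2 * (2 * x - 1)) has_real_derivative 2 * pi\<^sup>2) (at t within {y..1-y})"
      by (auto intro!: derivative_eq_intros)
    ultimately have "(E has_real_derivative 2 * pi\<^sup>2 + 2 * pi * (\<Sum>i<N. 2 * pi * cos (2 * pi * real (Suc i) * t))) (at t within {y..1-y})"
      unfolding E_def by (intro DERIV_add)
    moreover have "2 * pi\<^sup>2 + 2 * pi * (\<Sum>i<N. 2 * pi * cos (2 * pi * real (Suc i) * t)) = 2 * pi\<^sup>2 * sin (M * pi * t) / sin (pi * t)"
    proof -
      have "2 * pi\<^sup>2 + 2 * pi * (\<Sum>i<N. 2 * pi * cos (2 * pi * real (Suc i) * t))
        = 2 * pi\<^sup>2 * (1 + 2 * (\<Sum>i<N. cos (2 * pi * real (Suc i) * t)))"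
        by (simp add: sum_distrib_left[symmetric] power2_eq_square distrib_left)
      also have "\<dots> = 2 * pi\<^sup>2 * (sin (pi * t) * (1 + 2 * (\<Sum>i<N. cos (2 * pi * real (Suc i) * t)))) / sin (pi * t)"
        using s by simp
      finally show ?thesis unfolding M_def dirichlet_kernel .
    qed
    ultimately have E': "(E has_real_derivative 2 * pi\<^sup>2 * sin (M * pi * t) / sin (pi * t)) (at t within {y..1-y})"
      by simp
    have "((\<lambda>x. 2 * pi * cos (M * pi * x) / (M * sin (pi * x))) has_real_derivative 
        R' t - 2 * pi\<^sup>2 * sin (M * pi * t) / sin (pi * t)) (at t within {y..1-y})"
    proof (rule DERIV_cong)
      show "((\<lambda>x. 2 * pi * cos (M * pi * x) / (M * sin (pi * x))) has_real_derivative
         (2 * pi * (- sin (M * pi * t) * (M * pi)) * (M * sin (pi * t)) - 2 * pi * cos (M * pi * t) * (M * (cos (pi * t) * pi)))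
           / ((M * sin (pi * t)) * (M * sin (pi * t)))) (at t within {y..1-y})"
      proof (intro DERIV_divide DERIV_cmult)
        show "((\<lambda>x. cos (M * pi * x)) has_real_derivative - sin (M * pi * t) * (M * pi)) (at t within {y..1-y})"
          "((\<lambda>x. sin (pi * x)) has_real_derivative cos (pi * t) * pi) (at t within {y..1-y})"
          by (auto intro!: derivative_eq_intros)
      qed (use s M in auto)
      have "(2 * pi * (- A * (M * pi)) * (M * S) - 2 * pi * B * (M * (C * pi))) / ((M * S) * (M * S))
          = - 2 * pi\<^sup>2 * B * C / (M * S\<^sup>2) - 2 * pi\<^sup>2 * A / S" if "S > 0" for A B C S
        using that M by (simp add: field_simps power2_eq_square)
      from this[OF s] show "(2 * pi * (- sin (M * pi * t) * (M * pi)) * (M * sin (pi * t)) - 2 * pi * cos (M * pi * t) * (M * (cos (pi * t) * pi)))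
           / ((M * sin (pi * t)) * (M * sin (pi * t))) = R' t - 2 * pi\<^sup>2 * sin (M * pi * t) / sin (pi * t)"
        unfolding R'_def by blast
    qed
    from DERIV_add[OF E' this] show ?thesis unfolding R_def by simp
  qed
  have bR: "norm (R' t) \<le> 2 * pi\<^sup>2 / (M * c\<^sup>2)" if t: "t \<in> {y..1-y}" for t
  proof -
    have "\<bar>cos (M * pi * t) * cos (pi * t)\<bar> \<le> 1 * 1"
      unfolding abs_mult by (intro mult_mono) auto
    then have "2 * pi\<^sup>2 * \<bar>cos (M * pi * t) * cos (pi * t)\<bar> \<le> 2 * pi\<^sup>2"
      by simp
    moreover have "M * c\<^sup>2 \<le> M * (sin (pi * t))\<^sup>2"
      using c[of t] t c0 M by (intro mult_left_mono power_mono) auto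
    moreover have "norm (R' t) = 2 * pi\<^sup>2 * \<bar>cos (M * pi * t) * cos (pi * t)\<bar> / (M * (sin (pi * t))\<^sup>2)"
      unfolding R'_def using M by (simp add: abs_mult)
    ultimately show ?thesis using M c0
      by (auto intro!: frac_le)
  qed
  \<comment> \<open>At 1/2 all sines of the sum vanish, and so does the cosine, because
    \<open>M\<close> is odd.\<close>
  have "R (1/2) = 0"
  proof -
    have "sin (2 * pi * real (Suc i) * (1/2)) = 0" for i
    proof -
      have "2 * pi * real (Suc i) * (1/2) = real (Suc i) * pi" by simp
      then show ?thesis by (simp only: sin_npi)
    qed
    moreover have "cos (M * pi * (1/2)) = 0"
    proof -
      have "M * pi * (1/2) = real N * pi + pi / 2" by (simp add: M_def field_simps)
      show ?thesis unfolding \<open>M * pi * (1/2) = _\<close> by (simp add: cos_add)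
    qed
    ultimately show ?thesis unfolding R_def E_def by simp
  qed
  have "norm (R x - R (1/2)) \<le> 2 * pi\<^sup>2 / (M * c\<^sup>2) * norm (x - 1/2)"
    by (rule field_differentiable_bound[of "{y..1-y}", OF _ dR bR]) (use x y in auto)
  also have "\<dots> \<le> 2 * pi\<^sup>2 / (M * c\<^sup>2) * 1"
    using x y M c0 by (intro mult_left_mono) auto
  finally have Rx: "\<bar>R x\<bar> \<le> 2 * pi\<^sup>2 / (M * c\<^sup>2)" using \<open>R (1/2) = 0\<close> by simp
  have "\<bar>2 * pi * cos (M * pi * x) / (M * sin (pi * x))\<bar> = 2 * pi * \<bar>cos (M * pi * x)\<bar> / (M * sin (pi * x))"
    using c[of x] x c0 M by (simp add: abs_mult)
  also have "\<dots> \<le> 2 * pi\<^sup>2 / (M * c\<^sup>2)"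
  proof (rule frac_le)
    have "pi * \<bar>cos (M * pi * x)\<bar> \<le> pi * pi"
      using pi_gt3 by (intro mult_left_mono) (auto intro: order_trans[OF abs_cos_le_one])
    then show "2 * pi * \<bar>cos (M * pi * x)\<bar> \<le> 2 * pi\<^sup>2" by (simp add: power2_eq_square)
    have "c\<^sup>2 \<le> c" using c0 c1 by (simp add: power2_eq_square)
    also have "\<dots> \<le> sin (pi * x)" using c x by auto
    finally show "M * c\<^sup>2 \<le> M * sin (pi * x)" using M by simp
  qed (use M c0 in auto)
  finally have "\<bar>E x\<bar> \<le> 2 * pi\<^sup>2 / (M * c\<^sup>2) + 2 * pi\<^sup>2 / (M * c\<^sup>2)"
    using Rx unfolding R_def by linarith
  also have "\<dots> = 4 * pi\<^sup>2 / c\<^sup>2 / M" using M c0 by (simp add: field_simps)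
  finally show ?thesis unfolding E_def c_def M_def .
qed

text \<open>This is pi^2 times the Fourier series of the periodic second Bernoulli polynomial x^2 -
  x + 1/6. Only differences of values are evaluated, so the constant 1/6 is never
  determined.\<close>

definition cos_series :: "real \<Rightarrow> real" where
  "cos_series x = (\<Sum>i. cos (2 * pi * real (Suc i) * x) / (real (Suc i))\<^sup>2)"

lemma cos_series_uniform:
  "uniform_limit UNIV (\<lambda>N x. \<Sum>i<N. cos (2 * pi * real (Suc i) * x) / (real (Suc i))\<^sup>2) cos_series sequentially"
  unfolding cos_series_def
proof (rule Weierstrass_m_test)
  show "norm (cos (2 * pi * real (Suc i) * x) / (real (Suc i))\<^sup>2) \<le> 1 / (real (Suc i))\<^sup>2" for i x
    by (auto simp: intro!: divide_right_mono)
  show "summable (\<lambda>i. 1 / (real (Suc i))\<^sup>2)"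
    using inverse_squares_sums by (auto simp: sums_iff)
qed

lemma cos_series_LIMSEQ:
  "(\<lambda>N. \<Sum>i<N. cos (2 * pi * real (Suc i) * x) / (real (Suc i))\<^sup>2) \<longlonglongrightarrow> cos_series x"
  using tendsto_uniform_limitI[OF cos_series_uniform, of x] by simp

lemma continuous_cos_series: "continuous_on UNIV cos_series"
  by (rule uniform_limit_theorem[OF _ cos_series_uniform]) (auto intro!: continuous_intros always_eventually)

lemma cos_series_frac: "cos_series (frac x) = cos_series x"
proof -
  have "cos (2 * pi * real (Suc i) * frac x) = cos (2 * pi * real (Suc i) * x)" for i
  proof -
    have "2 * pi * real (Suc i) * frac x = 2 * pi * real (Suc i) * x + of_int (- int (Suc i) * floor x) * (2 * pi)"
      by (simp add: frac_def algebra_simps)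
    then show ?thesis by (metis cos.plus_of_int of_real_eq_id id_apply)
  qed
  then show ?thesis unfolding cos_series_def by simp
qed

text \<open>The parabola minus a partial sum has derivative O(1/N) on each interval [y, 1 - y], so
  its increments vanish in the limit. The reference point 1/2 lies in all these intervals.\<close>

lemma cos_series_diff_unit_interval:
  assumes x: "0 < x" "x < 1"
  shows "cos_series x - cos_series (1/2) = pi\<^sup>2 * ((x\<^sup>2 - x) - ((1/2)\<^sup>2 - 1/2))"
proof -
  define y where "y = min x (1 - x)"
  have y: "0 < y" "y \<le> 1/2" "y \<le> x" "x \<le> 1 - y" using x by (auto simp: y_def min_def)
  define Q where "Q = (\<lambda>N x. pi\<^sup>2 * (x\<^sup>2 - x) - (\<Sum>i<N. cos (2 * pi * real (Suc i) * x) / (real (Suc i))\<^sup>2))"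
  define K where "K = 4 * pi\<^sup>2 / (sin (pi * y))\<^sup>2"
  have bound: "norm (Q N x - Q N (1/2)) \<le> K / real (2 * N + 1)" for N
  proof -
    have "norm (Q N x - Q N (1/2)) \<le> K / real (2 * N + 1) * norm (x - 1/2)"
    proof (rule field_differentiable_bound[of "{y..1-y}"])
      fix t assume t: "t \<in> {y..1-y}"
      show "(Q N has_real_derivative pi\<^sup>2 * (2 * t - 1) + 2 * pi * (\<Sum>i<N. sin (2 * pi * real (Suc i) * t) / real (Suc i)))
          (at t within {y..1-y})"
      proof -
        have "((\<lambda>x. cos (2 * pi * real (Suc i) * x) / (real (Suc i))\<^sup>2) has_real_derivative
            - (2 * pi * (sin (2 * pi * real (Suc i) * t) / real (Suc i)))) (at t within {y..1-y})" for i
          by (auto intro!: derivative_eq_intros simp: power2_eq_square simp del: of_nat_Suc)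
        then have "((\<lambda>x. \<Sum>i<N. cos (2 * pi * real (Suc i) * x) / (real (Suc i))\<^sup>2) has_real_derivative
            (\<Sum>i<N. - (2 * pi * (sin (2 * pi * real (Suc i) * t) / real (Suc i))))) (at t within {y..1-y})"
          by (intro DERIV_sum)
        moreover have "((\<lambda>x. pi\<^sup>2 * (x\<^sup>2 - x)) has_real_derivative pi\<^sup>2 * (2 * t - 1)) (at t within {y..1-y})"
          by (auto intro!: derivative_eq_intros)
        ultimately have "(Q N has_real_derivative pi\<^sup>2 * (2 * t - 1) - 
            (\<Sum>i<N. - (2 * pi * (sin (2 * pi * real (Suc i) * t) / real (Suc i))))) (at t within {y..1-y})"
          unfolding Q_def by (intro DERIV_diff)
        then show ?thesis by (simp add: sum_negf sum_distrib_left)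
      qed
      show "norm (pi\<^sup>2 * (2 * t - 1) + 2 * pi * (\<Sum>i<N. sin (2 * pi * real (Suc i) * t) / real (Suc i))) \<le> K / real (2 * N + 1)"
        unfolding K_def real_norm_def by (rule sawtooth_partial_sum_bound) (use y t in auto)
    qed (use y in auto)
    also have "\<dots> \<le> K / real (2 * N + 1) * 1"
      by (intro mult_left_mono) (use x in \<open>auto simp: K_def\<close>)
    finally show ?thesis by simp
  qed
  have "(\<lambda>N. K / real (2 * N + 1)) \<longlonglongrightarrow> 0"
    by (intro tendsto_divide_0[OF tendsto_const] filterlim_at_top_imp_at_infinity
        filterlim_compose[OF filterlim_real_sequentially] filterlim_subseq) (auto simp: strict_mono_def)
  then have "(\<lambda>N. Q N x - Q N (1/2)) \<longlonglongrightarrow> 0"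
    by (rule Lim_null_comparison[rotated]) (use bound in auto)
  moreover have "(\<lambda>N. Q N x - Q N (1/2)) \<longlonglongrightarrow> (pi\<^sup>2 * (x\<^sup>2 - x) - cos_series x) - (pi\<^sup>2 * ((1/2)\<^sup>2 - 1/2) - cos_series (1/2))"
    unfolding Q_def by (intro tendsto_intros cos_series_LIMSEQ)
  ultimately have "(pi\<^sup>2 * (x\<^sup>2 - x) - cos_series x) - (pi\<^sup>2 * ((1/2)\<^sup>2 - 1/2) - cos_series (1/2)) = 0"
    using LIMSEQ_unique by blast
  then show ?thesis by (simp add: algebra_simps)
qed

lemma cos_series_diff_frac:
  "cos_series x - cos_series y = pi\<^sup>2 * (((frac x)\<^sup>2 - frac x) - ((frac y)\<^sup>2 - frac y))"
proof -
  have *: "cos_series x - cos_series (1/2) = pi\<^sup>2 * ((x\<^sup>2 - x) - ((1/2)\<^sup>2 - 1/2))" if "0 \<le> x" "x < 1" for x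
  proof (cases "x = 0")
    case True
    \<comment> \<open>The argument on the open interval says nothing at the integers; continuity of
      the series supplies the value there.\<close>
    have lim: "(cos_series \<longlongrightarrow> cos_series 0) (at_right 0)"
      using continuous_cos_series by (auto simp: continuous_on_def intro: tendsto_within_subset)
    have "((\<lambda>x. cos_series (1/2) + pi\<^sup>2 * ((x\<^sup>2 - x) - ((1/2)\<^sup>2 - 1/2))) \<longlongrightarrow> 
           cos_series (1/2) + pi\<^sup>2 * ((0\<^sup>2 - 0) - ((1/2)\<^sup>2 - 1/2))) (at_right 0)"
      by (intro tendsto_intros)
    moreover have "\<forall>\<^sub>F x in at_right 0. cos_series (1/2) + pi\<^sup>2 * ((x\<^sup>2 - x) - ((1/2)\<^sup>2 - 1/2)) = cos_series x"
      using eventually_at_right_real[of 0 "1::real", OF zero_less_one]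
      by (rule eventually_mono) (use cos_series_diff_unit_interval in \<open>auto simp: algebra_simps\<close>)
    ultimately have "(cos_series \<longlongrightarrow> cos_series (1/2) + pi\<^sup>2 * ((0\<^sup>2 - 0) - ((1/2)\<^sup>2 - 1/2))) (at_right 0)"
      by (rule Lim_transform_eventually)
    from tendsto_unique[OF _ lim this] show ?thesis using True by simp
  next
    case False
    then show ?thesis using cos_series_diff_unit_interval that by simp
  qed
  have "cos_series z - cos_series (1/2) = pi\<^sup>2 * (((frac z)\<^sup>2 - frac z) - ((1/2)\<^sup>2 - 1/2))" for z
    using *[of "frac z"] by (simp only: cos_series_frac frac_lt_1 frac_ge_0)
  from this[of x] this[of y] show ?thesis
    unfolding right_diff_distrib by linarith
qed

section \<open>Sums of the sawtooth function\<close>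

definition saw :: "real \<Rightarrow> real" where
  "saw x = frac x - 1/2"

lemma abs_saw_le: "\<bar>saw x\<bar> \<le> 1/2"
  using frac_lt_1[of x] frac_ge_0[of x] unfolding saw_def abs_le_iff by linarith

text \<open>
  Since \<open>saw\<close> has slope 1 and only downward jumps, averages over an interval of length \<open>d\<close> ending
  or starting at \<open>x\<close> bound \<open>saw x\<close> up to \<open>d\<close>; an antiderivative of \<open>saw\<close> is
  \<open>((frac x)\<^sup>2 - frac x) / 2\<close>.
\<close>

lemma saw_le_average:
  assumes "0 < d" "d \<le> 1"
  shows "saw x \<le> (((frac x)\<^sup>2 - frac x) - ((frac (x - d))\<^sup>2 - frac (x - d))) / (2 * d) + d"
proof -
  define u where "u = frac x"
  have u: "0 \<le> u" "u < 1" by (auto simp: u_def frac_lt_1)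
  have "2 * d * (u - 1/2 - d) \<le> (u\<^sup>2 - u) - ((frac (x - d))\<^sup>2 - frac (x - d))"
  proof (cases "d \<le> u")
    case True
    have "frac (x - d) = u - d"
      unfolding frac_unique_iff using True u assms by (simp add: u_def frac_def)
    moreover have "(u\<^sup>2 - u) - ((u - d)\<^sup>2 - (u - d)) - 2 * d * (u - 1/2 - d) = d\<^sup>2"
      by (simp add: power2_eq_square algebra_simps)
    ultimately show ?thesis using zero_le_power2[of d] by (smt (verit))
  next
    \<comment> \<open>The step to the left crosses one integer. The jump there contributes
      \<open>2 * (d - u)\<close>, which has the favourable sign.\<close>
    case False
    have "x - d - (u - d + 1) = of_int (floor x - 1)" by (simp add: u_def frac_def)
    then have "frac (x - d) = u - d + 1"
      unfolding frac_unique_iff using False u assms by (auto simp del: of_int_diff)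
    moreover have "(u\<^sup>2 - u) - ((u - d + 1)\<^sup>2 - (u - d + 1)) - 2 * d * (u - 1/2 - d) = d\<^sup>2 + 2 * (d - u)"
      by (simp add: power2_eq_square algebra_simps)
    ultimately show ?thesis using False zero_le_power2[of d] by (smt (verit))
  qed
  then have "u - 1/2 - d \<le> ((u\<^sup>2 - u) - ((frac (x - d))\<^sup>2 - frac (x - d))) / (2 * d)"
    using assms by (subst pos_le_divide_eq) (auto simp: algebra_simps)
  then show ?thesis by (simp add: u_def saw_def)
qed

lemma saw_ge_average:
  assumes "0 < d" "d \<le> 1"
  shows "(((frac (x + d))\<^sup>2 - frac (x + d)) - ((frac x)\<^sup>2 - frac x)) / (2 * d) - d \<le> saw x"
proof -
  define u where "u = frac x"
  have u: "0 \<le> u" "u < 1" by (auto simp: u_def frac_lt_1)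
  have "((frac (x + d))\<^sup>2 - frac (x + d)) - (u\<^sup>2 - u) \<le> 2 * d * (u - 1/2 + d)"
  proof (cases "u + d < 1")
    case True
    have "frac (x + d) = u + d"
      unfolding frac_unique_iff using True u assms by (simp add: u_def frac_def)
    moreover have "2 * d * (u - 1/2 + d) - (((u + d)\<^sup>2 - (u + d)) - (u\<^sup>2 - u)) = d\<^sup>2"
      by (simp add: power2_eq_square algebra_simps)
    ultimately show ?thesis using zero_le_power2[of d] by (smt (verit))
  next
    case False
    have "frac (x + d) = u + d - 1"
      unfolding frac_unique_iff using False u assms by (simp add: u_def frac_def)
    moreover have "2 * d * (u - 1/2 + d) - (((u + d - 1)\<^sup>2 - (u + d - 1)) - (u\<^sup>2 - u)) = d\<^sup>2 + 2 * (u + d - 1)"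
      by (simp add: power2_eq_square algebra_simps)
    ultimately show ?thesis using False zero_le_power2[of d] by (smt (verit))
  qed
  then have "(((frac (x + d))\<^sup>2 - frac (x + d)) - (u\<^sup>2 - u)) / (2 * d) \<le> u - 1/2 + d"
    using assms by (subst pos_divide_le_eq) (auto simp: algebra_simps)
  then show ?thesis by (simp add: u_def saw_def)
qed

section \<open>From sawtooth sums to exponential sums\<close>

lemma norm_cis_diff_one_le: "norm (cis t - 1) \<le> min 2 \<bar>t\<bar>"
proof -
  have "norm (cis t - 1) = 2 * \<bar>sin (t / 2)\<bar>"
    using dist_exp_i_1[of t] by (simp add: cis_conv_exp)
  moreover have "\<bar>sin (t / 2)\<bar> \<le> \<bar>t / 2\<bar>" by (rule abs_sin_x_le_abs_x)
  moreover have "\<bar>sin (t / 2)\<bar> \<le> 1" by simp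
  ultimately show ?thesis by (auto simp: min_def)
qed

text \<open>A shift by \<open>d\<close> multiplies the component of frequency n by a factor of
  modulus at most 2 pi min(1, n / H). With the coefficients 1 / n^2 this produces the weights 1 / n
  for n up to H and H / n^2 beyond. The bound holds for every partial sum and passes to the
  limit.\<close>

lemma sum_cos_series_shift_bound:
  fixes x :: "nat \<Rightarrow> real" and H :: nat
  assumes H: "H \<ge> 1" and d: "\<bar>d\<bar> = 1 / real H" 
    and U: "\<And>N. (\<Sum>i<N. min 1 (real (Suc i) / real H) * real H / (real (Suc i))\<^sup>2 *
               norm (\<Sum>j\<in>A. cis (2 * pi * real (Suc i) * x j))) \<le> U"
  shows "real H * \<bar>\<Sum>j\<in>A. cos_series (x j + d) - cos_series (x j)\<bar> \<le> 2 * pi * U"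
proof -
  define S where "S = (\<lambda>i. \<Sum>j\<in>A. cis (2 * pi * real (Suc i) * x j))"
  define T where "T = (\<lambda>N. \<Sum>j\<in>A. (\<Sum>i<N. cos (2 * pi * real (Suc i) * (x j + d)) / (real (Suc i))\<^sup>2)
                                 - (\<Sum>i<N. cos (2 * pi * real (Suc i) * x j) / (real (Suc i))\<^sup>2))"
  have summand: "real H * (\<bar>\<Sum>j\<in>A. cos (2 * pi * real (Suc i) * (x j + d)) - cos (2 * pi * real (Suc i) * x j)\<bar> / (real (Suc i))\<^sup>2)
      \<le> 2 * pi * (min 1 (real (Suc i) / real H) * real H / (real (Suc i))\<^sup>2 * norm (S i))" for i
  proof -
    define w where "w = 2 * pi * real (Suc i) * d"
    have "(\<Sum>j\<in>A. cos (2 * pi * real (Suc i) * (x j + d)) - cos (2 * pi * real (Suc i) * x j))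
        = Re (\<Sum>j\<in>A. (cis w - 1) * cis (2 * pi * real (Suc i) * x j))"
      unfolding Re_sum
      by (intro sum.cong) (auto simp: left_diff_distrib cis_mult w_def algebra_simps)
    also have "\<bar>\<dots>\<bar> \<le> norm (\<Sum>j\<in>A. (cis w - 1) * cis (2 * pi * real (Suc i) * x j))"
      by (rule abs_Re_le_cmod)
    also have "\<dots> = norm (cis w - 1) * norm (S i)"
      unfolding S_def by (simp add: sum_distrib_left[symmetric] norm_mult)
    also have "\<dots> \<le> (2 * pi * min 1 (real (Suc i) / real H)) * norm (S i)"
    proof (rule mult_right_mono)
      have "\<bar>w\<bar> = 2 * pi * (real (Suc i) / real H)" using d by (simp add: w_def abs_mult)
      then have "norm (cis w - 1) \<le> min 2 (2 * pi * (real (Suc i) / real H))"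
        using norm_cis_diff_one_le[of w] by simp
      also have "\<dots> \<le> 2 * pi * min 1 (real (Suc i) / real H)"
      proof (cases "1 \<le> real (Suc i) / real H")
        case False
        then show ?thesis by (simp add: min_def)
      qed (use pi_gt3 in \<open>auto simp: min_def\<close>)
      finally show "norm (cis w - 1) \<le> 2 * pi * min 1 (real (Suc i) / real H)" .
    qed simp
    finally have "real H / (real (Suc i))\<^sup>2 * \<bar>\<Sum>j\<in>A. cos (2 * pi * real (Suc i) * (x j + d)) - cos (2 * pi * real (Suc i) * x j)\<bar>
      \<le> real H / (real (Suc i))\<^sup>2 * ((2 * pi * min 1 (real (Suc i) / real H)) * norm (S i))"
      by (intro mult_left_mono) auto
    then show ?thesis by (simp add: algebra_simps)
  qed
  have bound: "real H * \<bar>T N\<bar> \<le> 2 * pi * U" for N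
  proof -
    have "T N = (\<Sum>i<N. (\<Sum>j\<in>A. cos (2 * pi * real (Suc i) * (x j + d)) - cos (2 * pi * real (Suc i) * x j)) / (real (Suc i))\<^sup>2)"
      unfolding T_def sum_subtractf[symmetric] sum_divide_distrib diff_divide_distrib[symmetric]
      by (rule sum.swap)
    then have "\<bar>T N\<bar> \<le> (\<Sum>i<N. \<bar>\<Sum>j\<in>A. cos (2 * pi * real (Suc i) * (x j + d)) - cos (2 * pi * real (Suc i) * x j)\<bar> / (real (Suc i))\<^sup>2)"
      by (auto intro!: order_trans[OF sum_abs] sum_mono)
    then have "real H * \<bar>T N\<bar> \<le> real H * (\<Sum>i<N. \<bar>\<Sum>j\<in>A. cos (2 * pi * real (Suc i) * (x j + d)) - cos (2 * pi * real (Suc i) * x j)\<bar> / (real (Suc i))\<^sup>2)"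
      by (intro mult_left_mono) auto
    also have "\<dots> \<le> (\<Sum>i<N. 2 * pi * (min 1 (real (Suc i) / real H) * real H / (real (Suc i))\<^sup>2 * norm (S i)))"
      unfolding sum_distrib_left by (intro sum_mono summand)
    also have "\<dots> \<le> 2 * pi * U"
      unfolding sum_distrib_left[symmetric] S_def by (intro mult_left_mono U) auto
    finally show ?thesis .
  qed
  have "T \<longlonglongrightarrow> (\<Sum>j\<in>A. cos_series (x j + d) - cos_series (x j))"
    unfolding T_def by (intro tendsto_intros cos_series_LIMSEQ)
  then have "(\<lambda>N. real H * \<bar>T N\<bar>) \<longlonglongrightarrow> real H * \<bar>\<Sum>j\<in>A. cos_series (x j + d) - cos_series (x j)\<bar>"
    by (intro tendsto_intros)
  then show ?thesis
    by (rule LIMSEQ_le_const2) (use bound in auto)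
qed

text \<open>An inequality of Erdos-Turan type. Difference quotients of the antiderivative over steps
  of length 1 / H replace \<open>saw\<close> at a cost of 1 / H per term, and their Fourier series
  converge absolutely. The upper bound steps to the left, the lower bound to the right.\<close>

lemma sum_saw_le_exponential_sums:
  fixes x :: "nat \<Rightarrow> real" and H :: nat
  assumes H: "H \<ge> 1"
    and U: "\<And>N. (\<Sum>i<N. min 1 (real (Suc i) / real H) * real H / (real (Suc i))\<^sup>2 *
               norm (\<Sum>j\<in>A. cis (2 * pi * real (Suc i) * x j))) \<le> U"
  shows "\<bar>\<Sum>j\<in>A. saw (x j)\<bar> \<le> real (card A) / real H + U"
proof -
  define P where "P = (\<lambda>x::real. (frac x)\<^sup>2 - frac x)"
  define d where "d = 1 / real H"
  have d: "0 < d" "d \<le> 1" using H by (auto simp: d_def)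
  have U0: "0 \<le> U" using U[of 0] by simp
  have P: "cos_series a - cos_series b = pi\<^sup>2 * (P a - P b)" for a b
    unfolding P_def by (rule cos_series_diff_frac)
  have main: "\<bar>(\<Sum>j\<in>A. P (x j + t) - P (x j))\<bar> / (2 * d) \<le> U" if t: "\<bar>t\<bar> = 1 / real H" for t
  proof -
    have "real H * (pi\<^sup>2 * \<bar>\<Sum>j\<in>A. P (x j + t) - P (x j)\<bar>) \<le> 2 * pi * U"
      using sum_cos_series_shift_bound[OF H t U]
      by (simp add: P sum_distrib_left[symmetric] abs_mult)
    then have "pi * (pi * (real H * \<bar>\<Sum>j\<in>A. P (x j + t) - P (x j)\<bar>)) \<le> pi * (2 * U)"
      by (simp add: power2_eq_square mult_ac)
    then have "pi * (real H * \<bar>\<Sum>j\<in>A. P (x j + t) - P (x j)\<bar>) \<le> 2 * U" 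
      using mult_le_cancel_left_pos[OF pi_gt_zero] by blast
    \<comment> \<open>One factor \<open>pi\<close> has been cancelled; the other is only bounded
      below by 1.\<close>
    moreover have "1 * (real H * \<bar>\<Sum>j\<in>A. P (x j + t) - P (x j)\<bar>) \<le> pi * (real H * \<bar>\<Sum>j\<in>A. P (x j + t) - P (x j)\<bar>)"
      using pi_gt3 by (intro mult_right_mono) auto
    ultimately have "real H * \<bar>\<Sum>j\<in>A. P (x j + t) - P (x j)\<bar> \<le> 2 * U" by linarith
    then show ?thesis by (simp add: d_def mult.commute)
  qed
  have card: "(\<Sum>j\<in>A. d) = real (card A) / real H" by (simp add: d_def)
  have neg: "- (X / (2 * d)) \<le> \<bar>X\<bar> / (2 * d)" for X
    using divide_right_mono[OF abs_ge_minus_self[of X], of "2 * d"] d by simp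
  have "(\<Sum>j\<in>A. saw (x j)) \<le> (\<Sum>j\<in>A. (P (x j) - P (x j - d)) / (2 * d) + d)"
    unfolding P_def using saw_le_average[OF d] by (intro sum_mono) auto
  also have "\<dots> = - ((\<Sum>j\<in>A. P (x j + - d) - P (x j)) / (2 * d)) + real (card A) / real H"
  proof -
    have "(\<Sum>j\<in>A. (P (x j) - P (x j - d)) / (2 * d) + d) = (\<Sum>j\<in>A. - ((P (x j + - d) - P (x j)) / (2 * d)) + d)"
      by (intro sum.cong) (auto simp: diff_divide_distrib)
    then show ?thesis unfolding sum.distrib sum_negf sum_divide_distrib[symmetric] card .
  qed
  also have "\<dots> \<le> \<bar>\<Sum>j\<in>A. P (x j + - d) - P (x j)\<bar> / (2 * d) + real (card A) / real H"
    using neg by simp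
  also have "\<dots> \<le> U + real (card A) / real H"
    using main[of "-d"] d by (simp add: d_def)
  finally have upper: "(\<Sum>j\<in>A. saw (x j)) \<le> real (card A) / real H + U" by simp
  have "- (\<Sum>j\<in>A. saw (x j)) \<le> - (\<Sum>j\<in>A. (P (x j + d) - P (x j)) / (2 * d) - d)"
    unfolding P_def neg_le_iff_le using saw_ge_average[OF d] by (intro sum_mono) auto
  also have "\<dots> = - ((\<Sum>j\<in>A. P (x j + d) - P (x j)) / (2 * d)) + real (card A) / real H"
    unfolding sum_subtractf[of _ "\<lambda>_. d"] card
    unfolding sum_divide_distrib[symmetric] by linarith
  also have "\<dots> \<le> \<bar>\<Sum>j\<in>A. P (x j + d) - P (x j)\<bar> / (2 * d) + real (card A) / real H"
    using neg by simp
  also have "\<dots> \<le> U + real (card A) / real H"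
    using main[of d] d by (simp add: d_def)
  finally show ?thesis using upper by simp
qed

text \<open>A weak form of Jordan's inequality: up to the angle pi/3 the cosine is at least 1/2, and
  beyond it the sine exceeds 1/2.\<close>

lemma sin_pi_times_ge:
  assumes "0 \<le> t" "t \<le> 1/2" shows "t \<le> sin (pi * t)"
proof (cases "pi * t \<le> pi / 3")
  case True
  show ?thesis
  proof (cases "t = 0")
    case False
    then have pos: "0 < pi * t" using assms by simp
    obtain z where z: "0 < z" "z < pi * t" "sin (pi * t) - sin 0 = (pi * t - 0) * cos z"
      using MVT2[OF pos, of sin cos] by (auto intro: DERIV_sin)
    have "cos (pi/3) \<le> cos z" using z True pos pi_gt_zero by (intro cos_monotone_0_pi_le) linarith+
    then have "1/2 \<le> cos z" by (simp add: cos_60)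
    then have "pi * t * (1/2) \<le> pi * t * cos z" using pos by (intro mult_left_mono) auto
    then have "pi * t * (1/2) \<le> sin (pi * t)" using z(3) by (simp only: sin_zero diff_zero)
    moreover have "2 * t \<le> pi * t" using pi_gt3 assms by (intro mult_right_mono) auto
    ultimately show ?thesis by linarith
  qed simp
next
  case False
  then have "sin (pi/3) \<le> sin (pi * t)"
    using assms by (intro sin_monotone_2pi_le) (auto simp: field_simps)
  moreover have "sqrt 3 \<ge> 1" by simp
  ultimately show ?thesis using assms unfolding sin_60 by linarith
qed

lemma sin_pi_times_ge_symmetric:
  assumes "0 \<le> \<tau>" "\<tau> \<le> t" "t \<le> 1 - \<tau>" shows "\<tau> \<le> sin (pi * t)"
proof (cases "t \<le> 1/2")
  case True
  then show ?thesis using sin_pi_times_ge[of t] assms by simp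
next
  case False
  then have "\<tau> \<le> sin (pi * (1 - t))" using sin_pi_times_ge[of "1 - t"] assms by simp
  also have "\<dots> = sin (pi * t)" using sin_pi_minus[of "pi * t"] by (simp add: algebra_simps)
  finally show ?thesis .
qed

section \<open>Exponential sums\<close>

text \<open>Summation by parts. \<open>c (t j)\<close> is the inverse of
  \<open>cis (2 * pi * t j) - 1\<close>, so \<open>z j = c (t j) * (z (Suc j) - z j)\<close>. The
  real part of \<open>c\<close> is constant and its imaginary part is a multiple of the cotangent,
  which is monotone in \<open>t\<close>, so the total variation telescopes.\<close>

lemma kusmin_landau:
  fixes z :: "nat \<Rightarrow> complex" and t :: "nat \<Rightarrow> real"
  assumes \<tau>: "0 < \<tau>" and ab: "a < b"
    and t: "\<And>j. a \<le> j \<Longrightarrow> j < b \<Longrightarrow> \<tau> \<le> t j \<and> t j \<le> 1 - \<tau>"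
    and mono: "\<And>j. a \<le> j \<Longrightarrow> Suc j < b \<Longrightarrow> t j \<le> t (Suc j)"
    and z: "\<And>j. a \<le> j \<Longrightarrow> j < b \<Longrightarrow> z (Suc j) = cis (2 * pi * t j) * z j"
    and nz: "\<And>j. norm (z j) = 1"
  shows "norm (\<Sum>j\<in>{a..<b}. z j) \<le> 3 / \<tau>"
proof -
  define ct where "ct = (\<lambda>u. cos (pi * u) / sin (pi * u))"
  define c where "c = (\<lambda>u. Complex (-1/2) (- ct u / 2))"
  have s: "\<tau> \<le> sin (pi * t j)" if "a \<le> j" "j < b" for j
    using sin_pi_times_ge_symmetric[of \<tau> "t j"] t[OF that] \<tau> by auto
  have c_inv: "c (t j) * (cis (2 * pi * t j) - 1) = 1" if j: "a \<le> j" "j < b" for j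
  proof -
    have S: "sin (pi * t j) \<noteq> 0" using s[OF j] \<tau> by auto
    have "cis (2 * pi * t j) - 1 = Complex (- 2 * (sin (pi * t j))\<^sup>2) (2 * sin (pi * t j) * cos (pi * t j))"
      by (simp add: complex_eq_iff mult.assoc cos_double_sin sin_double)
    moreover have "Complex (-1/2) (- (C / S) / 2) * Complex (- 2 * S\<^sup>2) (2 * S * C) = 1"
      if "S \<noteq> 0" "S\<^sup>2 + C\<^sup>2 = 1" for S C :: real
      using that by (simp add: complex_eq_iff power2_eq_square)
    ultimately show ?thesis using S sin_cos_squared_add[of "pi * t j"] unfolding c_def ct_def by metis
  qed
  have ct_bound: "\<bar>ct (t j)\<bar> \<le> 1 / \<tau>" if j: "a \<le> j" "j < b" for j
    using s[OF j] \<tau> unfolding ct_def abs_divide by (intro frac_le) auto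
  have "\<tau> \<le> 1" using t[of a] ab \<tau> by auto
  then have \<tau>1: "1 \<le> 1 / \<tau>" using \<tau> by simp
  have c_bound: "norm (c (t j)) \<le> 1 / \<tau>" if j: "a \<le> j" "j < b" for j
    using cmod_le[of "c (t j)"] ct_bound[OF j] \<tau>1 by (simp add: c_def)
  have ct_mono: "ct (t (Suc j)) \<le> ct (t j)" if j: "a \<le> j" "Suc j < b" for j
  proof -
    have S: "sin (pi * t j) > 0" "sin (pi * t (Suc j)) > 0" using s[of j] s[of "Suc j"] j \<tau> by auto
    have "0 \<le> pi * (t (Suc j) - t j)" using mono[OF j] by simp
    moreover have "pi * (t (Suc j) - t j) \<le> pi * 1"
      using t[of j] t[of "Suc j"] j \<tau> by (intro mult_left_mono) auto
    ultimately have "0 \<le> sin (pi * (t (Suc j) - t j))" by (intro sin_ge_zero) auto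
    then have "0 \<le> sin (pi * t (Suc j)) * cos (pi * t j) - cos (pi * t (Suc j)) * sin (pi * t j)"
      by (simp add: right_diff_distrib sin_diff)
    then show ?thesis unfolding ct_def using S by (simp add: field_simps)
  qed
  \<comment> \<open>The subtracted product is the boundary term at the upper end; the difference of
    cotangents is the variation accumulated so far.\<close>
  have "norm ((\<Sum>j\<in>{a..<Suc n}. z j) - c (t n) * z (Suc n)) \<le> 1 / \<tau> + (ct (t a) - ct (t n)) / 2" if "a \<le> n" "n < b" for n
    using that
  proof (induction n rule: dec_induct)
    case base
    have "z a = c (t a) * (cis (2 * pi * t a) - 1) * z a" using c_inv[of a] ab by simp
    also have "\<dots> = c (t a) * z (Suc a) - c (t a) * z a" using z[of a] ab by (simp add: algebra_simps)
    finally have "z a - c (t a) * z (Suc a) = (c (t a) * z (Suc a) - c (t a) * z a) - c (t a) * z (Suc a)"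
      by (rule arg_cong)
    then have "z a - c (t a) * z (Suc a) = - (c (t a) * z a)" by simp
    then show ?case using c_bound[of a] ab nz by (simp add: norm_mult)
  next
    case (step n)
    have n: "a \<le> Suc n" "Suc n < b" "a \<le> n" "n < b" using step by auto
    have "z (Suc n) = c (t (Suc n)) * (cis (2 * pi * t (Suc n)) - 1) * z (Suc n)" using c_inv[of "Suc n"] n by simp
    also have "\<dots> = c (t (Suc n)) * z (Suc (Suc n)) - c (t (Suc n)) * z (Suc n)" using z[of "Suc n"] n by (simp add: algebra_simps)
    finally have "(\<Sum>j\<in>{a..<Suc (Suc n)}. z j) - c (t (Suc n)) * z (Suc (Suc n))
        = ((\<Sum>j\<in>{a..<Suc n}. z j) - c (t n) * z (Suc n)) + (c (t n) - c (t (Suc n))) * z (Suc n)"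
      using n by (simp add: algebra_simps)
    also have "norm \<dots> \<le> (1 / \<tau> + (ct (t a) - ct (t n)) / 2) + (ct (t n) - ct (t (Suc n))) / 2"
    proof (rule norm_triangle_mono)
      have "c (t n) - c (t (Suc n)) = Complex 0 ((ct (t (Suc n)) - ct (t n)) / 2)"
        by (simp add: c_def complex_eq_iff field_simps)
      then have "norm (c (t n) - c (t (Suc n))) = (ct (t n) - ct (t (Suc n))) / 2"
        using ct_mono[of n] n by (simp add: norm_complex_def)
      then show "norm ((c (t n) - c (t (Suc n))) * z (Suc n)) \<le> (ct (t n) - ct (t (Suc n))) / 2"
        by (simp add: norm_mult nz)
    qed (use step n in auto)
    finally show ?case by (simp add: field_simps)
  qed
  from this[of "b - 1"] have *: "norm ((\<Sum>j\<in>{a..<b}. z j) - c (t (b - 1)) * z b) \<le> 1 / \<tau> + (ct (t a) - ct (t (b - 1))) / 2"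
    using ab by simp
  have "norm (\<Sum>j\<in>{a..<b}. z j) \<le> norm ((\<Sum>j\<in>{a..<b}. z j) - c (t (b - 1)) * z b) + norm (c (t (b - 1)) * z b)"
    using norm_triangle_sub by (metis add.commute)
  also have "\<dots> \<le> (1 / \<tau> + (1 / \<tau> + 1 / \<tau>) / 2) + 1 / \<tau>"
  proof -
    have b: "a \<le> b - 1" "b - 1 < b" using ab by auto
    have "norm (c (t (b - 1)) * z b) \<le> 1 / \<tau>" using c_bound[OF b] by (simp add: norm_mult nz)
    moreover have "\<bar>ct (t a)\<bar> \<le> 1 / \<tau>" using ct_bound[of a] ab by simp
    moreover have "(ct (t a) - ct (t (b - 1))) / 2 \<le> (1 / \<tau> + 1 / \<tau>) / 2"
      using \<open>\<bar>ct (t a)\<bar> \<le> 1 / \<tau>\<close> ct_bound[OF b] by (intro divide_right_mono) auto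
    ultimately show ?thesis using * by (intro add_mono order_trans[OF *] order_refl)
  qed
  finally show ?thesis by simp
qed

section \<open>Van der Corput's second difference test\<close>

lemma spaced_diff:
  fixes \<theta> :: "nat \<Rightarrow> real"
  assumes sp: "\<And>j. Suc j < n \<Longrightarrow> \<theta> j + \<Lambda> \<le> \<theta> (Suc j)" and "i \<le> j" "j < n"
  shows "\<theta> i + \<Lambda> * real (j - i) \<le> \<theta> j"
  using assms(2,3)
proof (induction j rule: dec_induct)
  case (step j)
  then show ?case using sp[of j] by (simp add: Suc_diff_le algebra_simps)
qed simp

lemma card_spaced_le:
  fixes \<theta> :: "nat \<Rightarrow> real"
  assumes sp: "\<And>j. Suc j < n \<Longrightarrow> \<theta> j + \<Lambda> \<le> \<theta> (Suc j)" and \<Lambda>: "\<Lambda> > 0" and "l \<ge> 0"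
    and A: "A \<subseteq> {j. j < n \<and> u \<le> \<theta> j \<and> \<theta> j \<le> u + l}"
  shows "real (card A) \<le> l / \<Lambda> + 1"
proof (cases "A = {}")
  case True
  then show ?thesis using assms by simp
next
  case False
  have fin: "finite A" using A by (rule finite_subset) simp
  define a b where "a = Min A" and "b = Max A"
  have ab: "a \<in> A" "b \<in> A" "a \<le> b" using fin False by (auto simp: a_def b_def)
  have "A \<subseteq> {a..b}" using fin by (auto simp: a_def b_def)
  then have "card A \<le> b - a + 1" using card_mono[of "{a..b}" A] ab by (simp add: Suc_diff_le)
  then have card: "real (card A) \<le> real (b - a) + 1" by linarith
  have "\<theta> a + \<Lambda> * real (b - a) \<le> \<theta> b"
    by (rule spaced_diff[where \<theta> = \<theta> and \<Lambda> = \<Lambda>, OF sp]) (use ab A in auto)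
  moreover have "u \<le> \<theta> a" "\<theta> b \<le> u + l" using ab A by auto
  ultimately have "\<Lambda> * real (b - a) \<le> l" by linarith
  then have "real (b - a) \<le> l / \<Lambda>" using \<Lambda> by (simp add: field_simps)
  with card show ?thesis by simp
qed

text \<open>The indices are sorted by the integer part of \<open>\<theta>\<close>, with at most
  \<open>W + 2\<close> classes. In a class, the indices whose \<open>\<theta>\<close> keeps distance
  \<open>\<tau>\<close> from the integers form an interval to which Kusmin-Landau applies; the
  others are few because \<open>\<theta>\<close> is spaced by \<open>\<Lambda>\<close>.\<close>

lemma second_difference_test:
  fixes x \<theta> :: "nat \<Rightarrow> real"
  defines "\<theta> \<equiv> \<lambda>j. x (Suc j) - x j"
  assumes sp: "\<And>j. Suc j < n \<Longrightarrow> \<theta> j + \<Lambda> \<le> \<theta> (Suc j)" and \<Lambda>: "\<Lambda> > 0" and W: "0 \<le> W"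
    and range: "n > 0 \<Longrightarrow> \<theta> (n - 1) - \<theta> 0 \<le> W"
  shows "norm (\<Sum>j<n. cis (2 * pi * x j)) \<le> 12 * (W + 1) / sqrt \<Lambda> + 2 * sqrt \<Lambda>"
proof (cases "n = 0")
  case True
  then show ?thesis using \<Lambda> W by simp
next
  case False
  have le: "\<theta> i \<le> \<theta> j" if "i \<le> j" "j < n" for i j
    using spaced_diff[where \<theta> = \<theta> and \<Lambda> = \<Lambda>, OF sp that] \<Lambda> by (smt (verit) mult_nonneg_nonneg of_nat_0_le_iff)
  show ?thesis
  proof (cases "\<Lambda> \<le> 1/4")
    \<comment> \<open>For large \<open>\<Lambda>\<close> the trivial bound suffices: spacing leaves
      at most \<open>W / \<Lambda> + 1\<close> terms, and the last 1 is absorbed by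
      \<open>2 * sqrt \<Lambda>\<close>.\<close>
    case \<Lambda>4: False
    have up: "\<theta> j \<le> \<theta> 0 + W" if "j < n" for j
    proof -
      have "\<theta> j \<le> \<theta> (n - 1)" using that by (intro le) auto
      then show ?thesis using range False by auto
    qed
    have "real (card {..<n}) \<le> W / \<Lambda> + 1"
      by (rule card_spaced_le[where \<theta> = \<theta> and u = "\<theta> 0", OF sp \<Lambda> W]) (use le[of 0] up in auto)
    then have n: "real n \<le> W / \<Lambda> + 1" by simp
    have "sqrt (1/4) \<le> sqrt \<Lambda>" using \<Lambda>4 by (intro real_sqrt_le_mono) simp
    then have r: "1/2 \<le> sqrt \<Lambda>" by (simp add: real_sqrt_divide)
    have "W / \<Lambda> = W / sqrt \<Lambda> / sqrt \<Lambda>" using \<Lambda> by simp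
    also have "\<dots> \<le> W / sqrt \<Lambda> / (1/2)" using r W \<Lambda> by (intro divide_left_mono) auto
    finally have "W / \<Lambda> \<le> 2 * (W / sqrt \<Lambda>)" by (simp add: mult.commute)
    moreover have "W / sqrt \<Lambda> \<ge> 0" "1 / sqrt \<Lambda> \<ge> 0" using W \<Lambda> by auto
    moreover have "norm (\<Sum>j<n. cis (2 * pi * x j)) \<le> real n"
      by (rule order_trans[OF sum_norm_le[of _ _ "\<lambda>_. 1"]]) auto
    moreover have "12 * (W + 1) / sqrt \<Lambda> = 12 * (W / sqrt \<Lambda>) + 12 * (1 / sqrt \<Lambda>)"
      by (simp add: distrib_left add_divide_distrib)
    ultimately show ?thesis using n r by linarith
  next
    case True
    \<comment> \<open>Balances \<open>3 / \<tau>\<close> from Kusmin-Landau against the number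
      \<open>\<tau> / \<Lambda>\<close> of indices near an integer.\<close>
    define \<tau> where "\<tau> = sqrt \<Lambda>"
    have \<tau>: "\<tau> > 0" "\<tau> * \<tau> = \<Lambda>" using \<Lambda> by (auto simp: \<tau>_def)
    have "\<tau> \<le> sqrt (1/4)" unfolding \<tau>_def using True by (intro real_sqrt_le_mono) simp
    then have \<tau>2: "\<tau> \<le> 1/2" by (simp add: real_sqrt_divide)
    have cls: "norm (\<Sum>j\<in>{j\<in>{..<n}. \<lfloor>\<theta> j\<rfloor> = k}. cis (2 * pi * x j)) \<le> 6 / \<tau>" for k
    proof -
      define C where "C = {j\<in>{..<n}. \<lfloor>\<theta> j\<rfloor> = k}"
      define G where "G = {j. j < n \<and> k + \<tau> \<le> \<theta> j \<and> \<theta> j \<le> k + 1 - \<tau>}"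
      have fin: "finite C" "finite G" by (auto simp: C_def G_def)
      have GC: "G \<subseteq> C" unfolding G_def C_def using \<tau> by (auto simp: floor_eq_iff)
      have "norm (sum (\<lambda>j. cis (2 * pi * x j)) G) \<le> 3 / \<tau>"
      proof (cases "G = {}")
        case True
        then show ?thesis using \<tau> by simp
      next
        case False
        define a b where "a = Min G" and "b = Suc (Max G)"
        have ab: "a \<in> G" "b - 1 \<in> G" "a < b" using fin False by (auto simp: a_def b_def less_Suc_eq_le)
        have G: "G = {a..<b}"
        proof
          show "G \<subseteq> {a..<b}" using fin by (auto simp: a_def b_def less_Suc_eq_le)
          show "{a..<b} \<subseteq> G"
          proof
            fix j assume j: "j \<in> {a..<b}"
            have "b - 1 < n" using ab by (auto simp: G_def)
            with j have "j < n" by auto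
            moreover have "\<theta> a \<le> \<theta> j" "\<theta> j \<le> \<theta> (b - 1)" using j \<open>j < n\<close> \<open>b - 1 < n\<close> by (auto intro!: le)
            ultimately show "j \<in> G" using ab by (auto simp: G_def)
          qed
        qed
        have bn: "b \<le> n" using ab by (auto simp: G_def)
        show ?thesis unfolding G
        proof (rule kusmin_landau[OF \<tau>(1) ab(3), where t = "\<lambda>j. \<theta> j - of_int k"])
          fix j assume j: "a \<le> j" "j < b"
          then have "j \<in> G" unfolding G by simp
          then show "\<tau> \<le> \<theta> j - of_int k \<and> \<theta> j - of_int k \<le> 1 - \<tau>" by (auto simp: G_def)
          have "cis (2 * pi * (\<theta> j - of_int k)) * cis (2 * pi * x j) = cis (2 * pi * x (Suc j) + 2 * pi * of_int (- k))"
            unfolding cis_mult \<theta>_def by (simp add: algebra_simps)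
          also have "\<dots> = cis (2 * pi * x (Suc j)) * cis (2 * pi * of_int (- k))" by (simp only: cis_mult)
          also have "cis (2 * pi * of_int (- k)) = 1" by (rule cis_multiple_2pi) simp
          finally show "cis (2 * pi * x (Suc j)) = cis (2 * pi * (\<theta> j - of_int k)) * cis (2 * pi * x j)" by simp
        next
          fix j assume "a \<le> j" "Suc j < b"
          then show "\<theta> j - of_int k \<le> \<theta> (Suc j) - of_int k" using bn le[of j "Suc j"] by simp
        qed simp
      qed
      moreover have "norm (sum (\<lambda>j. cis (2 * pi * x j)) (C - G)) \<le> 2 * (\<tau> / \<Lambda> + 1)"
      proof -
        have "C - G \<subseteq> {j. j < n \<and> of_int k \<le> \<theta> j \<and> \<theta> j \<le> of_int k + \<tau>} \<union> {j. j < n \<and> of_int k + 1 - \<tau> \<le> \<theta> j \<and> \<theta> j \<le> (of_int k + 1 - \<tau>) + \<tau>}"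
          (is "_ \<subseteq> ?L \<union> ?R")
          unfolding C_def G_def by (auto simp: floor_eq_iff)
        then have "card (C - G) \<le> card (?L \<union> ?R)" by (intro card_mono) auto
        also have "\<dots> \<le> card ?L + card ?R" by (rule card_Un_le)
        finally have "real (card (C - G)) \<le> real (card ?L) + real (card ?R)" by linarith
        moreover have "real (card ?L) \<le> \<tau> / \<Lambda> + 1" "real (card ?R) \<le> \<tau> / \<Lambda> + 1"
          by (rule card_spaced_le[where \<theta> = \<theta> and l = \<tau>, OF sp \<Lambda>]; use \<tau> in auto)+
        moreover have "norm (sum (\<lambda>j. cis (2 * pi * x j)) (C - G)) \<le> real (card (C - G))"
          by (rule order_trans[OF sum_norm_le[of _ _ "\<lambda>_. 1"]]) auto
        ultimately show ?thesis by (smt (verit))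
      qed
      moreover have "sum (\<lambda>j. cis (2 * pi * x j)) C = sum (\<lambda>j. cis (2 * pi * x j)) (C - G) + sum (\<lambda>j. cis (2 * pi * x j)) G"
        by (rule sum.subset_diff[OF GC fin(1)])
      ultimately have "norm (sum (\<lambda>j. cis (2 * pi * x j)) C) \<le> 2 * (\<tau> / \<Lambda> + 1) + 3 / \<tau>"
        by (metis norm_triangle_mono)
      also have "\<tau> / \<Lambda> = 1 / \<tau>" using \<tau> \<Lambda> by (simp add: field_simps)
      also have "2 * (1 / \<tau> + 1) + 3 / \<tau> \<le> 6 / \<tau>" using \<tau> \<tau>2 by (simp add: field_simps)
      finally show ?thesis unfolding C_def .
    qed
    define K where "K = (\<lambda>j. \<lfloor>\<theta> j\<rfloor>) ` {..<n}"
    have "K \<subseteq> {\<lfloor>\<theta> 0\<rfloor>..\<lfloor>\<theta> (n-1)\<rfloor>}"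
      unfolding K_def using False by (auto intro!: floor_mono le)
    then have "card K \<le> nat (\<lfloor>\<theta> (n-1)\<rfloor> - \<lfloor>\<theta> 0\<rfloor> + 1)" using card_mono[of "{\<lfloor>\<theta> 0\<rfloor>..\<lfloor>\<theta> (n-1)\<rfloor>}" K] by simp
    moreover have "\<lfloor>\<theta> 0\<rfloor> \<le> \<lfloor>\<theta> (n-1)\<rfloor>" using False by (intro floor_mono le) auto
    ultimately have "real (card K) \<le> of_int (\<lfloor>\<theta> (n-1)\<rfloor> - \<lfloor>\<theta> 0\<rfloor> + 1)" by linarith
    also have "\<dots> \<le> W + 2" using range False by linarith
    finally have K: "real (card K) \<le> W + 2" .
    have "(\<Sum>j<n. cis (2 * pi * x j)) = (\<Sum>k\<in>K. \<Sum>j\<in>{j\<in>{..<n}. \<lfloor>\<theta> j\<rfloor> = k}. cis (2 * pi * x j))"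
      unfolding K_def by (rule sum.image_gen) simp
    also have "norm \<dots> \<le> (\<Sum>k\<in>K. 6 / \<tau>)"
      by (intro sum_norm_le cls)
    also have "\<dots> \<le> (W + 2) * (6 / \<tau>)"
      using K \<tau> by (simp add: mult_right_mono divide_right_mono)
    also have "\<dots> \<le> (2 * (W + 1)) * (6 / \<tau>)" using W \<tau> by (intro mult_right_mono) auto
    also have "\<dots> \<le> 12 * (W + 1) / sqrt \<Lambda> + 2 * sqrt \<Lambda>" using \<Lambda> by (simp add: \<tau>_def)
    finally show ?thesis .
  qed
qed

section \<open>Sums over the smoothing weights\<close>

lemma sum_inverse_sqrt_le: "(\<Sum>i<N. 1 / sqrt (real (Suc i))) \<le> 2 * sqrt (real N)"
proof (induction N)
  case (Suc N)
  have "(sqrt (real (Suc N)) - sqrt (real N)) * (sqrt (real (Suc N)) + sqrt (real N)) = 1"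
    by (simp add: algebra_simps)
  moreover have "sqrt (real (Suc N)) + sqrt (real N) \<le> 2 * sqrt (real (Suc N))" by simp
  ultimately have "1 \<le> (sqrt (real (Suc N)) - sqrt (real N)) * (2 * sqrt (real (Suc N)))"
    by (metis diff_ge_0_iff_ge mult_left_mono of_nat_le_iff order_less_imp_le lessI real_sqrt_le_iff)
  then have "1 / sqrt (real (Suc N)) \<le> 2 * (sqrt (real (Suc N)) - sqrt (real N))"
    by (subst pos_divide_le_eq) (simp_all only: of_nat_0_less_iff real_sqrt_gt_0_iff zero_less_Suc mult_ac)
  then show ?case using Suc by simp
qed simp

text \<open>The bound telescopes because \<open>n powr (-3/2) \<le> 2 / sqrt (n - 1) - 2 / sqrt n\<close>.\<close>

lemma sum_inverse_times_sqrt_le: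
  assumes "H \<ge> 1"
  shows "(\<Sum>i\<in>{H..<N}. 1 / (real (Suc i) * sqrt (real (Suc i)))) \<le> 2 / sqrt (real H)"
proof -
  have "(\<Sum>i\<in>{H..<H + k}. 1 / (real (Suc i) * sqrt (real (Suc i)))) \<le> 2 / sqrt (real H) - 2 / sqrt (real (H + k))" for k
  proof (induction k)
    case (Suc k)
    define a b where "a = sqrt (real (H + k))" and "b = sqrt (real (Suc (H + k)))"
    have a: "a > 0" using assms by (simp add: a_def)
    have ab: "a \<le> b" by (simp add: a_def b_def)
    have sq: "b * b = a * a + 1" by (simp add: a_def b_def)
    have "(b - a) * (b + a) = 1" using sq by (simp add: algebra_simps)
    moreover have "(b - a) * (b + a) \<le> (b - a) * (2 * b)" using a ab by (intro mult_left_mono) auto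
    ultimately have "1 \<le> 2 * b * (b - a)" by (simp add: algebra_simps)
    then have "a * 1 \<le> a * (2 * b * (b - a))" using a by (intro mult_left_mono) auto
    also have "\<dots> \<le> b * (2 * b * (b - a))" using a ab by (intro mult_right_mono) auto
    finally have *: "a * 1 \<le> b * (2 * b * (b - a))" .
    have "1 / (b * b * b) = (a * 1) / (a * (b * b * b))" using a by simp
    also have "\<dots> \<le> (b * (2 * b * (b - a))) / (a * (b * b * b))"
      using a ab by (intro divide_right_mono *) auto
    also have "\<dots> = 2 / a - 2 / b" using a ab by (simp add: field_simps)
    finally have "1 / (b * b * b) \<le> 2 / a - 2 / b" .
    moreover have "b * b = real (Suc (H + k))" by (simp add: b_def)
    ultimately have "1 / (real (Suc (H + k)) * b) \<le> 2 / a - 2 / b" by simp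
    then show ?case using Suc by (simp add: a_def b_def)
  qed simp
  from this[of "N - H"] have "(\<Sum>i\<in>{H..<N}. 1 / (real (Suc i) * sqrt (real (Suc i)))) \<le> 2 / sqrt (real H) - 2 / sqrt (real (H + (N - H)))"
    by (cases "H \<le> N") auto
  also have "\<dots> \<le> 2 / sqrt (real H)" by simp
  finally show ?thesis .
qed

text \<open>The weight of the frequency n is at most 1 / n up to H and at most H / n^2 beyond; each
  range contributes at most \<open>2 * sqrt H\<close>.\<close>

lemma sum_fejer_weights_sqrt_le:
  assumes H: "H \<ge> 1"
  shows "(\<Sum>i<N. min 1 (real (Suc i) / real H) * real H / (real (Suc i))\<^sup>2 * sqrt (real (Suc i))) \<le> 4 * sqrt (real H)"
proof -
  let ?w = "\<lambda>i. min 1 (real (Suc i) / real H) * real H / (real (Suc i))\<^sup>2 * sqrt (real (Suc i))"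
  have "(\<Sum>i<N. ?w i) \<le> (\<Sum>i\<in>{..<H} \<union> {H..<N}. ?w i)"
    by (intro sum_mono2) auto
  also have "\<dots> = (\<Sum>i<H. ?w i) + (\<Sum>i\<in>{H..<N}. ?w i)"
    by (intro sum.union_disjoint) auto
  also have "(\<Sum>i<H. ?w i) \<le> (\<Sum>i<H. 1 / sqrt (real (Suc i)))"
  proof (intro sum_mono)
    fix i
    define n where "n = real (Suc i)"
    have n: "n > 0" by (simp add: n_def)
    have "?w i \<le> n / real H * real H / n\<^sup>2 * sqrt n"
      unfolding n_def[symmetric] using n by (intro mult_right_mono divide_right_mono) auto
    also have "\<dots> = 1 / sqrt n" using n H by (simp add: field_simps power2_eq_square)
    finally show "?w i \<le> 1 / sqrt (real (Suc i))" by (simp add: n_def)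
  qed
  also have "\<dots> \<le> 2 * sqrt (real H)" by (rule sum_inverse_sqrt_le)
  also have "(\<Sum>i\<in>{H..<N}. ?w i) \<le> (\<Sum>i\<in>{H..<N}. real H * (1 / (real (Suc i) * sqrt (real (Suc i)))))"
  proof (intro sum_mono)
    fix i
    define n where "n = real (Suc i)"
    have n: "n > 0" by (simp add: n_def)
    have "?w i \<le> 1 * real H / n\<^sup>2 * sqrt n"
      unfolding n_def[symmetric] using n by (intro mult_right_mono divide_right_mono) auto
    also have "\<dots> = real H * (1 / (n * sqrt n))" using n H by (simp add: field_simps power2_eq_square)
    finally show "?w i \<le> real H * (1 / (real (Suc i) * sqrt (real (Suc i))))" by (simp add: n_def)
  qed
  also have "\<dots> \<le> real H * (2 / sqrt (real H))"
    unfolding sum_distrib_left[symmetric] by (intro mult_left_mono sum_inverse_times_sqrt_le H) auto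
  also have "\<dots> = 2 * sqrt (real H)" using H by (simp add: field_simps)
  finally show ?thesis by simp
qed

text \<open>Here the bound 1 / n on the weight suffices for all n: the series of n^(-3/2) converges,
  so the estimate is uniform in H.\<close>

lemma sum_fejer_weights_inverse_sqrt_le:
  assumes H: "H \<ge> 1"
  shows "(\<Sum>i<N. min 1 (real (Suc i) / real H) * real H / (real (Suc i))\<^sup>2 * (1 / sqrt (real (Suc i)))) \<le> 3"
proof -
  let ?w = "\<lambda>i. min 1 (real (Suc i) / real H) * real H / (real (Suc i))\<^sup>2 * (1 / sqrt (real (Suc i)))"
  have "(\<Sum>i<N. ?w i) \<le> (\<Sum>i<N. 1 / (real (Suc i) * sqrt (real (Suc i))))"
  proof (intro sum_mono)
    fix i
    define n where "n = real (Suc i)"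
    have n: "n > 0" by (simp add: n_def)
    have "?w i \<le> n / real H * real H / n\<^sup>2 * (1 / sqrt n)"
      unfolding n_def[symmetric] using n by (intro mult_right_mono divide_right_mono) auto
    also have "\<dots> = 1 / (n * sqrt n)" using n H by (simp add: field_simps power2_eq_square)
    finally show "?w i \<le> 1 / (real (Suc i) * sqrt (real (Suc i)))" by (simp add: n_def)
  qed
  also have "\<dots> \<le> (\<Sum>i\<in>{..<1} \<union> {1..<N}. 1 / (real (Suc i) * sqrt (real (Suc i))))"
    by (intro sum_mono2) auto
  also have "\<dots> = (\<Sum>i<1. 1 / (real (Suc i) * sqrt (real (Suc i)))) + (\<Sum>i\<in>{1..<N}. 1 / (real (Suc i) * sqrt (real (Suc i))))"
    by (intro sum.union_disjoint) auto
  also have "\<dots> \<le> 1 + 2 / sqrt (real 1)"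
    using sum_inverse_times_sqrt_le[of 1 N] by simp
  finally show ?thesis by simp
qed

section \<open>Sawtooth sums in terms of second differences\<close>

lemma sum_saw_second_difference:
  fixes x \<theta> :: "nat \<Rightarrow> real"
  defines "\<theta> \<equiv> \<lambda>j. x (Suc j) - x j"
  assumes sp: "\<And>j. Suc j < n \<Longrightarrow> \<theta> j + \<mu> \<le> \<theta> (Suc j)" and \<mu>: "0 < \<mu>" "\<mu> \<le> 1" and W: "0 \<le> W"
    and range: "n > 0 \<Longrightarrow> \<theta> (n - 1) - \<theta> 0 \<le> W"
  shows "\<bar>\<Sum>j<n. saw (x j)\<bar> \<le> n * \<mu> powr (1/3) + 72 * W * \<mu> powr (-2/3) + 48 * \<mu> powr (-1/2)"
proof -
  \<comment> \<open>For \<open>W\<close> of order \<open>n * \<mu>\<close>, this size of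
    \<open>H\<close> balances the smoothing error \<open>n / H\<close> against the contribution
    \<open>W * sqrt H / sqrt \<mu>\<close> of the exponential sums.\<close>
  define y where "y = \<mu> powr (-1/3)"
  define H where "H = nat \<lceil>y\<rceil>"
  have "\<mu> powr 0 \<le> \<mu> powr (-1/3)" using \<mu> by (intro powr_mono') auto
  then have y: "y \<ge> 1" using \<mu> by (simp add: y_def)
  have H: "H \<ge> 1" "y \<le> real H" "real H \<le> 2 * y" unfolding H_def using y by linarith+
  define A where "A = 12 * W / sqrt \<mu> + 2 * sqrt \<mu>"
  define B where "B = 12 / sqrt \<mu>"
  let ?w = "\<lambda>i. min 1 (real (Suc i) / real H) * real H / (real (Suc i))\<^sup>2"
  have AB: "A \<ge> 0" "B \<ge> 0" using \<mu> W by (auto simp: A_def B_def)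
  have S: "norm (\<Sum>j\<in>{..<n}. cis (2 * pi * real (Suc i) * x j)) \<le> A * sqrt (real (Suc i)) + B * (1 / sqrt (real (Suc i)))" for i
  proof -
    define h where "h = real (Suc i)"
    have h: "h > 0" by (simp add: h_def)
    have "norm (\<Sum>j<n. cis (2 * pi * (h * x j))) \<le> 12 * (h * W + 1) / sqrt (h * \<mu>) + 2 * sqrt (h * \<mu>)"
    proof (rule second_difference_test)
      fix j assume "Suc j < n"
      then have "h * (\<theta> j + \<mu>) \<le> h * \<theta> (Suc j)" using sp h by (intro mult_left_mono) auto
      then show "h * x (Suc j) - h * x j + h * \<mu> \<le> h * x (Suc (Suc j)) - h * x (Suc j)"
        by (simp add: \<theta>_def algebra_simps)
    next
      assume "0 < n"
      then have "h * (\<theta> (n - 1) - \<theta> 0) \<le> h * W" using range h by (intro mult_left_mono) auto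
      then show "h * x (Suc (n - 1)) - h * x (n - 1) - (h * x (Suc 0) - h * x 0) \<le> h * W"
        by (simp add: \<theta>_def algebra_simps)
    qed (use h \<mu> W in auto)
    also have "\<dots> = A * sqrt h + B * (1 / sqrt h)"
      using h \<mu> by (simp add: A_def B_def real_sqrt_mult field_simps)
    finally show ?thesis by (simp add: h_def mult.assoc)
  qed
  have "(\<Sum>i<N. ?w i * norm (\<Sum>j\<in>{..<n}. cis (2 * pi * real (Suc i) * x j))) \<le> A * (4 * sqrt (real H)) + B * 3" for N
  proof -
    have "(\<Sum>i<N. ?w i * norm (\<Sum>j\<in>{..<n}. cis (2 * pi * real (Suc i) * x j)))
      \<le> (\<Sum>i<N. ?w i * (A * sqrt (real (Suc i)) + B * (1 / sqrt (real (Suc i)))))"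
      by (intro sum_mono mult_left_mono S) auto
    also have "\<dots> = A * (\<Sum>i<N. ?w i * sqrt (real (Suc i))) + B * (\<Sum>i<N. ?w i * (1 / sqrt (real (Suc i))))"
    proof -
      have "w * (A * s + B * r) = A * (w * s) + B * (w * r)" for w s r by (simp add: algebra_simps)
      then show ?thesis unfolding sum_distrib_left sum.distrib[symmetric] by (intro sum.cong refl)
    qed
    also have "\<dots> \<le> A * (4 * sqrt (real H)) + B * 3"
      using AB sum_fejer_weights_sqrt_le[OF H(1)] sum_fejer_weights_inverse_sqrt_le[OF H(1)]
      by (intro add_mono mult_left_mono) auto
    finally show ?thesis .
  qed
  from sum_saw_le_exponential_sums[OF H(1) this]
  have main: "\<bar>\<Sum>j<n. saw (x j)\<bar> \<le> n / real H + (A * (4 * sqrt (real H)) + B * 3)" by simp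
  have "n / real H \<le> n / y" using H y by (intro divide_left_mono) auto
  also have "\<dots> = n * \<mu> powr (1/3)" using \<mu> by (simp add: y_def powr_minus_divide[of \<mu> "1/3"])
  finally have 1: "n / real H \<le> n * \<mu> powr (1/3)" .
  \<comment> \<open>The factor 2 is enlarged to 9/4 to have a rational square root.\<close>
  have "sqrt (real H) \<le> sqrt ((3/2)\<^sup>2 * y)" using H y by (intro real_sqrt_le_mono) (auto simp: power2_eq_square)
  also have "\<dots> = 3/2 * \<mu> powr (-1/6)" using \<mu> by (simp add: real_sqrt_mult y_def powr_half_sqrt[symmetric] powr_powr)
  finally have sH: "sqrt (real H) \<le> 3/2 * \<mu> powr (-1/6)" .
  have l2: "sqrt \<mu> = \<mu> powr (1/2)" using \<mu> by (simp add: powr_half_sqrt)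
  have B: "B * 3 = 36 * \<mu> powr (-1/2)" using \<mu> by (simp add: B_def l2 powr_minus_divide[of \<mu> "1/2"])
  have "A * (4 * sqrt (real H)) \<le> A * (6 * \<mu> powr (-1/6))" using sH AB by (intro mult_left_mono) auto
  also have "\<dots> = 72 * W * (\<mu> powr (-1/2) * \<mu> powr (-1/6)) + 12 * (\<mu> powr (1/2) * \<mu> powr (-1/6))"
    using \<mu> by (simp add: A_def l2 powr_minus_divide[of \<mu> "1/2"] algebra_simps)
  also have "\<dots> = 72 * W * \<mu> powr (-2/3) + 12 * \<mu> powr (1/3)"
    by (simp only: powr_add[symmetric]) simp
  also have "\<mu> powr (1/3) \<le> \<mu> powr (-1/2)" using \<mu> by (intro powr_mono') auto
  finally have "A * (4 * sqrt (real H)) \<le> 72 * W * \<mu> powr (-2/3) + 12 * \<mu> powr (-1/2)" by simp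
  with main 1 B show ?thesis by linarith
qed


text \<open>If the second differences agree up to a factor 2, the first differences range over at
  most \<open>n * B\<close>, and the term with \<open>W\<close> has the same order as the first
  one.\<close>

lemma sum_saw_dyadic_second_difference:
  fixes x :: "nat \<Rightarrow> real"
  assumes d: "\<And>j. j < n \<Longrightarrow> B / 2 \<le> x (Suc (Suc j)) - 2 * x (Suc j) + x j \<and> x (Suc (Suc j)) - 2 * x (Suc j) + x j \<le> B"
    and B: "0 < B" "B \<le> 1"
  shows "\<bar>\<Sum>j<n. saw (x j)\<bar> \<le> 145 * real n * B powr (1/3) + 68 * B powr (-1/2)"
proof -
  define \<theta> where "\<theta> = (\<lambda>j. x (Suc j) - x j)"
  have up: "\<theta> j - \<theta> 0 \<le> j * B" if "j < n" for j
    using that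
  proof (induction j)
    case (Suc j)
    then show ?case using d[of j] by (simp add: \<theta>_def algebra_simps)
  qed simp
  have "\<bar>\<Sum>j<n. saw (x j)\<bar> \<le> n * (B/2) powr (1/3) + 72 * (n * B) * (B/2) powr (-2/3) + 48 * (B/2) powr (-1/2)"
  proof (rule sum_saw_second_difference)
    fix j assume "Suc j < n"
    then show "x (Suc j) - x j + B / 2 \<le> x (Suc (Suc j)) - x (Suc j)" using d[of j] by simp
  next
    assume "0 < n"
    then have "\<theta> (n - 1) - \<theta> 0 \<le> real (n - 1) * B" by (intro up) auto
    also have "\<dots> \<le> real n * B" using B by (intro mult_right_mono) auto
    finally show "x (Suc (n - 1)) - x (n - 1) - (x (Suc 0) - x 0) \<le> real n * B" by (simp add: \<theta>_def)
  qed (use B in auto)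
  also have "n * B * (B/2) powr (-2/3) = 2 * n * (B/2) powr (1/3)"
  proof -
    have "(B/2) powr (1/3) = (B/2) powr 1 * (B/2) powr (-2/3)" unfolding powr_add[symmetric] by simp
    then show ?thesis using B by simp
  qed
  then have "72 * (n * B) * (B/2) powr (-2/3) = 144 * (n * (B/2) powr (1/3))" by simp
  also have "n * (B/2) powr (1/3) + 144 * (n * (B/2) powr (1/3)) \<le> 145 * real n * B powr (1/3)"
    using B powr_mono2[of "1/3" "B/2" B] mult_left_mono[of "(B/2) powr (1/3)" "B powr (1/3)" "145 * real n"] by simp
  also have "48 * (B/2) powr (-1/2) \<le> 68 * B powr (-1/2)"
  proof -
    \<comment> \<open>17/12 is a rational upper bound for the square root of 2, and 48 * 17/12 =
      68.\<close>
    have "sqrt 2 \<le> sqrt ((17/12)\<^sup>2)" by (intro real_sqrt_le_mono) (simp add: power2_eq_square)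
    then have "48 * sqrt 2 \<le> 68" by simp
    then have "48 * sqrt 2 * B powr (-1/2) \<le> 68 * B powr (-1/2)" by (intro mult_right_mono) auto
    then show ?thesis using B by (simp add: powr_divide powr_minus_divide powr_half_sqrt)
  qed
  finally show ?thesis by simp
qed

text \<open>Dyadic decomposition by the size of the second difference: the contributions
  \<open>(B / 2 ^ k) powr (-1/2)\<close> grow geometrically, hence only the last one matters.\<close>

lemma sum_saw_antimono_second_difference_aux:
  fixes x :: "nat \<Rightarrow> real"
  defines "d \<equiv> \<lambda>x j. x (Suc (Suc j)) - 2 * x (Suc j) + x j :: real"
  assumes "\<And>j. j < n \<Longrightarrow> \<mu> \<le> d x j \<and> d x j \<le> B"
    and "\<And>j. Suc j < n \<Longrightarrow> d x (Suc j) \<le> d x j"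
    and \<mu>: "0 < \<mu>" and "\<mu> \<le> B" "B \<le> 1" "B \<le> 2 ^ K * \<mu>"
  shows "\<bar>\<Sum>j<n. saw (x j)\<bar> \<le> 145 * real n * B powr (1/3) + 170 * (2 * \<mu> powr (-1/2) - B powr (-1/2))"
  using assms(2,3,5-)
proof (induction K arbitrary: x n B)
  have small: "\<bar>\<Sum>j<n. saw (x j)\<bar> \<le> 145 * real n * B powr (1/3) + 170 * (2 * \<mu> powr (-1/2) - B powr (-1/2))"
    if "\<And>j. j < n \<Longrightarrow> \<mu> \<le> d x j \<and> d x j \<le> B" "\<mu> \<le> B" "B \<le> 1" "B \<le> 2 * \<mu>" for x B and n :: nat
  proof -
    have "\<bar>\<Sum>j<n. saw (x j)\<bar> \<le> 145 * real n * B powr (1/3) + 68 * B powr (-1/2)"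
    proof (rule sum_saw_dyadic_second_difference)
      fix j assume "j < n"
      from that(1)[OF this] that show "B / 2 \<le> x (Suc (Suc j)) - 2 * x (Suc j) + x j \<and> x (Suc (Suc j)) - 2 * x (Suc j) + x j \<le> B"
        by (auto simp: d_def)
    qed (use that \<mu> in auto)
    moreover have "B powr (-1/2) \<le> \<mu> powr (-1/2)" using \<mu> that by (intro powr_mono2') auto
    moreover have "0 \<le> B powr (-1/2)" by simp
    ultimately show ?thesis unfolding right_diff_distrib by argo
  qed
  {
    case 0
    then show ?case using \<mu> by (intro small) auto
  next
    case (Suc K)
    show ?case
    proof (cases "B \<le> 2 * \<mu>")
      case True
      then show ?thesis using Suc.prems by (intro small) auto
    next
      case False
      \<comment> \<open>The second differences decrease, so those of size at least
        \<open>B / 2\<close> form an initial segment, and \<open>i\<close> is its length.\<close>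
      define i where "i = (LEAST j. j = n \<or> d x j < B / 2)"
      have i: "i = n \<or> d x i < B / 2" unfolding i_def by (rule LeastI[where k = n]) simp
      have "i \<le> n" unfolding i_def by (rule Least_le) simp
      have anti: "d x k \<le> d x j" if "j \<le> k" "k < n" for j k
        using that
      proof (induction k rule: dec_induct)
        case (step k)
        then show ?case using Suc.prems(2)[of k] by simp
      qed simp
      have lo: "B / 2 \<le> d x j" if "j < i" for j
        using not_less_Least[of j "\<lambda>j. j = n \<or> d x j < B / 2"] that unfolding i_def[symmetric] by auto
      have hi: "d x j \<le> B / 2" if "i \<le> j" "j < n" for j
        using anti[of i j] that i by auto
      have 1: "\<bar>\<Sum>j<i. saw (x j)\<bar> \<le> 145 * real i * B powr (1/3) + 68 * B powr (-1/2)"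
      proof (rule sum_saw_dyadic_second_difference)
        fix j assume "j < i"
        then show "B / 2 \<le> x (Suc (Suc j)) - 2 * x (Suc j) + x j \<and> x (Suc (Suc j)) - 2 * x (Suc j) + x j \<le> B"
          using lo[of j] Suc.prems(1)[of j] \<open>i \<le> n\<close> by (auto simp: d_def)
      qed (use Suc.prems \<mu> in auto)
      have 2: "\<bar>\<Sum>j<n - i. saw (x (i + j))\<bar> \<le> 145 * real (n - i) * (B/2) powr (1/3) + 170 * (2 * \<mu> powr (-1/2) - (B/2) powr (-1/2))"
      proof (rule Suc.IH)
        fix j assume "j < n - i"
        then show "\<mu> \<le> d (\<lambda>j. x (i + j)) j \<and> d (\<lambda>j. x (i + j)) j \<le> B / 2"
          using hi[of "i + j"] Suc.prems(1)[of "i + j"] by (simp add: d_def)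
      next
        fix j assume "Suc j < n - i"
        then show "d (\<lambda>j. x (i + j)) (Suc j) \<le> d (\<lambda>j. x (i + j)) j"
          using Suc.prems(2)[of "i + j"] by (simp add: d_def)
      qed (use Suc.prems False in auto)
      have B: "B > 0" using Suc.prems \<mu> by auto
      have "145 * real (n - i) * (B/2) powr (1/3) \<le> 145 * real (n - i) * B powr (1/3)"
        using B by (intro mult_left_mono powr_mono2) auto
      \<comment> \<open>The subtracted \<open>B powr (-1/2)\<close> closes the induction: halving
        \<open>B\<close> raises it by the factor sqrt 2, which is at least 7/5, and 170 * 7/5 = 68 +
        170 pays for the block just removed.\<close>
      moreover have "170 * (B/2) powr (-1/2) \<ge> 238 * B powr (-1/2)"
      proof -
        have "sqrt ((7/5)\<^sup>2) \<le> sqrt 2" by (intro real_sqrt_le_mono) (simp add: power2_eq_square)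
        then have "238 \<le> 170 * sqrt 2" by simp
        then have "238 * B powr (-1/2) \<le> 170 * sqrt 2 * B powr (-1/2)" by (intro mult_right_mono) auto
        then show ?thesis using B by (simp add: powr_divide powr_minus_divide powr_half_sqrt)
      qed
      moreover have "(\<Sum>j<n. saw (x j)) = (\<Sum>j<i. saw (x j)) + (\<Sum>j<n - i. saw (x (i + j)))"
        using sum.atLeastLessThan_concat[of 0 i n "\<lambda>j. saw (x j)"] \<open>i \<le> n\<close>
          sum.atLeastLessThan_shift_0[of "\<lambda>j. saw (x j)" i n]
        by (simp add: lessThan_atLeast0)
      moreover have "145 * real n * B powr (1/3) = 145 * real i * B powr (1/3) + 145 * real (n - i) * B powr (1/3)"
        using \<open>i \<le> n\<close> by (simp add: algebra_simps of_nat_diff)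
      moreover have "\<bar>(\<Sum>j<i. saw (x j)) + (\<Sum>j<n - i. saw (x (i + j)))\<bar> \<le> \<bar>\<Sum>j<i. saw (x j)\<bar> + \<bar>\<Sum>j<n - i. saw (x (i + j))\<bar>"
        by (rule abs_triangle_ineq)
      ultimately show ?thesis using 1 2 unfolding right_diff_distrib by argo
    qed
  }
qed

lemma sum_saw_antimono_second_difference:
  fixes x :: "nat \<Rightarrow> real"
  defines "d \<equiv> \<lambda>j. x (Suc (Suc j)) - 2 * x (Suc j) + x j"
  assumes d: "\<And>j. j < n \<Longrightarrow> \<mu> \<le> d j \<and> d j \<le> B"
    and anti: "\<And>j. Suc j < n \<Longrightarrow> d (Suc j) \<le> d j"
    and \<mu>: "0 < \<mu>" "\<mu> \<le> B" and B: "B \<le> 1"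
  shows "\<bar>\<Sum>j<n. saw (x j)\<bar> \<le> 145 * real n * B powr (1/3) + 340 * \<mu> powr (-1/2)"
proof -
  obtain K where "B / \<mu> < 2 ^ K" using real_arch_pow[of 2 "B / \<mu>"] by auto
  then have "B \<le> 2 ^ K * \<mu>" using \<mu> by (simp add: field_simps)
  then have "\<bar>\<Sum>j<n. saw (x j)\<bar> \<le> 145 * real n * B powr (1/3) + 170 * (2 * \<mu> powr (-1/2) - B powr (-1/2))"
    using assms by (intro sum_saw_antimono_second_difference_aux) auto
  moreover have "0 \<le> B powr (-1/2)" by simp
  ultimately show ?thesis unfolding right_diff_distrib by argo
qed

section \<open>The sawtooth function along a curve\<close>

lemma columns_eq_interval:
  fixes u v h :: real
  assumes "0 < h" "0 \<le> u" "u \<le> v"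
  shows "{j::nat. u < real j * h \<and> real j * h \<le> v} = {nat \<lfloor>u / h\<rfloor> + 1..<nat \<lfloor>v / h\<rfloor> + 1}"
proof -
  have "u < real j * h \<longleftrightarrow> nat \<lfloor>u / h\<rfloor> + 1 \<le> j" for j
  proof -
    have "u < real j * h \<longleftrightarrow> u / h < of_int (int j)" using assms by (simp add: field_simps)
    also have "\<dots> \<longleftrightarrow> \<lfloor>u / h\<rfloor> < int j" by (simp add: floor_less_iff)
    also have "\<dots> \<longleftrightarrow> nat \<lfloor>u / h\<rfloor> + 1 \<le> j" using assms by (auto simp: nat_less_iff Suc_le_eq)
    finally show ?thesis .
  qed
  moreover have "real j * h \<le> v \<longleftrightarrow> j < nat \<lfloor>v / h\<rfloor> + 1" for j
  proof -
    have "real j * h \<le> v \<longleftrightarrow> of_int (int j) \<le> v / h" using assms by (simp add: field_simps)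
    also have "\<dots> \<longleftrightarrow> int j \<le> \<lfloor>v / h\<rfloor>" by (simp add: le_floor_iff)
    also have "\<dots> \<longleftrightarrow> j < nat \<lfloor>v / h\<rfloor> + 1"
    proof -
      have "0 \<le> \<lfloor>v / h\<rfloor>" using assms by simp
      then show ?thesis by linarith
    qed
    finally show ?thesis .
  qed
  ultimately show ?thesis by auto
qed

lemma card_columns_approx:
  fixes u v h :: real
  assumes "0 < h" "0 \<le> u" "u \<le> v"
  shows "\<bar>real (card {j::nat. u < real j * h \<and> real j * h \<le> v}) - (v - u) / h\<bar> \<le> 1"
proof -
  have "0 \<le> \<lfloor>u / h\<rfloor>" "u / h \<le> v / h" using assms by (auto intro: divide_right_mono)
  moreover from this have "\<lfloor>u / h\<rfloor> \<le> \<lfloor>v / h\<rfloor>" by (intro floor_mono)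
  ultimately have "\<bar>real (nat \<lfloor>v / h\<rfloor> - nat \<lfloor>u / h\<rfloor>) - (v / h - u / h)\<bar> \<le> 1" by linarith
  then show ?thesis by (simp add: columns_eq_interval[OF assms] diff_divide_distrib)
qed

lemma card_columns_le:
  fixes u v h :: real
  assumes "0 < h" "0 \<le> u" "u \<le> v"
  shows "real (card {j::nat. u < real j * h \<and> real j * h \<le> v}) \<le> (v - u) / h + 1"
  using card_columns_approx[OF assms] by linarith

lemma abs_sum_saw_le_card: "\<bar>\<Sum>j\<in>A. saw (x j)\<bar> \<le> real (card A)"
proof -
  have "\<bar>\<Sum>j\<in>A. saw (x j)\<bar> \<le> (\<Sum>j\<in>A. \<bar>saw (x j)\<bar>)" by (rule sum_abs)
  also have "\<dots> \<le> (\<Sum>j\<in>A. 1)" by (intro sum_mono order_trans[OF abs_saw_le]) simp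
  finally show ?thesis by simp
qed

text \<open>A second difference at column \<open>j\<close> involves the next two columns. With three
  columns removed at the end, these still lie strictly inside the interval.\<close>

lemma abs_sum_saw_le_trimmed:
  fixes a b :: nat
  shows "\<bar>\<Sum>j\<in>{a..<b}. saw (x j)\<bar> \<le> \<bar>\<Sum>j\<in>{a..<b - 3}. saw (x j)\<bar> + 3"
proof -
  have "(\<Sum>j\<in>{a..<b}. saw (x j)) = (\<Sum>j\<in>{a..<b} - {a..<b - 3}. saw (x j)) + (\<Sum>j\<in>{a..<b - 3}. saw (x j))"
    by (rule sum.subset_diff) auto
  moreover have "{a..<b} - {a..<b - 3} \<subseteq> {b - 3..<b}" by auto
  then have "card ({a..<b} - {a..<b - 3}) \<le> card {b - 3..<b}" by (intro card_mono) auto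
  then have "real (card ({a..<b} - {a..<b - 3})) \<le> 3" by simp
  moreover have "\<bar>\<Sum>j\<in>{a..<b} - {a..<b - 3}. saw (x j)\<bar> \<le> real (card ({a..<b} - {a..<b - 3}))"
    by (rule abs_sum_saw_le_card)
  ultimately show ?thesis by linarith
qed

section \<open>Second differences of a sampled curve\<close>

context
  fixes f f' f'' :: "real \<Rightarrow> real" and \<alpha> L Q :: real
  assumes D1: "\<And>x. \<alpha> < x \<Longrightarrow> x < L \<Longrightarrow> (f has_real_derivative f' x) (at x)"
    and D2: "\<And>x. \<alpha> < x \<Longrightarrow> x < L \<Longrightarrow> (f' has_real_derivative f'' x) (at x)"
    and Q: "\<And>x. \<alpha> < x \<Longrightarrow> x < L \<Longrightarrow> - Q \<le> f' x \<and> f' x \<le> 0"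
begin

text \<open>The intermediate point stays within one cell, so the points belonging to consecutive
  columns are ordered. This makes the second differences decrease when \<open>f''\<close> does; the
  point of the second-order version ranges over two cells.\<close>

lemma second_difference_mvt:
  assumes "\<alpha> < t" "0 < h" "t + 2 * h < L"
  obtains \<eta> where "t < \<eta>" "\<eta> < t + h" "f (t + 2 * h) - 2 * f (t + h) + f t = h * (f' (\<eta> + h) - f' \<eta>)"
proof -
  have "\<exists>z. t < z \<and> z < t + h \<and> (f (t + h + h) - f (t + h)) - (f (t + h) - f t) = (t + h - t) * (f' (z + h) - f' z)"
  proof (rule MVT2)
    fix x assume x: "t \<le> x" "x \<le> t + h"
    show "((\<lambda>x. f (x + h) - f x) has_real_derivative f' (x + h) - f' x) (at x)"
      by (intro DERIV_diff D1 DERIV_shift[THEN iffD1]) (use x assms in auto)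
  qed (use assms in auto)
  then show ?thesis using that by (auto simp: algebra_simps)
qed

lemma second_difference_mvt2:
  assumes "\<alpha> < t" "0 < h" "t + 2 * h < L"
  obtains \<xi> where "t < \<xi>" "\<xi> < t + 2 * h" "f (t + 2 * h) - 2 * f (t + h) + f t = h\<^sup>2 * f'' \<xi>"
proof -
  obtain \<eta> where \<eta>: "t < \<eta>" "\<eta> < t + h" "f (t + 2 * h) - 2 * f (t + h) + f t = h * (f' (\<eta> + h) - f' \<eta>)"
    using second_difference_mvt[OF assms] .
  have "\<exists>z. \<eta> < z \<and> z < \<eta> + h \<and> f' (\<eta> + h) - f' \<eta> = (\<eta> + h - \<eta>) * f'' z"
    by (rule MVT2) (use \<eta> assms in \<open>auto intro!: D2\<close>)
  then obtain z where "\<eta> < z" "z < \<eta> + h" "f' (\<eta> + h) - f' \<eta> = h * f'' z" by auto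
  then show ?thesis using \<eta> that[of z] by (auto simp: power2_eq_square)
qed

text \<open>Since \<open>f''\<close> is bounded only from below, the range of the first differences
  is controlled by the slopes in [-Q, 0] instead, which gives \<open>W = R * h * Q\<close>.\<close>

lemma sum_saw_curve_lower:
  assumes h: "0 < h" and R: "0 < R" and \<mu>: "0 < \<mu>" "\<mu> \<le> 1"
    and j: "\<And>j. a \<le> j \<Longrightarrow> j < b \<Longrightarrow> \<alpha> < real j * h \<and> real j * h + 2 * h < L"
    and Q0: "0 \<le> Q"
    and low: "\<And>j x. a \<le> j \<Longrightarrow> j < b \<Longrightarrow> real j * h < x \<Longrightarrow> x < real j * h + 2 * h \<Longrightarrow> \<mu> \<le> R * h\<^sup>2 * f'' x"
  shows "\<bar>\<Sum>j\<in>{a..<b}. saw (R * f (real j * h))\<bar>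
    \<le> real (b - a) * \<mu> powr (1/3) + 72 * (R * h * Q) * \<mu> powr (-2/3) + 48 * \<mu> powr (-1/2)"
proof -
  have "\<bar>\<Sum>j<b - a. saw (R * f (real (a + j) * h))\<bar>
    \<le> real (b - a) * \<mu> powr (1/3) + 72 * (R * h * Q) * \<mu> powr (-2/3) + 48 * \<mu> powr (-1/2)"
  proof (rule sum_saw_second_difference)
    fix j assume "Suc j < b - a"
    then have jj: "a \<le> a + j" "a + j < b" by auto
    obtain \<xi> where \<xi>: "real (a + j) * h < \<xi>" "\<xi> < real (a + j) * h + 2 * h"
      "f (real (a + j) * h + 2 * h) - 2 * f (real (a + j) * h + h) + f (real (a + j) * h) = h\<^sup>2 * f'' \<xi>"
      using second_difference_mvt2[of "real (a + j) * h" h] j[OF jj] h by auto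
    have "R * (h\<^sup>2 * f'' \<xi>) \<ge> \<mu>" using low[OF jj \<xi>(1,2)] by (simp add: mult.assoc)
    then show "R * f (real (a + Suc j) * h) - R * f (real (a + j) * h) + \<mu>
      \<le> R * f (real (a + Suc (Suc j)) * h) - R * f (real (a + Suc j) * h)"
      unfolding \<xi>(3)[symmetric] by (simp add: algebra_simps)
  next
    assume "0 < b - a"
    have bd: "- (R * h * Q) \<le> R * f (real (Suc k) * h) - R * f (real k * h) \<and> R * f (real (Suc k) * h) - R * f (real k * h) \<le> 0"
      if k: "a \<le> k" "k < b" for k
    proof -
      have "\<exists>z. real k * h < z \<and> z < real k * h + h \<and> f (real k * h + h) - f (real k * h) = (real k * h + h - real k * h) * f' z"
        by (rule MVT2) (use j[OF k] h in \<open>auto intro!: D1\<close>)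
      then obtain z where z: "real k * h < z" "z < real k * h + h" "f (real k * h + h) - f (real k * h) = h * f' z" by auto
      have "- Q \<le> f' z \<and> f' z \<le> 0" using j[OF k] z h by (intro Q) auto
      then have "R * h * (- Q) \<le> R * h * f' z \<and> R * h * f' z \<le> R * h * 0" using R h by (intro conjI mult_left_mono) auto
      moreover have "R * f (real (Suc k) * h) - R * f (real k * h) = R * (f (real k * h + h) - f (real k * h))"
        by (simp add: algebra_simps)
      ultimately show ?thesis unfolding z(3) by (simp add: mult.assoc)
    qed
    show "R * f (real (a + Suc (b - a - 1)) * h) - R * f (real (a + (b - a - 1)) * h)
        - (R * f (real (a + Suc 0) * h) - R * f (real (a + 0) * h)) \<le> R * h * Q"
    proof -
      have k: "a \<le> a + (b - a - 1)" "a + (b - a - 1) < b" "a < b" using \<open>0 < b - a\<close> by auto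
      show ?thesis using bd[OF k(1,2)] bd[OF order_refl k(3)] unfolding add_Suc_right add_0_right by linarith
    qed
  qed (use \<mu> R h Q0 in auto)
  then show ?thesis
    using sum.atLeastLessThan_shift_0[of "\<lambda>j. saw (R * f (real j * h))" a b] by (simp add: lessThan_atLeast0)
qed

lemma sum_saw_curve_antimono:
  assumes h: "0 < h" and R: "0 < R" and \<mu>: "0 < \<mu>" "\<mu> \<le> B" and B: "B \<le> 1"
    and j: "\<And>j. a \<le> j \<Longrightarrow> j < b \<Longrightarrow> \<alpha> \<le> c \<and> c < real j * h \<and> real j * h + 2 * h < L"
    and anti: "antimono_on {c<..<L} f''"
    and bd: "\<And>j x. a \<le> j \<Longrightarrow> j < b \<Longrightarrow> real j * h < x \<Longrightarrow> x < real j * h + 2 * h \<Longrightarrow> \<mu> \<le> R * h\<^sup>2 * f'' x \<and> R * h\<^sup>2 * f'' x \<le> B"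
  shows "\<bar>\<Sum>j\<in>{a..<b}. saw (R * f (real j * h))\<bar> \<le> 145 * real (b - a) * B powr (1/3) + 340 * \<mu> powr (-1/2)"
proof -
  have sd: "R * f (real (a + Suc (Suc j)) * h) - 2 * (R * f (real (a + Suc j) * h)) + R * f (real (a + j) * h)
    = R * (f (real (a + j) * h + 2 * h) - 2 * f (real (a + j) * h + h) + f (real (a + j) * h))" for j
    by (simp add: algebra_simps)
  have "\<bar>\<Sum>j<b - a. saw (R * f (real (a + j) * h))\<bar> \<le> 145 * real (b - a) * B powr (1/3) + 340 * \<mu> powr (-1/2)"
  proof (rule sum_saw_antimono_second_difference[OF _ _ \<mu> B])
    fix j assume "j < b - a"
    then have jj: "a \<le> a + j" "a + j < b" by auto
    obtain \<xi> where \<xi>: "real (a + j) * h < \<xi>" "\<xi> < real (a + j) * h + 2 * h"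
      "f (real (a + j) * h + 2 * h) - 2 * f (real (a + j) * h + h) + f (real (a + j) * h) = h\<^sup>2 * f'' \<xi>"
      using second_difference_mvt2[of "real (a + j) * h" h] j[OF jj] h by auto
    then show "\<mu> \<le> R * f (real (a + Suc (Suc j)) * h) - 2 * (R * f (real (a + Suc j) * h)) + R * f (real (a + j) * h) \<and>
         R * f (real (a + Suc (Suc j)) * h) - 2 * (R * f (real (a + Suc j) * h)) + R * f (real (a + j) * h) \<le> B"
      using bd[OF jj \<xi>(1,2)] unfolding sd by (simp add: mult.assoc)
  next
    fix j assume "Suc j < b - a"
    then have jj: "a \<le> a + j" "a + j < b" "a \<le> a + Suc j" "a + Suc j < b" by auto
    obtain \<eta> where \<eta>: "real (a + j) * h < \<eta>" "\<eta> < real (a + j) * h + h"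
      "f (real (a + j) * h + 2 * h) - 2 * f (real (a + j) * h + h) + f (real (a + j) * h) = h * (f' (\<eta> + h) - f' \<eta>)"
      using second_difference_mvt[of "real (a + j) * h" h] j[OF jj(1,2)] h by auto
    obtain \<zeta> where \<zeta>: "real (a + Suc j) * h < \<zeta>" "\<zeta> < real (a + Suc j) * h + h"
      "f (real (a + Suc j) * h + 2 * h) - 2 * f (real (a + Suc j) * h + h) + f (real (a + Suc j) * h) = h * (f' (\<zeta> + h) - f' \<zeta>)"
      using second_difference_mvt[of "real (a + Suc j) * h" h] j[OF jj(3,4)] h by auto
    have "f' (\<zeta> + h) - f' \<zeta> \<le> f' (\<eta> + h) - f' \<eta>"
    proof (rule DERIV_nonpos_imp_nonincreasing[where f = "\<lambda>x. f' (x + h) - f' x"])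
      show "\<eta> \<le> \<zeta>" using \<eta> \<zeta> by (simp add: algebra_simps)
      fix x assume x: "\<eta> \<le> x" "x \<le> \<zeta>"
      have cx: "c < x" "x + h < L" "\<alpha> < x" using x \<eta> \<zeta> j[OF jj(1,2)] j[OF jj(3,4)] h by auto
      have "((\<lambda>x. f' (x + h) - f' x) has_real_derivative f'' (x + h) - f'' x) (at x)"
        by (intro DERIV_diff D2 DERIV_shift[THEN iffD1]) (use cx h in auto)
      moreover have "f'' (x + h) \<le> f'' x"
        using cx h by (intro monotone_onD[OF anti]) auto
      ultimately show "\<exists>y. ((\<lambda>x. f' (x + h) - f' x) has_real_derivative y) (at x) \<and> y \<le> 0"
        by (intro exI[of _ "f'' (x + h) - f'' x"]) auto
    qed
    then have "R * (h * (f' (\<zeta> + h) - f' \<zeta>)) \<le> R * (h * (f' (\<eta> + h) - f' \<eta>))"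
      using R h by (intro mult_left_mono) auto
    then show "R * f (real (a + Suc (Suc (Suc j))) * h) - 2 * (R * f (real (a + Suc (Suc j)) * h)) + R * f (real (a + Suc j) * h)
      \<le> R * f (real (a + Suc (Suc j)) * h) - 2 * (R * f (real (a + Suc j) * h)) + R * f (real (a + j) * h)"
      unfolding sd \<eta>(3) \<zeta>(3) .
  qed
  then show ?thesis
    using sum.atLeastLessThan_shift_0[of "\<lambda>j. saw (R * f (real j * h))" a b] by (simp add: lessThan_atLeast0)
qed

lemma sum_saw_columns_lower:
  assumes h: "0 < h" and R: "0 < R" and \<mu>: "0 < \<mu>" "\<mu> \<le> 1" and u: "0 \<le> \<alpha>" "\<alpha> \<le> u" "u \<le> v" "v \<le> L" and "0 \<le> Q"
    and low: "\<And>x. u < x \<Longrightarrow> x < v \<Longrightarrow> \<mu> \<le> R * h\<^sup>2 * f'' x"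
  shows "\<bar>\<Sum>j | u < real j * h \<and> real j * h \<le> v. saw (R * f (real j * h))\<bar>
    \<le> 3 + ((v - u) / h + 1) * \<mu> powr (1/3) + 72 * (R * h * Q) * \<mu> powr (-2/3) + 48 * \<mu> powr (-1/2)"
proof -
  define a b where "a = nat \<lfloor>u / h\<rfloor> + 1" and "b = nat \<lfloor>v / h\<rfloor> + 1"
  have S: "{j::nat. u < real j * h \<and> real j * h \<le> v} = {a..<b}"
    unfolding a_def b_def using columns_eq_interval h u by auto
  have in1: "u < real j * h \<and> real j * h + 2 * h < v" if "a \<le> j" "j < b - 3" for j
  proof -
    have "j \<in> {a..<b}" "j + 3 \<in> {a..<b}" using that by auto
    then show ?thesis unfolding S[symmetric] using h by (auto simp: algebra_simps)
  qed
  have "real (b - a) \<le> (v - u) / h + 1"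
    using card_columns_le[of h u v] h u unfolding S by simp
  then have ba: "real (b - 3 - a) \<le> (v - u) / h + 1" by linarith
  have "\<bar>\<Sum>j\<in>{a..<b - 3}. saw (R * f (real j * h))\<bar>
    \<le> real (b - 3 - a) * \<mu> powr (1/3) + 72 * (R * h * Q) * \<mu> powr (-2/3) + 48 * \<mu> powr (-1/2)"
  proof (rule sum_saw_curve_lower[OF h R \<mu> _ \<open>0 \<le> Q\<close>])
    fix j assume "a \<le> j" "j < b - 3"
    from in1[OF this] show "\<alpha> < real j * h \<and> real j * h + 2 * h < L" using u by auto
  next
    fix j x assume "a \<le> j" "j < b - 3" "real j * h < x" "x < real j * h + 2 * h"
    with in1[of j] show "\<mu> \<le> R * h\<^sup>2 * f'' x" by (intro low) auto
  qed
  moreover have "real (b - 3 - a) * \<mu> powr (1/3) \<le> ((v - u) / h + 1) * \<mu> powr (1/3)"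
    using ba by (intro mult_right_mono) auto
  ultimately show ?thesis
    using abs_sum_saw_le_trimmed[of "\<lambda>j. R * f (real j * h)" a b] unfolding S by linarith
qed

lemma sum_saw_columns_antimono:
  assumes h: "0 < h" and R: "0 < R" and \<mu>: "0 < \<mu>" "\<mu> \<le> B" and B: "B \<le> 1" and u: "0 \<le> \<alpha>" "\<alpha> \<le> u" "u \<le> v" "v \<le> L"
    and anti: "antimono_on {u<..<L} f''"
    and bd: "\<And>x. u < x \<Longrightarrow> x < v \<Longrightarrow> \<mu> \<le> R * h\<^sup>2 * f'' x \<and> R * h\<^sup>2 * f'' x \<le> B"
  shows "\<bar>\<Sum>j | u < real j * h \<and> real j * h \<le> v. saw (R * f (real j * h))\<bar>
    \<le> 3 + 145 * ((v - u) / h + 1) * B powr (1/3) + 340 * \<mu> powr (-1/2)"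
proof -
  define a b where "a = nat \<lfloor>u / h\<rfloor> + 1" and "b = nat \<lfloor>v / h\<rfloor> + 1"
  have S: "{j::nat. u < real j * h \<and> real j * h \<le> v} = {a..<b}"
    unfolding a_def b_def using columns_eq_interval h u by auto
  have in1: "u < real j * h \<and> real j * h + 2 * h < v" if "a \<le> j" "j < b - 3" for j
  proof -
    have "j \<in> {a..<b}" "j + 3 \<in> {a..<b}" using that by auto
    then show ?thesis unfolding S[symmetric] using h by (auto simp: algebra_simps)
  qed
  have "real (b - a) \<le> (v - u) / h + 1"
    using card_columns_le[of h u v] h u unfolding S by simp
  then have ba: "real (b - 3 - a) \<le> (v - u) / h + 1" by linarith
  have "\<bar>\<Sum>j\<in>{a..<b - 3}. saw (R * f (real j * h))\<bar>
    \<le> 145 * real (b - 3 - a) * B powr (1/3) + 340 * \<mu> powr (-1/2)"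
  proof (rule sum_saw_curve_antimono[OF h R \<mu> B _ anti])
    fix j assume "a \<le> j" "j < b - 3"
    from in1[OF this] show "\<alpha> \<le> u \<and> u < real j * h \<and> real j * h + 2 * h < L" using u by auto
  next
    fix j x assume "a \<le> j" "j < b - 3" "real j * h < x" "x < real j * h + 2 * h"
    with in1[of j] show "\<mu> \<le> R * h\<^sup>2 * f'' x \<and> R * h\<^sup>2 * f'' x \<le> B" by (intro bd) auto
  qed
  moreover have "145 * real (b - 3 - a) * B powr (1/3) \<le> 145 * ((v - u) / h + 1) * B powr (1/3)"
    using ba by (intro mult_right_mono mult_left_mono) auto
  ultimately show ?thesis
    using abs_sum_saw_le_trimmed[of "\<lambda>j. R * f (real j * h)" a b] unfolding S by linarith
qed

end

section \<open>Large r, uniformly in the stretch factor\<close>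

context
  fixes f f' f'' :: "real \<Rightarrow> real" and \<alpha> L Q :: real
  assumes D1: "\<And>x. \<alpha> < x \<Longrightarrow> x < L \<Longrightarrow> (f has_real_derivative f' x) (at x)"
    and D2: "\<And>x. \<alpha> < x \<Longrightarrow> x < L \<Longrightarrow> (f' has_real_derivative f'' x) (at x)"
    and Q: "\<And>x. \<alpha> < x \<Longrightarrow> x < L \<Longrightarrow> - Q \<le> f' x \<and> f' x \<le> 0"
    and Q0: "0 \<le> Q" and \<alpha>0: "0 \<le> \<alpha>"
begin

text \<open>Height factor \<open>r * s\<close> and step \<open>s / r\<close> scale second
  differences by \<open>s ^ 3 / r\<close>, whence 27.\<close>

lemma stretch_curvature_bounds:
  fixes r s y :: real
  assumes "0 < r" "1/3 \<le> s" "s \<le> 3" "0 \<le> y"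
  shows "y / (27 * r) \<le> (r * s) * (s / r)\<^sup>2 * y" "(r * s) * (s / r)\<^sup>2 * y \<le> 27 * y / r"
proof -
  have eq: "(r * s) * (s / r)\<^sup>2 = s ^ 3 / r" using assms by (simp add: field_simps power2_eq_square power3_eq_cube)
  have "(1/3) ^ 3 \<le> s ^ 3" "s ^ 3 \<le> 3 ^ 3" using assms by (intro power_mono; simp)+
  then have s: "1 / 27 \<le> s ^ 3" "s ^ 3 \<le> 27" by (simp_all add: power3_eq_cube)
  then have "(1/27) * (y / r) \<le> s ^ 3 * (y / r)" "s ^ 3 * (y / r) \<le> 27 * (y / r)"
    using assms by (intro mult_right_mono divide_nonneg_pos; simp)+
  then show "y / (27 * r) \<le> (r * s) * (s / r)\<^sup>2 * y" "(r * s) * (s / r)\<^sup>2 * y \<le> 27 * y / r"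
    unfolding eq by (simp_all only: times_divide_eq_left times_divide_eq_right divide_divide_eq_left mult_1 mult_1_left)
qed

text \<open>There are O(r) columns, the second differences are at least \<open>\<kappa> / r\<close>,
  and the range of the first differences is at most \<open>9 * Q\<close> for every r. The three
  terms of the estimate become r^(2/3), r^(2/3) and r^(1/2).\<close>

lemma sum_saw_columns_lower_asymp:
  assumes u: "\<alpha> \<le> u" "u \<le> v" "v \<le> L" and \<mu>: "0 < \<mu>" and low: "\<And>x. u < x \<Longrightarrow> x < v \<Longrightarrow> \<mu> \<le> f'' x"
  shows "\<exists>C. \<forall>\<^sub>F r in at_top. \<forall>s\<in>{1/3..3}.
    \<bar>\<Sum>j | u < real j * (s / r) \<and> real j * (s / r) \<le> v. saw (r * s * f (real j * (s / r)))\<bar> \<le> C * r powr (2/3)"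
proof -
  define \<kappa> where "\<kappa> = \<mu> / 27"
  have \<kappa>: "\<kappa> > 0" using \<mu> by (simp add: \<kappa>_def)
  define C where "C = 3 + (3 * (v - u) + 1) * \<kappa> powr (1/3) + 648 * Q * \<kappa> powr (-2/3) + 48 * \<kappa> powr (-1/2)"
  have "\<bar>\<Sum>j | u < real j * (s / r) \<and> real j * (s / r) \<le> v. saw (r * s * f (real j * (s / r)))\<bar> \<le> C * r powr (2/3)"
    if r: "r \<ge> max 1 \<kappa>" and s: "s \<in> {1/3..3}" for r s
  proof -
    have r0: "r > 0" "r \<ge> 1" "\<kappa> \<le> r" using r by auto
    have s0: "0 < s" "1/3 \<le> s" "s \<le> 3" using s by auto
    have "\<bar>\<Sum>j | u < real j * (s / r) \<and> real j * (s / r) \<le> v. saw (r * s * f (real j * (s / r)))\<bar> \<le> 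
      3 + ((v - u) / (s / r) + 1) * (\<kappa> / r) powr (1/3) + 72 * ((r * s) * (s / r) * Q) * (\<kappa> / r) powr (-2/3) + 48 * (\<kappa> / r) powr (-1/2)"
    proof (rule sum_saw_columns_lower[OF D1 D2 Q])
      fix x assume x: "u < x" "x < v"
      have "\<kappa> / r = \<mu> / (27 * r)" by (simp add: \<kappa>_def)
      also have "\<dots> \<le> f'' x / (27 * r)" using low[OF x] r0 by (intro divide_right_mono) auto
      also have "\<dots> \<le> r * s * (s / r)\<^sup>2 * f'' x"
        using stretch_curvature_bounds(1)[of r s "f'' x"] r0 s0 low[OF x] \<mu> by simp
      finally show "\<kappa> / r \<le> r * s * (s / r)\<^sup>2 * f'' x" .
    qed (use r0 s0 \<kappa> u \<alpha>0 Q0 in auto)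
    also have "(v - u) / (s / r) + 1 \<le> (3 * (v - u) + 1) * r"
    proof -
      have "(v - u) * r / s \<le> (v - u) * r / (1/3)" using r0 s0 u by (intro divide_left_mono) auto
      then show ?thesis using r0 by (simp add: algebra_simps)
    qed
    then have "((v - u) / (s / r) + 1) * (\<kappa> / r) powr (1/3) \<le> (3 * (v - u) + 1) * r * (\<kappa> / r) powr (1/3)"
      by (intro mult_right_mono) auto
    also have "\<dots> = (3 * (v - u) + 1) * \<kappa> powr (1/3) * (r powr 1 * r powr (-1/3))"
      using r0 \<kappa> by (simp add: powr_divide powr_minus_divide)
    also have "r powr 1 * r powr (-1/3) = r powr (2/3)" unfolding powr_add[symmetric] by simp
    also have "72 * ((r * s) * (s / r) * Q) * (\<kappa> / r) powr (-2/3) \<le> 72 * (9 * Q) * (\<kappa> / r) powr (-2/3)"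
    proof (intro mult_right_mono mult_left_mono)
      have "s * s \<le> 3 * 3" using s0 by (intro mult_mono) auto
      then show "r * s * (s / r) \<le> 9" using r0 by simp
    qed (use Q0 in auto)
    also have "\<dots> = 648 * Q * \<kappa> powr (-2/3) * r powr (2/3)"
      using r0 \<kappa> by (simp add: powr_divide powr_minus_divide)
    also have "48 * (\<kappa> / r) powr (-1/2) = 48 * \<kappa> powr (-1/2) * r powr (1/2)"
      using r0 \<kappa> by (simp add: powr_divide powr_minus_divide)
    also have "\<dots> \<le> 48 * \<kappa> powr (-1/2) * r powr (2/3)"
      using r0 by (intro mult_left_mono powr_mono) auto
    finally have "\<bar>\<Sum>j | u < real j * (s / r) \<and> real j * (s / r) \<le> v. saw (r * s * f (real j * (s / r)))\<bar> \<le>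
      3 + (3 * (v - u) + 1) * \<kappa> powr (1/3) * r powr (2/3) + 648 * Q * \<kappa> powr (-2/3) * r powr (2/3) + 48 * \<kappa> powr (-1/2) * r powr (2/3)"
      by simp
    moreover have "(3::real) \<le> 3 * r powr (2/3)" using r0 by (simp add: ge_one_powr_ge_zero)
    ultimately show ?thesis unfolding C_def distrib_right by linarith
  qed
  then show ?thesis unfolding eventually_at_top_linorder by blast
qed

lemma sum_saw_columns_antimono_asymp:
  assumes c: "\<alpha> \<le> c" "c < L" and anti: "antimono_on {c<..<L} f''"
    and pos: "\<And>x. c < x \<Longrightarrow> x < L \<Longrightarrow> 0 < f'' x \<and> f'' x \<le> B"
    and \<delta>: "\<forall>\<^sub>F r in at_top. 0 < \<delta> r \<and> \<delta> r < L - c"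
    and \<delta>O: "\<forall>\<^sub>F r in at_top. \<delta> r \<le> K * r powr (- 2 * a)" and K: "0 < K"
    and fO: "\<forall>\<^sub>F r in at_top. 1 / f'' (L - \<delta> r) \<le> K * r powr (1 - 4 * b)"
    and e: "e \<le> 1/6" "e \<le> a" "e \<le> b"
  shows "\<exists>C. \<forall>\<^sub>F r in at_top. \<forall>s\<in>{1/3..3}.
    \<bar>\<Sum>j | c < real j * (s / r) \<and> real j * (s / r) \<le> L. saw (r * s * f (real j * (s / r)))\<bar> \<le> C * r powr (1 - 2 * e)"
proof -
  have B: "0 < B" using pos[of "(c + L) / 2"] c by auto
  define C where "C = 4 + 145 * (3 * (L - c) + 1) * (27 * B) powr (1/3) + 340 * (27 * K) powr (1/2) + 3 * K"
  have "\<forall>\<^sub>F r in at_top. r \<ge> 1 \<and> r \<ge> 27 * B" by (intro eventually_conj eventually_ge_at_top)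
  with \<delta> \<delta>O fO have "\<forall>\<^sub>F r in at_top. \<forall>s\<in>{1/3..3}.
    \<bar>\<Sum>j | c < real j * (s / r) \<and> real j * (s / r) \<le> L. saw (r * s * f (real j * (s / r)))\<bar> \<le> C * r powr (1 - 2 * e)"
  proof eventually_elim
    case (elim r)
    show ?case
    proof
      fix s :: real assume s: "s \<in> {1/3..3}"
      have r0: "r > 0" "r \<ge> 1" "27 * B \<le> r" using elim by auto
      have s0: "0 < s" "1/3 \<le> s" "s \<le> 3" using s by auto
      define h where "h = s / r"
      have h: "h > 0" using r0 s0 by (simp add: h_def)
      define v where "v = L - \<delta> r"
      have v: "c < v" "v < L" using elim by (auto simp: v_def)
      \<comment> \<open>As \<open>f''\<close> decreases, its value at the cut \<open>v\<close>
        bounds all second differences before \<open>v\<close> from below.\<close>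
      define \<nu> where "\<nu> = f'' v / (27 * r)"
      have fv: "0 < f'' v" "f'' v \<le> B" using pos v by auto
      have len: "w / h \<le> 3 * w * r" if "0 \<le> w" for w
      proof -
        have "w * r / s \<le> w * r / (1/3)" using r0 s0 that by (intro divide_left_mono) auto
        then show ?thesis by (simp add: h_def)
      qed
      let ?g = "\<lambda>j. saw (r * s * f (real j * h))"
      have "\<bar>\<Sum>j | c < real j * h \<and> real j * h \<le> v. ?g j\<bar> 
        \<le> 3 + 145 * ((v - c) / h + 1) * (27 * B / r) powr (1/3) + 340 * \<nu> powr (-1/2)"
      proof (rule sum_saw_columns_antimono[OF D1 D2 Q])
        show "\<nu> \<le> 27 * B / r" unfolding \<nu>_def using fv r0 B by (intro frac_le) auto
        fix x assume x: "c < x" "x < v"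
        have "f'' v \<le> f'' x" using x v by (intro monotone_onD[OF anti]) auto
        then have "\<nu> \<le> f'' x / (27 * r)" unfolding \<nu>_def using r0 by (intro divide_right_mono) auto
        also have "\<dots> \<le> r * s * h\<^sup>2 * f'' x" unfolding h_def
          using stretch_curvature_bounds(1)[of r s "f'' x"] r0 s0 fv \<open>f'' v \<le> f'' x\<close> by simp
        finally have 1: "\<nu> \<le> r * s * h\<^sup>2 * f'' x" .
        have "r * s * h\<^sup>2 * f'' x \<le> 27 * f'' x / r" unfolding h_def
          using stretch_curvature_bounds(2)[of r s "f'' x"] r0 s0 fv \<open>f'' v \<le> f'' x\<close> by simp
        also have "\<dots> \<le> 27 * B / r" using pos[of x] x v r0 by (intro divide_right_mono) auto
        finally show "\<nu> \<le> r * s * h\<^sup>2 * f'' x \<and> r * s * h\<^sup>2 * f'' x \<le> 27 * B / r" using 1 by simp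
      qed (use r0 s0 h c v \<alpha>0 anti fv \<nu>_def in auto)
      also have "145 * ((v - c) / h + 1) * (27 * B / r) powr (1/3) \<le> 145 * ((3 * (L - c) + 1) * r) * (27 * B / r) powr (1/3)"
      proof (intro mult_right_mono mult_left_mono)
        have "(v - c) / h \<le> 3 * (v - c) * r" using v by (intro len) auto
        also have "\<dots> \<le> 3 * (L - c) * r" using v r0 by (intro mult_right_mono) auto
        finally show "(v - c) / h + 1 \<le> (3 * (L - c) + 1) * r" using r0 by (simp add: algebra_simps)
      qed auto
      also have "\<dots> = 145 * (3 * (L - c) + 1) * (27 * B) powr (1/3) * (r powr 1 * r powr (-1/3))"
        using r0 B by (simp add: powr_divide powr_minus_divide)
      also have "r powr 1 * r powr (-1/3) = r powr (2/3)" unfolding powr_add[symmetric] by simp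
      also have "145 * (3 * (L - c) + 1) * (27 * B) powr (1/3) * r powr (2/3) \<le> 145 * (3 * (L - c) + 1) * (27 * B) powr (1/3) * r powr (1 - 2 * e)"
        using r0 c e by (intro mult_left_mono powr_mono) auto
      also have "\<nu> powr (-1/2) \<le> (27 * K) powr (1/2) * r powr (1 - 2 * e)"
      proof -
        have "\<nu> powr (-1/2) = (27 * r * (1 / f'' v)) powr (1/2)"
          using r0 fv by (simp add: \<nu>_def powr_divide powr_minus_divide)
        also have "\<dots> \<le> (27 * r * (K * r powr (1 - 4 * b))) powr (1/2)"
          using elim fv r0 unfolding v_def by (intro powr_mono2 mult_left_mono) auto
        also have "27 * r * (K * r powr (1 - 4 * b)) = 27 * K * (r powr 1 * r powr (1 - 4 * b))" using r0 by simp
        also have "r powr 1 * r powr (1 - 4 * b) = r powr (2 - 4 * b)" unfolding powr_add[symmetric] by simp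
        also have "(27 * K * r powr (2 - 4 * b)) powr (1/2) = (27 * K) powr (1/2) * r powr (1 - 2 * b)"
          using r0 K by (simp add: powr_mult powr_powr diff_divide_distrib)
        also have "\<dots> \<le> (27 * K) powr (1/2) * r powr (1 - 2 * e)"
          using r0 e by (intro mult_left_mono powr_mono) auto
        finally show ?thesis .
      qed
      finally have 1: "\<bar>\<Sum>j | c < real j * h \<and> real j * h \<le> v. ?g j\<bar> 
        \<le> 3 + 145 * (3 * (L - c) + 1) * (27 * B) powr (1/3) * r powr (1 - 2 * e) + 340 * ((27 * K) powr (1/2) * r powr (1 - 2 * e))"
        by simp
      have "\<bar>\<Sum>j | v < real j * h \<and> real j * h \<le> L. ?g j\<bar> \<le> real (card {j::nat. v < real j * h \<and> real j * h \<le> L})"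
        by (rule abs_sum_saw_le_card)
      also have "\<dots> \<le> (L - v) / h + 1" using h v c \<alpha>0 by (intro card_columns_le) auto
      also have "\<dots> \<le> 3 * \<delta> r * r + 1" using len[of "L - v"] v by (simp add: v_def)
      also have "\<dots> \<le> 3 * (K * r powr (- 2 * a)) * r + 1"
        using elim r0 by (intro add_mono mult_right_mono mult_left_mono) auto
      also have "\<dots> = 3 * K * (r powr (- 2 * a) * r powr 1) + 1" using r0 by simp
      also have "r powr (- 2 * a) * r powr 1 = r powr (1 - 2 * a)" unfolding powr_add[symmetric] by simp
      also have "3 * K * r powr (1 - 2 * a) \<le> 3 * K * r powr (1 - 2 * e)"
        using r0 e K by (intro mult_left_mono powr_mono) auto
      finally have 2: "\<bar>\<Sum>j | v < real j * h \<and> real j * h \<le> L. ?g j\<bar> \<le> 3 * K * r powr (1 - 2 * e) + 1" by simp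
      have fin: "finite {j::nat. x < real j * h \<and> real j * h \<le> y}" if "0 \<le> x" "x \<le> y" for x y
        unfolding columns_eq_interval[OF h that] by simp
      have "(\<Sum>j | c < real j * h \<and> real j * h \<le> L. ?g j) = (\<Sum>j | c < real j * h \<and> real j * h \<le> v. ?g j) + (\<Sum>j | v < real j * h \<and> real j * h \<le> L. ?g j)"
        by (subst sum.union_disjoint[symmetric]) (use fin c v \<alpha>0 in \<open>auto intro!: sum.cong\<close>)
      then have 0: "\<bar>\<Sum>j | c < real j * h \<and> real j * h \<le> L. ?g j\<bar> \<le> \<bar>\<Sum>j | c < real j * h \<and> real j * h \<le> v. ?g j\<bar> + \<bar>\<Sum>j | v < real j * h \<and> real j * h \<le> L. ?g j\<bar>"
        using abs_triangle_ineq by simp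
      have 3: "(1::real) \<le> r powr (1 - 2 * e)" using r0 e by (simp add: ge_one_powr_ge_zero)
      have "\<bar>\<Sum>j | c < real j * h \<and> real j * h \<le> L. ?g j\<bar> \<le> C * r powr (1 - 2 * e)"
        using 0 1 2 3 unfolding C_def distrib_right mult.assoc[of 340] by linarith
      then show "\<bar>\<Sum>j | c < real j * (s / r) \<and> real j * (s / r) \<le> L. saw (r * s * f (real j * (s / r)))\<bar> \<le> C * r powr (1 - 2 * e)"
        unfolding h_def .
    qed
  qed
  then show ?thesis by blast
qed

end

section \<open>From the smoothness hypotheses to a bound along a whole arc\<close>

lemma has_C2_derivs_on_interior:
  assumes "has_C2_derivs_on f f' f'' {\<alpha>..<L}" "\<alpha> < x" "x < L"
  shows "(f has_real_derivative f' x) (at x)" "(f' has_real_derivative f'' x) (at x)"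
proof -
  have "at x within {\<alpha>..<L} = at x"
    using assms(2,3) by (intro at_within_interior) (simp add: interior_atLeastLessThan)
  then show "(f has_real_derivative f' x) (at x)" "(f' has_real_derivative f'' x) (at x)"
    using assms unfolding has_C2_derivs_on_def by (metis atLeastLessThan_iff less_imp_le)+
qed

lemma convex_C2_derivative_bound:
  assumes C2: "has_C2_derivs_on f f' f'' {\<alpha>..<L}" and neg: "\<forall>x\<in>{\<alpha>..<L}. f' x < 0 \<and> f'' x > 0"
    and x: "\<alpha> < x" "x < L"
  shows "f' \<alpha> \<le> f' x \<and> f' x \<le> 0"
proof
  have "continuous_on {\<alpha>..<L} f'"
    using C2 unfolding has_C2_derivs_on_def by (intro DERIV_continuous_on) auto
  then have cont: "continuous_on {\<alpha>..x} f'" by (rule continuous_on_subset) (use x in auto)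
  show "f' \<alpha> \<le> f' x"
  proof (rule DERIV_nonneg_imp_increasing_open[where f = f'])
    fix z assume z: "\<alpha> < z" "z < x"
    then have "0 < f'' z" using neg x by simp
    moreover have "(f' has_real_derivative f'' z) (at z)" using z x by (intro has_C2_derivs_on_interior(2)[OF C2]) simp_all
    ultimately show "\<exists>y. (f' has_real_derivative y) (at z) \<and> 0 \<le> y" by (intro exI[of _ "f'' z"] conjI less_imp_le)
  qed (use x cont in simp_all)
  have "f' x < 0" using neg x by simp
  then show "f' x \<le> 0" by simp
qed

text \<open>Only the piece ending at \<open>L\<close> matters: on the compact rest of the arc the
  continuous positive second derivative has a positive minimum.\<close>

lemma piecewise_monotonic_last:
  assumes "piecewise_monotonic h p m" "p 0 = \<alpha>" "p m = L" "\<alpha> < L"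
  obtains c where "\<alpha> \<le> c" "c < L" "mono_on {c<..<L} h \<or> antimono_on {c<..<L} h"
proof -
  have "m \<noteq> 0" using assms by (cases m) auto
  then obtain k where m: "m = Suc k" by (cases m) auto
  have le: "p 0 \<le> p i" if "i \<le> k" for i
    using that
  proof (induction i)
    case (Suc i)
    then show ?case using assms(1) m unfolding piecewise_monotonic_def by (metis Suc_le_lessD le_SucI less_imp_le order_trans Suc_leD)
  qed simp
  show ?thesis
    using that[of "p k"] le[of k] assms m unfolding piecewise_monotonic_def by auto
qed

lemma sum_saw_curve_asymp:
  assumes \<alpha>: "0 < \<alpha>" "\<alpha> < L"
    and C2: "has_C2_derivs_on f f' f'' {\<alpha>..<L}" and neg: "\<forall>x\<in>{\<alpha>..<L}. f' x < 0 \<and> f'' x > 0"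
    and p: "p 0 = \<alpha>" "p m = L" "piecewise_monotonic f'' p m"
    and \<delta>: "\<forall>r>0. 0 < \<delta> r"
    and a: "0 < a"
    and \<delta>O: "\<delta> \<in> O[at_top](\<lambda>r. r powr (- 2 * a))"
    and fO: "(\<lambda>r. 1 / f'' (L - \<delta> r)) \<in> O[at_top](\<lambda>r. r powr (1 - 4 * b))"
    and e: "e \<le> 1/6" "e \<le> a" "e \<le> b"
  shows "\<exists>C. \<forall>\<^sub>F r in at_top. \<forall>s\<in>{1/3..3}.
    \<bar>\<Sum>j | \<alpha> < real j * (s / r) \<and> real j * (s / r) \<le> L. saw (r * s * f (real j * (s / r)))\<bar> \<le> C * r powr (1 - 2 * e)"
proof -
  define Q where "Q = - f' \<alpha>"
  note D = has_C2_derivs_on_interior[OF C2]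
  have Q: "- Q \<le> f' x \<and> f' x \<le> 0" if "\<alpha> < x" "x < L" for x
    using convex_C2_derivative_bound[OF C2 neg that] by (simp add: Q_def)
  have "f' \<alpha> < 0" using neg \<alpha> by auto
  then have Q0: "0 \<le> Q" by (simp add: Q_def)
  have \<alpha>0: "0 \<le> \<alpha>" using \<alpha> by simp
  have cont: "continuous_on {\<alpha>..<L} f''" using C2 by (simp add: has_C2_derivs_on_def)
  have low: "\<exists>\<mu>>0. \<forall>x\<in>{\<alpha>..c}. \<mu> \<le> f'' x" if c: "\<alpha> \<le> c" "c < L" for c
  proof -
    have "\<exists>x\<in>{\<alpha>..c}. \<forall>y\<in>{\<alpha>..c}. f'' x \<le> f'' y"
      by (intro continuous_attains_inf continuous_on_subset[OF cont]) (use c in auto)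
    then obtain x where x: "x \<in> {\<alpha>..c}" "\<forall>y\<in>{\<alpha>..c}. f'' x \<le> f'' y" by blast
    then show ?thesis using neg c by (intro exI[of _ "f'' x"]) auto
  qed
  obtain c0 where c0: "\<alpha> \<le> c0" "c0 < L" "mono_on {c0<..<L} f'' \<or> antimono_on {c0<..<L} f''"
    using piecewise_monotonic_last[OF p(3,1,2) \<alpha>(2)] .
  \<comment> \<open>\<open>c\<close> lies strictly inside the last piece so that monotonicity
    applies to \<open>f'' c\<close> itself, which then bounds \<open>f''\<close> beyond
    \<open>c\<close> from below or from above.\<close>
  define c where "c = (c0 + L) / 2"
  have c: "\<alpha> \<le> c" "c0 < c" "c < L" using c0 by (auto simp: c_def)
  obtain \<mu> where \<mu>: "\<mu> > 0" "\<And>x. x \<in> {\<alpha>..c} \<Longrightarrow> \<mu> \<le> f'' x" using low[OF c(1,3)] by auto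
  let ?S = "\<lambda>u v r s. \<Sum>j | u < real j * (s / r) \<and> real j * (s / r) \<le> v. saw (r * s * f (real j * (s / r)))"
  show ?thesis
  proof (cases "mono_on {c0<..<L} f''")
    \<comment> \<open>An increasing \<open>f''\<close> never falls below its minimum on
      \<open>{\<alpha>..c}\<close>, so no cut near \<open>L\<close> is needed.\<close>
    case True
    have "\<mu> \<le> f'' x" if x: "\<alpha> < x" "x < L" for x
    proof (cases "x \<le> c")
      case False
      have "\<mu> \<le> f'' c" using c by (intro \<mu>) auto
      also have "\<dots> \<le> f'' x" using False c x by (intro mono_onD[OF True]) auto
      finally show ?thesis .
    qed (use x \<mu> in auto)
    from sum_saw_columns_lower_asymp[OF D Q Q0 \<alpha>0 order_refl less_imp_le[OF \<alpha>(2)] order_refl \<mu>(1) this]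
    obtain C where C: "\<forall>\<^sub>F r in at_top. \<forall>s\<in>{1/3..3}. \<bar>?S \<alpha> L r s\<bar> \<le> C * r powr (2/3)" by auto
    have "\<forall>\<^sub>F r in at_top. \<forall>s\<in>{1/3..3}. \<bar>?S \<alpha> L r s\<bar> \<le> \<bar>C\<bar> * r powr (1 - 2 * e)"
      using C eventually_ge_at_top[of 1]
    proof eventually_elim
      case (elim r)
      have "C * r powr (2/3) \<le> \<bar>C\<bar> * r powr (1 - 2 * e)" using elim e by (intro mult_mono powr_mono) auto
      then show ?case using elim(1) by (blast intro: order_trans)
    qed
    then show ?thesis by blast
  next
    case False
    then have anti0: "antimono_on {c0<..<L} f''" using c0 by auto
    have anti: "antimono_on {c<..<L} f''" by (rule monotone_on_subset[OF anti0]) (use c in auto)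
    have bd: "0 < f'' x \<and> f'' x \<le> f'' c" if "c < x" "x < L" for x
      using that c neg by (auto intro!: monotone_onD[OF anti0])
    have low': "\<And>x. \<alpha> < x \<Longrightarrow> x < c \<Longrightarrow> \<mu> \<le> f'' x" using \<mu> by auto
    from sum_saw_columns_lower_asymp[OF D Q Q0 \<alpha>0 order_refl c(1) less_imp_le[OF c(3)] \<mu>(1) low']
    obtain C1 where C1: "\<forall>\<^sub>F r in at_top. \<forall>s\<in>{1/3..3}. \<bar>?S \<alpha> c r s\<bar> \<le> C1 * r powr (2/3)" by auto
    obtain K1 where K1: "K1 > 0" "\<forall>\<^sub>F r in at_top. norm (\<delta> r) \<le> K1 * norm (r powr (- 2 * a))"
      using landau_o.bigE[OF \<delta>O] by blast
    obtain K2 where K2: "K2 > 0" "\<forall>\<^sub>F r in at_top. norm (1 / f'' (L - \<delta> r)) \<le> K2 * norm (r powr (1 - 4 * b))"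
      using landau_o.bigE[OF fO] by blast
    define K where "K = max K1 K2"
    have K: "K > 0" using K1 by (simp add: K_def)
    have \<delta>1: "\<forall>\<^sub>F r in at_top. \<delta> r \<le> K * r powr (- 2 * a)"
      using K1(2)
    proof eventually_elim
      case (elim r)
      have "\<delta> r \<le> K1 * r powr (- 2 * a)" using elim by simp
      also have "\<dots> \<le> K * r powr (- 2 * a)" by (intro mult_right_mono) (auto simp: K_def)
      finally show ?case .
    qed
    have f1: "\<forall>\<^sub>F r in at_top. 1 / f'' (L - \<delta> r) \<le> K * r powr (1 - 4 * b)"
      using K2(2)
    proof eventually_elim
      case (elim r)
      have "1 / f'' (L - \<delta> r) \<le> norm (1 / f'' (L - \<delta> r))" by (simp only: real_norm_def abs_ge_self)
      also note elim
      also have "K2 * norm (r powr (1 - 4 * b)) = K2 * r powr (1 - 4 * b)" by simp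
      also have "\<dots> \<le> K * r powr (1 - 4 * b)" by (intro mult_right_mono) (auto simp: K_def)
      finally show ?case .
    qed
    \<comment> \<open>The cut \<open>L - \<delta> r\<close> has to lie beyond \<open>c\<close>; this
      holds eventually because \<open>\<delta> r\<close> tends to 0.\<close>
    have "((\<lambda>r. K * r powr (- 2 * a)) \<longlongrightarrow> K * 0) at_top"
      using a by (intro tendsto_intros tendsto_neg_powr filterlim_ident) auto
    then have "\<forall>\<^sub>F r in at_top. K * r powr (- 2 * a) < L - c"
      using c by (intro order_tendstoD(2)) auto
    with \<delta>1 eventually_gt_at_top[of 0] have \<delta>2: "\<forall>\<^sub>F r in at_top. 0 < \<delta> r \<and> \<delta> r < L - c"
      by eventually_elim (use \<delta> in auto)
    from sum_saw_columns_antimono_asymp[OF D Q Q0 \<alpha>0 c(1,3) anti bd \<delta>2 \<delta>1 K f1 e]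
    obtain C2 where C2: "\<forall>\<^sub>F r in at_top. \<forall>s\<in>{1/3..3}. \<bar>?S c L r s\<bar> \<le> C2 * r powr (1 - 2 * e)" by auto
    have "\<forall>\<^sub>F r in at_top. \<forall>s\<in>{1/3..3}. \<bar>?S \<alpha> L r s\<bar> \<le> (\<bar>C1\<bar> + C2) * r powr (1 - 2 * e)"
      using C1 C2 eventually_ge_at_top[of 1]
    proof eventually_elim
      case (elim r)
      show ?case
      proof
        fix s :: real assume s: "s \<in> {1/3..3}"
        have h: "s / r > 0" using s elim by auto
        have "C1 * r powr (2/3) \<le> \<bar>C1\<bar> * r powr (1 - 2 * e)" using elim e by (intro mult_mono powr_mono) auto
        moreover have "\<bar>?S \<alpha> c r s\<bar> \<le> C1 * r powr (2/3)" "\<bar>?S c L r s\<bar> \<le> C2 * r powr (1 - 2 * e)"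
          using elim s by auto
        moreover have fin: "finite {j::nat. x < real j * (s / r) \<and> real j * (s / r) \<le> y}" if "0 \<le> x" "x \<le> y" for x y
          unfolding columns_eq_interval[OF h that] by simp
        have "?S \<alpha> L r s = ?S \<alpha> c r s + ?S c L r s"
          by (subst sum.union_disjoint[symmetric]) (use fin c \<alpha> in \<open>auto intro!: sum.cong\<close>)
        ultimately show "\<bar>?S \<alpha> L r s\<bar> \<le> (\<bar>C1\<bar> + C2) * r powr (1 - 2 * e)"
          unfolding distrib_right by linarith
      qed
    qed
    then show ?thesis by blast
  qed
qed

section \<open>Lattice points below a convex curve\<close>

lemma has_integral_affine_real:
  fixes a b u c :: real
  assumes "a \<le> b"
  shows "((\<lambda>x. u + c * x) has_integral (b - a) * u + c * ((b\<^sup>2 - a\<^sup>2) / 2)) {a..b}"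
proof -
  have "((\<lambda>x. u) has_integral (b - a) * u) {a..b}"
    using has_integral_const_real[of u a b] assms by simp
  then show ?thesis
    by (intro has_integral_add has_integral_mult_right ident_has_integral assms)
qed

lemma convex_integral_le_trapezoid:
  fixes f :: "real \<Rightarrow> real"
  assumes f: "convex_on S f" "continuous_on {a..b} f" and ab: "{a..b} \<subseteq> S" "a \<le> b"
  shows "integral {a..b} f \<le> (b - a) * (f a + f b) / 2"
proof (cases "a = b")
  case False
  with ab have ab': "a < b" by simp
  define c where "c = (f b - f a) / (b - a)"
  have "((\<lambda>x. (f a - c * a) + c * x) has_integral ((b - a) * (f a - c * a) + c * ((b\<^sup>2 - a\<^sup>2) / 2))) {a..b}"
    using ab by (intro has_integral_affine_real) auto
  moreover have "(b - a) * (f a - c * a) + c * ((b\<^sup>2 - a\<^sup>2) / 2) = (b - a) * f a + (b - a) * c * (b - a) / 2"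
    by (simp add: power2_eq_square algebra_simps) (simp add: field_simps)
  moreover have "(b - a) * f a + (b - a) * c * (b - a) / 2 = (b - a) * (f a + f b) / 2"
  proof -
    have slope: "(b - a) * c = f b - f a" using ab' by (simp add: c_def)
    show ?thesis unfolding slope by (simp add: field_simps)
  qed
  ultimately have chord: "((\<lambda>x. (f a - c * a) + c * x) has_integral (b - a) * (f a + f b) / 2) {a..b}"
    by (simp only:)
  have "integral {a..b} f \<le> integral {a..b} (\<lambda>x. (f a - c * a) + c * x)"
  proof (rule integral_le)
    show "f integrable_on {a..b}" by (rule integrable_continuous_real[OF f(2)])
    show "(\<lambda>x. (f a - c * a) + c * x) integrable_on {a..b}" using chord by blast
    fix x assume x: "x \<in> {a..b}"
    show "f x \<le> (f a - c * a) + c * x"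
    proof -
      define t where "t = (x - a) / (b - a)"
      have t: "0 \<le> t" "t \<le> 1" using x ab' by (auto simp: t_def)
      have xt: "(1 - t) *\<^sub>R a + t *\<^sub>R b = x" 
      proof -
        have "t * (b - a) = x - a" using ab' by (simp add: t_def)
        then show ?thesis by (simp add: algebra_simps)
      qed
      have "f ((1 - t) *\<^sub>R a + t *\<^sub>R b) \<le> (1 - t) * f a + t * f b"
        using t ab ab' by (intro convex_onD[OF f(1)]) auto
      also have "(1 - t) * f a + t * f b = f a + t * (f b - f a)" by (simp add: algebra_simps)
      also have "t * (f b - f a) = c * (x - a)" by (simp add: t_def c_def)
      finally show ?thesis unfolding xt by (simp add: algebra_simps)
    qed
  qed
  then show ?thesis using chord by (simp add: integral_unique)
qed simp

text \<open>For x \<ge> 0 this is the number of naturals up to x with 0 included; the count of 0 is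
  the source of the summand 1/2 throughout.\<close>

lemma floor_plus_one_eq_saw: "of_int \<lfloor>x\<rfloor> + 1 = x - saw x + 1/2"
  by (simp add: saw_def frac_def)

text \<open>The curve is kept fixed and the grid is rescaled to steps \<open>h\<close> and
  \<open>h'\<close>. Exchanging the axes then amounts to swapping \<open>L\<close>,
  \<open>f\<close>, \<open>h\<close> with \<open>M\<close>, \<open>g\<close>,
  \<open>h'\<close>.\<close>

definition lattice_points :: "real \<Rightarrow> (real \<Rightarrow> real) \<Rightarrow> real \<Rightarrow> real \<Rightarrow> (nat \<times> nat) set" where
  "lattice_points L f h h' = {(j, k). real j * h \<le> L \<and> real k * h' \<le> f (real j * h)}"

lemma lattice_count_eq_card:
  assumes "0 < r" "0 < s"
  shows "lattice_count L f r s = card (lattice_points L f (s / r) (1 / (r * s)))"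
proof -
  have "real k \<le> r * s * y \<longleftrightarrow> real k * (1 / (r * s)) \<le> y" for k y
    using assms by (simp add: field_simps)
  then show ?thesis unfolding lattice_count_def lattice_points_def by simp
qed

section \<open>A convex curve and its inverse\<close>

locale convex_curve =
  fixes L M :: real and f g :: "real \<Rightarrow> real"
  assumes L: "0 < L" and M: "0 < M"
    and f_cont: "continuous_on {0..L} f" and f_convex: "convex_on {0..L} f"
    and f_anti: "strict_antimono_on {0..L} f"
    and f_0: "f 0 = M" and f_L: "f L = 0"
    and g_f: "x \<in> {0..L} \<Longrightarrow> g (f x) = x"
begin

lemma f_less: "0 \<le> x \<Longrightarrow> x < y \<Longrightarrow> y \<le> L \<Longrightarrow> f y < f x"
  by (rule monotone_onD[OF f_anti, simplified]) auto

lemma f_le: "0 \<le> x \<Longrightarrow> x \<le> y \<Longrightarrow> y \<le> L \<Longrightarrow> f y \<le> f x"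
  using f_less[of x y] by (cases "x = y") auto

lemma f_range: "0 \<le> x \<Longrightarrow> x \<le> L \<Longrightarrow> 0 \<le> f x \<and> f x \<le> M"
  using f_le[of 0 x] f_le[of x L] f_0 f_L by auto

lemma f_image: "f ` {0..L} = {0..M}"
proof
  show "f ` {0..L} \<subseteq> {0..M}" using f_range by auto
  show "{0..M} \<subseteq> f ` {0..L}"
  proof
    fix y assume y: "y \<in> {0..M}"
    have "\<exists>x. 0 \<le> x \<and> x \<le> L \<and> f x = y" by (rule IVT2'[OF _ _ _ f_cont]) (use y f_0 f_L L in auto)
    then show "y \<in> f ` {0..L}" by auto
  qed
qed

lemma f_g: "y \<in> {0..M} \<Longrightarrow> f (g y) = y"
  using g_f f_image by (metis imageE)

lemma g_range: "0 \<le> y \<Longrightarrow> y \<le> M \<Longrightarrow> 0 \<le> g y \<and> g y \<le> L"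
  using g_f f_image by (metis atLeastAtMost_iff imageE)

text \<open>Through this, facts about columns also serve for rows. Convexity of \<open>g\<close>
  holds because the decreasing \<open>f\<close> turns a violation of it into a violation of the
  convexity of \<open>f\<close> at \<open>g x\<close> and \<open>g y\<close>.\<close>

lemma flip: "convex_curve M L g f"
proof
  show "continuous_on {0..M} g"
    unfolding f_image[symmetric] by (rule continuous_on_inv[OF f_cont]) (use g_f in auto)
  show "strict_antimono_on {0..M} g"
  proof (rule monotone_onI)
    fix x y assume xy: "x \<in> {0..M}" "y \<in> {0..M}" "x < y"
    show "g x > g y"
    proof (rule ccontr)
      assume "\<not> g x > g y"
      then have "f (g y) \<le> f (g x)" using g_range[of x] g_range[of y] xy by (intro f_le) auto
      then show False using f_g xy by auto
    qed
  qed
  show "convex_on {0..M} g"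
  proof (rule convex_onI)
    fix t x y :: real assume t: "0 < t" "t < 1" and xy: "x \<in> {0..M}" "y \<in> {0..M}"
    have gx: "g x \<in> {0..L}" "g y \<in> {0..L}" using g_range xy by auto
    have in1: "(1 - t) *\<^sub>R g x + t *\<^sub>R g y \<in> {0..L}"
      using t by (intro convexD_alt[OF _ gx]) auto
    have in2: "(1 - t) *\<^sub>R x + t *\<^sub>R y \<in> {0..M}"
      using t by (intro convexD_alt[OF _ xy]) auto
    have "f ((1 - t) *\<^sub>R g x + t *\<^sub>R g y) \<le> (1 - t) * f (g x) + t * f (g y)"
      using t gx by (intro convex_onD[OF f_convex]) auto
    also have "\<dots> = f (g ((1 - t) *\<^sub>R x + t *\<^sub>R y))" using f_g xy in2 by simp
    finally have le: "f ((1 - t) *\<^sub>R g x + t *\<^sub>R g y) \<le> f (g ((1 - t) *\<^sub>R x + t *\<^sub>R y))" .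
    show "g ((1 - t) *\<^sub>R x + t *\<^sub>R y) \<le> (1 - t) * g x + t * g y"
    proof (rule ccontr)
      assume "\<not> ?thesis"
      then have "f (g ((1 - t) *\<^sub>R x + t *\<^sub>R y)) < f ((1 - t) *\<^sub>R g x + t *\<^sub>R g y)"
        using in1 in2 g_range[of "(1 - t) *\<^sub>R x + t *\<^sub>R y"] by (intro f_less) auto
      then show False using le by simp
    qed
  qed simp
  show "g 0 = L" "g M = 0" using g_f[of L] g_f[of 0] L f_0 f_L by auto
qed (use L M f_g in auto)

lemma below_curve_iff:
  assumes "0 \<le> x" "0 \<le> y"
  shows "x \<le> L \<and> y \<le> f x \<longleftrightarrow> y \<le> M \<and> x \<le> g y"
proof
  assume a: "x \<le> L \<and> y \<le> f x"
  have y: "y \<le> M" using a f_range[of x] assms by auto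
  have "x \<le> g y"
  proof (rule ccontr)
    assume "\<not> x \<le> g y"
    then have "f x < f (g y)" using a g_range[of y] y assms by (intro f_less) auto
    then show False using f_g[of y] a y assms by auto
  qed
  with y show "y \<le> M \<and> x \<le> g y" by simp
next
  assume a: "y \<le> M \<and> x \<le> g y"
  then have "f (g y) \<le> f x" using assms g_range[of y] by (intro f_le) auto
  then show "x \<le> L \<and> y \<le> f x" using f_g[of y] g_range[of y] a assms by auto
qed

lemma card_lattice_points_flip:
  assumes "0 < h" "0 < h'"
  shows "card (lattice_points L f h h') = card (lattice_points M g h' h)"
proof (rule bij_betw_same_card)
  show "bij_betw prod.swap (lattice_points L f h h') (lattice_points M g h' h)"
  proof (rule bij_betw_imageI)
    have "(j, k) \<in> lattice_points L f h h' \<longleftrightarrow> (k, j) \<in> lattice_points M g h' h" for j k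
      unfolding lattice_points_def using below_curve_iff[of "real j * h" "real k * h'"] assms by simp
    note iff = this
    show "prod.swap ` lattice_points L f h h' = lattice_points M g h' h"
    proof
      show "prod.swap ` lattice_points L f h h' \<subseteq> lattice_points M g h' h" by (auto simp: iff)
      show "lattice_points M g h' h \<subseteq> prod.swap ` lattice_points L f h h'"
      proof
        fix z assume "z \<in> lattice_points M g h' h"
        then have "(snd z, fst z) \<in> lattice_points L f h h'" unfolding iff by simp
        then show "z \<in> prod.swap ` lattice_points L f h h'" by (rule image_eqI[rotated]) simp
      qed
    qed
  qed simp
qed

lemma f_cont_sub: "0 \<le> a \<Longrightarrow> b \<le> L \<Longrightarrow> continuous_on {a..b} f"
  by (rule continuous_on_subset[OF f_cont]) auto

lemma f_integrable: "0 \<le> a \<Longrightarrow> b \<le> L \<Longrightarrow> f integrable_on {a..b}"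
  by (intro integrable_continuous_real f_cont_sub)

lemma f_integral_split: "0 \<le> a \<Longrightarrow> a \<le> b \<Longrightarrow> b \<le> c \<Longrightarrow> c \<le> L \<Longrightarrow>
  integral {a..c} f = integral {a..b} f + integral {b..c} f"
  by (rule Henstock_Kurzweil_Integration.integral_combine[symmetric]) (auto intro: f_integrable)

lemma f_integral_bounds:
  assumes "0 \<le> a" "a \<le> b" "b \<le> L"
  shows "(b - a) * f b \<le> integral {a..b} f" "integral {a..b} f \<le> (b - a) * f a"
proof -
  have "integral {a..b} (\<lambda>x. f b) \<le> integral {a..b} f" "integral {a..b} f \<le> integral {a..b} (\<lambda>x. f a)"
    by (intro integral_le f_integrable f_le integrable_const_ivl; use assms in auto)+
  moreover have "integral {a..b} (\<lambda>x. u) = (b - a) * u" for u using assms by simp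
  ultimately show "(b - a) * f b \<le> integral {a..b} f" "integral {a..b} f \<le> (b - a) * f a" by (simp_all only:)
qed

lemma integral_le_trapezoid_sum:
  assumes h: "0 < h" and i: "i \<le> n" and n: "real n * h \<le> L"
  shows "integral {real i * h..real n * h} f \<le> h * ((\<Sum>j=i..n. f (real j * h)) - (f (real i * h) + f (real n * h)) / 2)"
  using i n
proof (induction n rule: dec_induct)
  case (step n)
  have nh: "real n * h \<le> real (Suc n) * h" using h by simp
  have "integral {real i * h..real (Suc n) * h} f = integral {real i * h..real n * h} f + integral {real n * h..real (Suc n) * h} f"
    using step h nh by (intro f_integral_split) (auto intro: mult_right_mono)
  moreover have "integral {real n * h..real (Suc n) * h} f \<le> (real (Suc n) * h - real n * h) * (f (real n * h) + f (real (Suc n) * h)) / 2"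
    using step h nh by (intro convex_integral_le_trapezoid[OF f_convex] f_cont_sub) auto
  moreover have "real (Suc n) * h - real n * h = h" by (simp add: algebra_simps)
  moreover have "integral {real i * h..real n * h} f \<le> h * ((\<Sum>j=i..n. f (real j * h)) - (f (real i * h) + f (real n * h)) / 2)"
    using step nh by auto
  ultimately show ?case using step by (simp add: algebra_simps) (simp add: field_simps)
qed simp

text \<open>On \<open>[n h, (n + 1) h]\<close> the curve lies above the continuation of its chord over the preceding
  cell, so each cell contributes a difference of consecutive increments and the errors telescope.\<close>

lemma trapezoid_sum_le_integral:
  assumes h: "0 < h" and i: "Suc i \<le> n" and n: "real n * h \<le> L"
  shows "h * ((\<Sum>j=i..n. f (real j * h)) - (f (real i * h) + f (real n * h)) / 2) - integral {real i * h..real n * h} f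
    \<le> h * ((f (real n * h) - f (real (n - 1) * h)) / 2 + (f (real i * h) - f (real (Suc i) * h)))"
  using i n
proof (induction n rule: dec_induct)
  case base
  have "h * f (real (Suc i) * h) \<le> integral {real i * h..real (Suc i) * h} f"
    using f_integral_bounds(1)[of "real i * h" "real (Suc i) * h"] h base by (simp add: algebra_simps)
  then show ?case by (simp add: algebra_simps) (simp add: field_simps)
next
  case (step n)
  obtain k where k: "n = Suc k" using step by (cases n) auto
  define a b c where "a = real k * h" and "b = real n * h" and "c = real (Suc n) * h"
  have abc: "b = a + h" "c = b + h" by (auto simp: a_def b_def c_def k algebra_simps)
  have bounds: "0 \<le> a" "c \<le> L" using h step by (auto simp: a_def c_def)
  have split: "integral {real i * h..c} f = integral {real i * h..b} f + integral {b..c} f"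
  proof (intro f_integral_split)
    show "real i * h \<le> b" unfolding b_def using step h by (intro mult_right_mono) auto
  qed (use h bounds abc in auto)
  define d where "d = (f b - f a) / h"
  have "f b + d * (x - b) \<le> f x" if x: "x \<in> {b..c}" for x
  proof (cases "x = b")
    case False
    have "(f a - f b) / (a - b) \<le> (f a - f x) / (a - x)" "(f a - f x) / (a - x) \<le> (f b - f x) / (b - x)"
      by (rule convex_on_slope_le[OF f_convex]; use False x h bounds abc in auto)+
    then have "(f a - f b) / (a - b) \<le> (f b - f x) / (b - x)" by simp
    moreover have "(f a - f b) / (a - b) = d" using h by (simp add: d_def abc divide_simps)
    moreover have "(f b - f x) / (b - x) = (f x - f b) / (x - b)" by (metis minus_diff_eq minus_divide_divide)
    ultimately show ?thesis using False x by (simp add: field_simps)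
  qed simp
  then have "integral {b..c} (\<lambda>x. (f b - d * b) + d * x) \<le> integral {b..c} f"
    using bounds abc h by (intro integral_le f_integrable integrable_continuous_real continuous_intros) (auto simp: algebra_simps)
  moreover have "integral {b..c} (\<lambda>x. (f b - d * b) + d * x) = (c - b) * (f b - d * b) + d * ((c\<^sup>2 - b\<^sup>2) / 2)"
    using h abc by (intro integral_unique has_integral_affine_real) auto
  moreover have "(c - b) * (f b - d * b) + d * ((c\<^sup>2 - b\<^sup>2) / 2) = h * f b + h * (d * h) / 2"
    unfolding abc by (simp add: power2_eq_square algebra_simps)
  moreover have "d * h = f b - f a" using h by (simp add: d_def)
  ultimately have cell: "h * f b + h * (f b - f a) / 2 \<le> integral {b..c} f" by (simp only:)
  have nL: "real n * h \<le> L" using bounds abc h unfolding b_def[symmetric] by linarith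
  have nk: "n - 1 = k" by (simp add: k)
  have IH: "h * ((\<Sum>j=i..n. f (real j * h)) - (f (real i * h) + f b) / 2) - integral {real i * h..b} f
    \<le> h * ((f b - f a) / 2 + (f (real i * h) - f (real (Suc i) * h)))"
    using step.IH[OF nL] unfolding a_def b_def nk .
  have sum: "(\<Sum>j=i..Suc n. f (real j * h)) = (\<Sum>j=i..n. f (real j * h)) + f c"
    using step by (simp add: c_def)
  show ?case
    unfolding sum c_def[symmetric] b_def[symmetric] diff_Suc_1 unfolding split using IH cell
    by (simp add: algebra_simps) (simp add: field_simps)
qed

end

section \<open>Counting by columns\<close>

lemma card_columns:
  fixes F :: "nat \<Rightarrow> real"
  assumes "finite J" "0 < h'" "\<And>j. j \<in> J \<Longrightarrow> 0 \<le> F j"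
  shows "finite {(j, k). j \<in> J \<and> real k * h' \<le> F j}"
    and "real (card {(j, k). j \<in> J \<and> real k * h' \<le> F j}) = (\<Sum>j\<in>J. F j / h' - saw (F j / h') + 1/2)"
proof -
  have col: "{k. real k * h' \<le> F j} = {..nat \<lfloor>F j / h'\<rfloor>}" if "j \<in> J" for j
  proof -
    have "real k * h' \<le> F j \<longleftrightarrow> k \<le> nat \<lfloor>F j / h'\<rfloor>" for k
    proof -
      have "real k * h' \<le> F j \<longleftrightarrow> of_int (int k) \<le> F j / h'" using assms by (simp add: field_simps)
      also have "\<dots> \<longleftrightarrow> int k \<le> \<lfloor>F j / h'\<rfloor>" by (simp add: le_floor_iff)
      also have "\<dots> \<longleftrightarrow> k \<le> nat \<lfloor>F j / h'\<rfloor>"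
      proof -
        have "0 \<le> \<lfloor>F j / h'\<rfloor>" using assms that by simp
        then show ?thesis by linarith
      qed
      finally show ?thesis .
    qed
    then show ?thesis by auto
  qed
  have S: "{(j, k). j \<in> J \<and> real k * h' \<le> F j} = Sigma J (\<lambda>j. {k. real k * h' \<le> F j})" by auto
  show "finite {(j, k). j \<in> J \<and> real k * h' \<le> F j}"
    unfolding S using assms(1) by (intro finite_SigmaI) (auto simp: col)
  have "card {(j, k). j \<in> J \<and> real k * h' \<le> F j} = (\<Sum>j\<in>J. card {k. real k * h' \<le> F j})"
    unfolding S using assms(1) by (intro card_SigmaI) (auto simp: col)
  then have "real (card {(j, k). j \<in> J \<and> real k * h' \<le> F j}) = (\<Sum>j\<in>J. real (card {k. real k * h' \<le> F j}))"
    by simp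
  also have "\<dots> = (\<Sum>j\<in>J. F j / h' - saw (F j / h') + 1/2)"
  proof (intro sum.cong refl)
    fix j assume j: "j \<in> J"
    have "0 \<le> \<lfloor>F j / h'\<rfloor>" using assms j by simp
    then show "real (card {k. real k * h' \<le> F j}) = F j / h' - saw (F j / h') + 1/2"
      unfolding col[OF j] floor_plus_one_eq_saw[symmetric] by simp
  qed
  finally show "real (card {(j, k). j \<in> J \<and> real k * h' \<le> F j}) = (\<Sum>j\<in>J. F j / h' - saw (F j / h') + 1/2)" .
qed

lemma multiples_atMost:
  fixes h L :: real
  assumes "0 < h" "0 \<le> L"
  shows "{j::nat. real j * h \<le> L} = {..nat \<lfloor>L / h\<rfloor>}" "real (nat \<lfloor>L / h\<rfloor>) * h \<le> L" "L < real (Suc (nat \<lfloor>L / h\<rfloor>)) * h"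
proof -
  have eq: "real j * h \<le> L \<longleftrightarrow> j \<le> nat \<lfloor>L / h\<rfloor>" for j
  proof -
    have "real j * h \<le> L \<longleftrightarrow> of_int (int j) \<le> L / h" using assms by (simp add: field_simps)
    also have "\<dots> \<longleftrightarrow> int j \<le> \<lfloor>L / h\<rfloor>" by (simp add: le_floor_iff)
    also have "\<dots> \<longleftrightarrow> j \<le> nat \<lfloor>L / h\<rfloor>"
    proof -
      have "0 \<le> \<lfloor>L / h\<rfloor>" using assms by simp
      then show ?thesis by linarith
    qed
    finally show ?thesis .
  qed
  then show "{j::nat. real j * h \<le> L} = {..nat \<lfloor>L / h\<rfloor>}" by auto
  show "real (nat \<lfloor>L / h\<rfloor>) * h \<le> L" using eq[of "nat \<lfloor>L / h\<rfloor>"] by simp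
  show "L < real (Suc (nat \<lfloor>L / h\<rfloor>)) * h" using eq[of "Suc (nat \<lfloor>L / h\<rfloor>)"] by (simp add: not_le[symmetric] del: of_nat_Suc)
qed

context convex_curve begin

lemma card_lattice_points_columns:
  assumes "0 < h" "0 < h'"
  shows "real (card (lattice_points L f h h')) = (\<Sum>j | real j * h \<le> L. f (real j * h) / h' - saw (f (real j * h) / h') + 1/2)"
proof -
  have "finite {j::nat. real j * h \<le> L}" using multiples_atMost(1)[of h L] assms L by simp
  from card_columns(2)[OF this assms(2), of "\<lambda>j. f (real j * h)"] show ?thesis
    unfolding lattice_points_def using f_range assms by simp
qed

text \<open>By convexity the trapezoidal sum is at least the integral. It gives the column at 0 only
  half its weight, and the other half is the term \<open>M / (2 * h')\<close>. Each column holds at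
  least \<open>f (real j * h) / h'\<close> points, so no sawtooth estimate enters.\<close>

lemma integral_le_card_lattice_points:
  assumes h: "0 < h" "0 < h'"
  shows "integral {0..L} f / (h * h') + M / (2 * h') \<le> card (lattice_points L f h h')"
proof -
  define n where "n = nat \<lfloor>L / h\<rfloor>"
  have n: "{j::nat. real j * h \<le> L} = {..n}" "real n * h \<le> L" "L < real (Suc n) * h"
    using multiples_atMost[of h L] h L by (simp_all add: n_def)
  define S where "S = (\<Sum>j=0..n. f (real j * h))"
  have "integral {0..L} f = integral {0..real n * h} f + integral {real n * h..L} f"
    using h n by (intro f_integral_split) auto
  moreover have "integral {real 0 * h..real n * h} f \<le> h * (S - (f (real 0 * h) + f (real n * h)) / 2)"
    unfolding S_def using h n by (intro integral_le_trapezoid_sum) auto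
  moreover have "integral {real n * h..L} f \<le> (L - real n * h) * (f (real n * h) + f L) / 2"
    using h n by (intro convex_integral_le_trapezoid[OF f_convex] f_cont_sub) auto
  moreover have "(L - real n * h) * (f (real n * h) + f L) / 2 \<le> h * f (real n * h) / 2"
    using h n f_range[of "real n * h"] unfolding f_L by (intro divide_right_mono mult_mono) (auto simp: algebra_simps)
  ultimately have "integral {0..L} f \<le> h * S - h * M / 2"
    by (simp add: f_0 algebra_simps) (simp add: field_simps)
  then have "(integral {0..L} f + h * M / 2) / (h * h') \<le> h * S / (h * h')"
    using h by (intro divide_right_mono) auto
  then have "integral {0..L} f / (h * h') + M / (2 * h') \<le> S / h'"
    using h by (simp add: add_divide_distrib)
  also have "\<dots> \<le> card (lattice_points L f h h')"
    unfolding card_lattice_points_columns[OF h] n(1) S_def sum_divide_distrib atLeast0AtMost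
  proof (intro sum_mono)
    fix j
    show "f (real j * h) / h' \<le> f (real j * h) / h' - saw (f (real j * h) / h') + 1/2"
      using abs_saw_le[of "f (real j * h) / h'"] by linarith
  qed
  finally show ?thesis .
qed

text \<open>A crude bound, correct in the leading term; it serves to compare the areas under
  \<open>f\<close> and \<open>g\<close>.\<close>

lemma card_lattice_points_le_integral:
  assumes h: "0 < h" "0 < h'"
  shows "card (lattice_points L f h h') \<le> (integral {0..L} f + 2 * h * M) / (h * h') + L / h + 1"
proof -
  define n where "n = nat \<lfloor>L / h\<rfloor>"
  have n: "{j::nat. real j * h \<le> L} = {..n}" "real n * h \<le> L" "L < real (Suc n) * h"
    using multiples_atMost[of h L] h L by (simp_all add: n_def)
  define S where "S = (\<Sum>j=0..n. f (real j * h))"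
  have split: "integral {0..L} f = integral {0..real n * h} f + integral {real n * h..L} f"
    using h n by (intro f_integral_split) auto
  have nonneg: "0 \<le> integral {0..real n * h} f" "0 \<le> integral {real n * h..L} f"
    using h n L f_range[of "real n * h"] order_trans[OF mult_nonneg_nonneg f_integral_bounds(1)[of 0 "real n * h"]]
      order_trans[OF mult_nonneg_nonneg f_integral_bounds(1)[of "real n * h" L]] by (auto simp: f_L)
  have "h * S \<le> integral {0..L} f + 2 * h * M"
  proof (cases "n = 0")
    case True
    then have "h * S = h * M" by (simp add: S_def f_0)
    also have "\<dots> \<le> 2 * h * M" using h M by simp
    finally show ?thesis using split nonneg by linarith
  next
    case False
    then have "h * (S - (f (real 0 * h) + f (real n * h)) / 2) - integral {real 0 * h..real n * h} f
        \<le> h * ((f (real n * h) - f (real (n - 1) * h)) / 2 + (f (real 0 * h) - f (real (Suc 0) * h)))"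
      unfolding S_def using h n by (intro trapezoid_sum_le_integral) auto
    also have "\<dots> \<le> h * (0 + M)"
    proof (intro mult_left_mono add_mono)
      have "real (n - 1) * h \<le> real n * h" using h by (intro mult_right_mono) auto
      then show "(f (real n * h) - f (real (n - 1) * h)) / 2 \<le> 0" using h n by (simp add: f_le)
      have "real 1 * h \<le> real n * h" using h False by (intro mult_right_mono) auto
      then have "h \<le> L" using n by simp
      then show "f (real 0 * h) - f (real (Suc 0) * h) \<le> M" using f_range[of h] h by (simp add: f_0)
    qed (use h in auto)
    finally have "h * S \<le> h * ((M + f (real n * h)) / 2) + integral {0..real n * h} f + h * M"
      by (simp add: f_0 algebra_simps)
    moreover have "h * ((M + f (real n * h)) / 2) \<le> h * M" using f_range[of "real n * h"] h n by (intro mult_left_mono) auto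
    ultimately show ?thesis using split nonneg by linarith
  qed
  then have S: "S / h' \<le> (integral {0..L} f + 2 * h * M) / (h * h')"
    using h by (simp add: field_simps)
  have "real (card (lattice_points L f h h')) \<le> (\<Sum>j=0..n. f (real j * h) / h' + 1)"
    unfolding card_lattice_points_columns[OF h] n(1) S_def atLeast0AtMost
  proof (intro sum_mono)
    fix j
    show "f (real j * h) / h' - saw (f (real j * h) / h') + 1/2 \<le> f (real j * h) / h' + 1"
      using abs_saw_le[of "f (real j * h) / h'"] by linarith
  qed
  also have "\<dots> = S / h' + (real n + 1)" by (simp add: sum.distrib S_def sum_divide_distrib)
  also have "real n \<le> L / h" using n h by (simp add: field_simps)
  finally show ?thesis using S by simp
qed

text \<open>A grid of mesh 1/N has equally many points below both curves. After division by N^2 the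
  lower bound for \<open>f\<close> and the upper bound for \<open>g\<close> differ from the areas by
  O(1/N), which excludes a strict excess.\<close>

lemma integral_le_integral_inverse: "integral {0..L} f \<le> integral {0..M} g"
proof (rule ccontr)
  assume "\<not> ?thesis"
  then have d: "integral {0..L} f - integral {0..M} g > 0" (is "?d > 0") by simp
  interpret inv: convex_curve M L g f by (rule flip)
  \<comment> \<open>For this \<open>N\<close> the excess \<open>?d * N * N\<close> outgrows all
    linear terms.\<close>
  obtain N where N: "(2 * L + M + 1) / ?d < real N" using reals_Archimedean2 by blast
  have "0 < (2 * L + M + 1) / ?d" using d L M by simp
  then have N0: "real N > 0" using N by linarith
  then have N1: "real N \<ge> 1" by simp
  have "integral {0..L} f / (1 / N * (1 / N)) + M / (2 * (1 / N)) \<le> card (lattice_points L f (1 / N) (1 / N))"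
    using N0 by (intro integral_le_card_lattice_points) auto
  also have "card (lattice_points L f (1 / N) (1 / N)) = card (lattice_points M g (1 / N) (1 / N))"
    using N0 by (intro card_lattice_points_flip) auto
  also have "real \<dots> \<le> (integral {0..M} g + 2 * (1 / N) * L) / (1 / N * (1 / N)) + M / (1 / N) + 1"
    using N0 by (intro inv.card_lattice_points_le_integral) auto
  also have "\<dots> = integral {0..M} g * N * N + 2 * L * N + M * N + 1"
    using N0 by (simp add: distrib_right)
  finally have "?d * N * N + M * N / 2 \<le> (2 * L + M) * N + 1"
    by (simp add: algebra_simps)
  moreover have "0 \<le> M * N / 2" using M N0 by simp
  moreover have "(2 * L + M) * N + 1 \<le> (2 * L + M + 1) * N" using N1 by (simp add: algebra_simps)
  ultimately have "?d * N * N \<le> (2 * L + M + 1) * N" by linarith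
  then have "?d * N \<le> 2 * L + M + 1" using N0 mult_le_cancel_right_pos[of "real N"] by blast
  then show False using N d by (simp add: field_simps)
qed

lemma integral_inverse: "integral {0..M} g = integral {0..L} f"
  using integral_le_integral_inverse convex_curve.integral_le_integral_inverse[OF flip] by linarith

text \<open>The part of the region above height \<open>f \<alpha>\<close>, moved down to the axis.
  Equality of its two area integrals yields the decomposition of the area at the point
  (\<open>\<alpha>\<close>, \<open>f \<alpha>\<close>).\<close>

lemma subcurve:
  assumes "0 < \<alpha>" "\<alpha> < L"
  shows "convex_curve \<alpha> (M - f \<alpha>) (\<lambda>x. f x - f \<alpha>) (\<lambda>y. g (y + f \<alpha>))"
proof
  show "continuous_on {0..\<alpha>} (\<lambda>x. f x - f \<alpha>)" using assms by (intro continuous_intros f_cont_sub) auto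
  show "convex_on {0..\<alpha>} (\<lambda>x. f x - f \<alpha>)"
  proof -
    have "convex_on {0..\<alpha>} f" by (rule convex_on_subset[OF f_convex]) (use assms in auto)
    then have "convex_on {0..\<alpha>} (\<lambda>x. f x + - f \<alpha>)" by (intro convex_on_add) (auto simp: convex_on_const)
    then show ?thesis by simp
  qed
  show "strict_antimono_on {0..\<alpha>} (\<lambda>x. f x - f \<alpha>)" using assms by (intro monotone_onI) (auto intro: f_less)
qed (use assms f_less[of 0 \<alpha>] g_f in \<open>auto simp: f_0\<close>)

lemma area_decomposition:
  assumes "0 < \<alpha>" "\<alpha> < L"
  shows "integral {0..L} f = integral {\<alpha>..L} f + integral {f \<alpha>..M} g + \<alpha> * f \<alpha>"
proof -
  interpret sub: convex_curve \<alpha> "M - f \<alpha>" "\<lambda>x. f x - f \<alpha>" "\<lambda>y. g (y + f \<alpha>)" by (rule subcurve[OF assms])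
  interpret inv: convex_curve M L g f by (rule flip)
  have \<beta>: "0 \<le> f \<alpha>" "f \<alpha> \<le> M" using f_range[of \<alpha>] assms by auto
  have "integral {0..M - f \<alpha>} (\<lambda>y. g (y + f \<alpha>)) = integral {f \<alpha>..M} g"
    using integral_shift[of 0 "f \<alpha>" "M - f \<alpha>" g] inv.f_cont_sub[of "f \<alpha>" M] \<beta> by (simp add: comp_def)
  moreover have "integral {0..\<alpha>} (\<lambda>x. f x - f \<alpha>) = integral {0..\<alpha>} f - \<alpha> * f \<alpha>"
    using assms by (subst Henstock_Kurzweil_Integration.integral_diff) (auto intro: f_integrable)
  moreover have "integral {0..L} f = integral {0..\<alpha>} f + integral {\<alpha>..L} f"
    using assms by (intro f_integral_split) auto
  ultimately show ?thesis using sub.integral_inverse by linarith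
qed

end

section \<open>The count in terms of the two arcs\<close>

context convex_curve begin

text \<open>The first column \<open>xi\<close> lies beyond \<open>\<alpha>\<close> by
  \<open>h * (1/2 - saw (\<alpha> / h))\<close>. The strip from \<open>\<alpha>\<close> to
  \<open>xi\<close>, set against the half weight of the first column, leaves the boundary term with
  \<open>saw (\<alpha> / h)\<close>; at \<open>L\<close> the curve vanishes and leaves none.\<close>

lemma arc_sum_approx:
  assumes h: "0 < h" and \<alpha>: "0 \<le> \<alpha>" "\<alpha> + h \<le> L"
    and Q: "\<And>x y. \<alpha> \<le> x \<Longrightarrow> x \<le> y \<Longrightarrow> y \<le> L \<Longrightarrow> f x - f y \<le> Q * (y - x)"
  shows "\<bar>h * (\<Sum>j | \<alpha> < real j * h \<and> real j * h \<le> L. f (real j * h)) - integral {\<alpha>..L} f - h * saw (\<alpha> / h) * f \<alpha>\<bar> \<le> 4 * Q * h\<^sup>2"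
proof -
  define i n where "i = nat \<lfloor>\<alpha> / h\<rfloor> + 1" and "n = nat \<lfloor>L / h\<rfloor>"
  define xi xn where "xi = real i * h" and "xn = real n * h"
  define S where "S = (\<Sum>j=i..n. f (real j * h))"
  define sw where "sw = saw (\<alpha> / h)"
  have xn: "xn \<le> L" "L < xn + h"
    using multiples_atMost[of h L] h L by (simp_all add: n_def xn_def algebra_simps)
  have "0 \<le> \<lfloor>\<alpha> / h\<rfloor>" using h \<alpha> by simp
  then have "real i = \<alpha> / h - saw (\<alpha> / h) + 1/2"
    unfolding i_def floor_plus_one_eq_saw[symmetric] by simp
  then have "real i = \<alpha> / h + (1/2 - sw)" by (simp add: sw_def)
  then have "xi = (\<alpha> / h) * h + h * (1/2 - sw)"
    unfolding xi_def by (simp only: distrib_right mult.commute[of h])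
  then have xi: "xi - \<alpha> = h * (1/2 - sw)" using h by simp
  have sw: "-1/2 \<le> sw" "sw < 1/2" using frac_ge_0[of "\<alpha> / h"] frac_lt_1[of "\<alpha> / h"] by (simp_all add: sw_def saw_def)
  have xi_le: "xi \<le> \<alpha> + h"
  proof -
    have "h * (1/2 - sw) \<le> h * 1" using sw h by (intro mult_left_mono) auto
    then show ?thesis using xi by simp
  qed
  have xi_ge: "\<alpha> < xi" 
  proof -
    have "0 < h * (1/2 - sw)" using sw h by (intro mult_pos_pos) auto
    then show ?thesis using xi by simp
  qed
  have "real i * h < (real n + 1) * h" using xi_le \<alpha> xn unfolding xi_def xn_def by (simp add: algebra_simps)
  then have "real i < real n + 1" using h by simp
  then have i_n: "i \<le> n" by linarith
  then have xi_xn: "xi \<le> xn" using h unfolding xi_def xn_def by (intro mult_right_mono) auto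
  have "\<alpha> \<le> L" using \<alpha> h by simp
  have set: "{j::nat. \<alpha> < real j * h \<and> real j * h \<le> L} = {i..n}"
    unfolding columns_eq_interval[OF h \<alpha>(1) \<open>\<alpha> \<le> L\<close>] i_def n_def by auto
  have "0 \<le> f \<alpha> - f L" using f_range[of \<alpha>] \<alpha> h by (simp add: f_L)
  also have "\<dots> \<le> Q * (L - \<alpha>)" using \<alpha> h by (intro Q) auto
  finally have Q0: "0 \<le> Q" using \<alpha> h by (simp add: zero_le_mult_iff)
  have Qb: "f x - f y \<le> Q * h \<and> 0 \<le> f x - f y" if "\<alpha> \<le> x" "x \<le> y" "y \<le> L" "y \<le> x + h" for x y
  proof -
    have "f x - f y \<le> Q * (y - x)" using that by (intro Q)
    also have "\<dots> \<le> Q * h" using that Q0 by (intro mult_left_mono) auto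
    finally show ?thesis using f_le[of x y] that \<alpha> by simp
  qed
  define I1 I2 I3 where "I1 = integral {\<alpha>..xi} f" and "I2 = integral {xi..xn} f" and "I3 = integral {xn..L} f"
  have I: "integral {\<alpha>..L} f = I1 + I2 + I3"
    using f_integral_split[of \<alpha> xi L] f_integral_split[of xi xn L] xi_ge xi_xn xn \<alpha> by (simp add: I1_def I2_def I3_def)
  have 1: "(xi - \<alpha>) * f xi \<le> I1" "I1 \<le> (xi - \<alpha>) * f \<alpha>"
    unfolding I1_def using f_integral_bounds[of \<alpha> xi] \<alpha> xi_ge xi_xn xn by auto
  have "(xi - \<alpha>) * (f \<alpha> - f xi) \<le> h * (Q * h)"
    using xi_le xi_ge Qb[of \<alpha> xi] xi_xn xn h by (intro mult_mono) auto
  then have e1: "0 \<le> (xi - \<alpha>) * f \<alpha> - I1" "(xi - \<alpha>) * f \<alpha> - I1 \<le> h * (Q * h)"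
    using 1 by (auto simp: algebra_simps)
  have "I3 \<le> (L - xn) * f xn" "(L - xn) * f L \<le> I3"
    unfolding I3_def using f_integral_bounds[of xn L] \<alpha> xi_ge xi_xn xn by auto
  moreover have "(L - xn) * f xn \<le> h * (Q * h)"
    using Qb[of xn L] xi_xn xn h xi_ge by (intro mult_mono) (auto simp: f_L)
  ultimately have e3: "0 \<le> I3" "I3 \<le> h * (Q * h)" by (auto simp: f_L)
  define E where "E = h * (S - (f xi + f xn) / 2) - I2"
  have E0: "0 \<le> E" unfolding E_def I2_def S_def xi_def xn_def
    using integral_le_trapezoid_sum[OF h i_n] xn by (simp add: xn_def)
  have E1: "E \<le> h * (Q * h)"
  proof (cases "i = n")
    case True
    then have "xi = xn" "S = f xi" by (simp_all add: xi_def xn_def S_def)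
    then have "E = 0" by (simp add: E_def I2_def)
    then show ?thesis using Q0 h by simp
  next
    case False
    have "E \<le> h * ((f (real n * h) - f (real (n - 1) * h)) / 2 + (f (real i * h) - f (real (Suc i) * h)))"
      unfolding E_def I2_def S_def xi_def xn_def
      using False i_n xn by (intro trapezoid_sum_le_integral h) (auto simp: xn_def)
    also have "\<dots> \<le> h * (0 + Q * h)"
    proof (intro mult_left_mono add_mono)
      have "real (n - 1) * h \<le> real n * h" using h by (intro mult_right_mono) auto
      then show "(f (real n * h) - f (real (n - 1) * h)) / 2 \<le> 0" using h xn by (simp add: f_le xn_def)
      have "real (Suc i) * h \<le> real n * h" using h False i_n by (intro mult_right_mono) auto
      then show "f (real i * h) - f (real (Suc i) * h) \<le> Q * h"
        using Qb[of "real i * h" "real (Suc i) * h"] xi_ge xn h by (simp add: xi_def xn_def algebra_simps)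
    qed (use h in auto)
    finally show ?thesis by simp
  qed
  have "h * (f \<alpha> - f xi) \<le> h * (Q * h)" "0 \<le> h * (f \<alpha> - f xi)"
    using Qb[of \<alpha> xi] xi_ge xi_le xi_xn xn h by (auto intro: mult_left_mono)
  moreover have "h * f xn \<le> h * (Q * h)" "0 \<le> h * f xn"
    using Qb[of xn L] xi_xn xn h xi_ge by (auto simp: f_L intro: mult_left_mono)
  \<comment> \<open>The five error terms are at most 1, 1/2, 1/2, 1 and 1 times
    \<open>Q * h\<^sup>2\<close> in modulus, which gives the constant 4.\<close>
  moreover have "h * S - (I1 + I2 + I3) - h * sw * f \<alpha> 
      = E - h * (f \<alpha> - f xi) / 2 + h * f xn / 2 + ((xi - \<alpha>) * f \<alpha> - I1) - I3"
    unfolding E_def xi by (simp add: field_simps)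
  ultimately have "\<bar>h * S - (I1 + I2 + I3) - h * sw * f \<alpha>\<bar> \<le> 4 * (h * (Q * h))"
    using E0 E1 e1 e3 unfolding abs_le_iff by linarith
  then show ?thesis unfolding set I S_def[symmetric] sw_def by (simp add: power2_eq_square mult_ac)
qed

lemma card_lattice_points_split:
  assumes h: "0 < h" "0 < h'" and \<alpha>: "0 < \<alpha>" "\<alpha> < L"
  shows "real (card (lattice_points L f h h'))
    = (\<Sum>j | \<alpha> < real j * h \<and> real j * h \<le> L. f (real j * h) / h' - saw (f (real j * h) / h') + 1/2)
    + (\<Sum>k | f \<alpha> < real k * h' \<and> real k * h' \<le> M. g (real k * h') / h - saw (g (real k * h') / h) + 1/2)
    + (\<alpha> / h - saw (\<alpha> / h) + 1/2) * (f \<alpha> / h' - saw (f \<alpha> / h') + 1/2)"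
proof -
  interpret inv: convex_curve M L g f by (rule flip)
  define \<beta> where "\<beta> = f \<alpha>"
  have \<beta>: "0 \<le> \<beta>" "\<beta> \<le> M" using f_range[of \<alpha>] \<alpha> by (auto simp: \<beta>_def)
  define J K where "J = {j::nat. \<alpha> < real j * h \<and> real j * h \<le> L}" and "K = {k::nat. \<beta> < real k * h' \<and> real k * h' \<le> M}"
  have fin: "finite J" "finite K"
    unfolding J_def K_def using h \<alpha> \<beta> by (simp_all add: columns_eq_interval)
  define A1 where "A1 = {(j, k). j \<in> J \<and> real k * h' \<le> f (real j * h)}"
  define B2 where "B2 = {(k, j). k \<in> K \<and> real j * h \<le> g (real k * h')}"
  define A3 where "A3 = {j::nat. real j * h \<le> \<alpha>} \<times> {k::nat. real k * h' \<le> \<beta>}"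
  have 1: "finite A1" "real (card A1) = (\<Sum>j\<in>J. f (real j * h) / h' - saw (f (real j * h) / h') + 1/2)"
    unfolding A1_def using card_columns[of J h' "\<lambda>j. f (real j * h)"] fin h f_range \<alpha> by (auto simp: J_def)
  have 2: "finite B2" "real (card B2) = (\<Sum>k\<in>K. g (real k * h') / h - saw (g (real k * h') / h) + 1/2)"
    unfolding B2_def using card_columns[of K h "\<lambda>k. g (real k * h')"] fin h g_range by (auto simp: K_def)
  have 3: "finite A3" "real (card A3) = (\<alpha> / h - saw (\<alpha> / h) + 1/2) * (\<beta> / h' - saw (\<beta> / h') + 1/2)"
  proof -
    have "0 \<le> \<lfloor>\<alpha> / h\<rfloor>" "0 \<le> \<lfloor>\<beta> / h'\<rfloor>" using h \<alpha> \<beta> by auto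
    then show "finite A3" "real (card A3) = (\<alpha> / h - saw (\<alpha> / h) + 1/2) * (\<beta> / h' - saw (\<beta> / h') + 1/2)"
      unfolding A3_def floor_plus_one_eq_saw[symmetric] using h \<alpha> \<beta>
      by (simp_all add: multiples_atMost(1) card_cartesian_product) (simp_all add: algebra_simps)
  qed
  have g\<beta>: "g \<beta> = \<alpha>" using g_f[of \<alpha>] \<alpha> by (simp add: \<beta>_def)
  \<comment> \<open>Strict monotonicity makes the three regions disjoint: columns beyond
    \<open>\<alpha>\<close> hold only points below height \<open>\<beta>\<close>, and rows above
    \<open>\<beta>\<close> only points to the left of \<open>\<alpha>\<close>.\<close>
  have left: "f (real j * h) < \<beta>" if "j \<in> J" for j
    using that \<alpha> unfolding J_def \<beta>_def by (intro f_less) auto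
  have right: "g (real k * h') < \<alpha>" if "k \<in> K" for k
    using that \<beta> inv.f_less[of \<beta> "real k * h'"] unfolding K_def g\<beta> by auto
  have "lattice_points L f h h' = A1 \<union> (prod.swap ` B2 \<union> A3)"
  proof (intro set_eqI)
    fix z :: "nat \<times> nat"
    obtain j k where z: "z = (j, k)" by (cases z)
    have sw: "(j, k) \<in> prod.swap ` B2 \<longleftrightarrow> (k, j) \<in> B2" by force
    have c: "real j * h \<le> L \<and> real k * h' \<le> f (real j * h) \<longleftrightarrow> real k * h' \<le> M \<and> real j * h \<le> g (real k * h')"
      using h by (intro below_curve_iff) auto
    have inner: "real k * h' \<le> f (real j * h)" if "real j * h \<le> \<alpha>" "real k * h' \<le> \<beta>"
      using that f_le[of "real j * h" \<alpha>] h \<alpha> unfolding \<beta>_def by auto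
    show "z \<in> lattice_points L f h h' \<longleftrightarrow> z \<in> A1 \<union> (prod.swap ` B2 \<union> A3)"
      unfolding z Un_iff sw lattice_points_def A1_def B2_def A3_def J_def K_def
      using c inner \<alpha> by (auto simp: not_less)
  qed
  moreover have "A1 \<inter> (prod.swap ` B2 \<union> A3) = {}"
    using left by (force simp: A1_def B2_def A3_def J_def K_def)
  moreover have "prod.swap ` B2 \<inter> A3 = {}"
    using right by (force simp: B2_def A3_def K_def)
  moreover have "card (prod.swap ` B2) = card B2" by (intro card_image) simp
  ultimately have "card (lattice_points L f h h') = card A1 + (card B2 + card A3)"
    using 1(1) 2(1) 3(1) by (simp add: card_Un_disjoint)
  then have "real (card (lattice_points L f h h')) = real (card A1) + real (card B2) + real (card A3)" by simp
  then show ?thesis unfolding 1 2 3 J_def K_def \<beta>_def .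
qed

text \<open>
  The boundary term \<open>saw (\<alpha> / h) * f \<alpha> / h'\<close> of the column sum and its analogue for the rows cancel
  against the mixed terms in the number of points of the rectangle \<open>[0, \<alpha>] \<times> [0, f \<alpha>]\<close>.
\<close>

lemma card_lattice_points_approx:
  assumes h: "0 < h" "0 < h'" and \<alpha>: "0 < \<alpha>" "\<alpha> + h \<le> L" "f \<alpha> + h' \<le> M"
    and Q: "\<And>x y. \<alpha> \<le> x \<Longrightarrow> x \<le> y \<Longrightarrow> y \<le> L \<Longrightarrow> f x - f y \<le> Q * (y - x)"
    and P: "\<And>x y. f \<alpha> \<le> x \<Longrightarrow> x \<le> y \<Longrightarrow> y \<le> M \<Longrightarrow> g x - g y \<le> P * (y - x)"
  shows "\<bar>real (card (lattice_points L f h h')) - (integral {0..L} f / (h * h') + L / (2 * h) + M / (2 * h'))\<bar>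
    \<le> \<bar>\<Sum>j | \<alpha> < real j * h \<and> real j * h \<le> L. saw (f (real j * h) / h')\<bar>
      + \<bar>\<Sum>k | f \<alpha> < real k * h' \<and> real k * h' \<le> M. saw (g (real k * h') / h)\<bar>
      + 4 * Q * (h / h') + 4 * P * (h' / h) + 2"
proof -
  interpret inv: convex_curve M L g f by (rule flip)
  define \<beta> where "\<beta> = f \<alpha>"
  have \<alpha>L: "\<alpha> < L" using \<alpha> h by simp
  have \<beta>: "0 \<le> \<beta>" "\<beta> + h' \<le> M" using f_range[of \<alpha>] \<alpha> h by (auto simp: \<beta>_def)
  have g\<beta>: "g \<beta> = \<alpha>" using g_f[of \<alpha>] \<alpha> \<alpha>L by (simp add: \<beta>_def)
  define J K where "J = {j::nat. \<alpha> < real j * h \<and> real j * h \<le> L}" and "K = {k::nat. \<beta> < real k * h' \<and> real k * h' \<le> M}"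
  define a b sa sb where "a = \<alpha> / h" and "b = \<beta> / h'" and "sa = saw a" and "sb = saw b"
  define F G where "F = (\<Sum>j\<in>J. f (real j * h))" and "G = (\<Sum>k\<in>K. g (real k * h'))"
  define S T where "S = (\<Sum>j\<in>J. saw (f (real j * h) / h'))" and "T = (\<Sum>k\<in>K. saw (g (real k * h') / h))"
  define I1 I2 where "I1 = integral {\<alpha>..L} f" and "I2 = integral {\<beta>..M} g"
  define e1 e2 where "e1 = F / h' - I1 / (h * h') - sa * b" and "e2 = G / h - I2 / (h * h') - sb * a"
  have "\<bar>h * F - I1 - h * sa * \<beta>\<bar> \<le> 4 * Q * h\<^sup>2"
    unfolding F_def J_def I1_def sa_def a_def \<beta>_def using h \<alpha> by (intro arc_sum_approx Q) auto
  then have "\<bar>h * F - I1 - h * sa * \<beta>\<bar> / (h * h') \<le> 4 * Q * h\<^sup>2 / (h * h')"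
    using h by (intro divide_right_mono) auto
  moreover have "\<bar>h * F - I1 - h * sa * \<beta>\<bar> / (h * h') = \<bar>(h * F - I1 - h * sa * \<beta>) / (h * h')\<bar>"
    using h by (simp add: abs_mult)
  moreover have "(h * F - I1 - h * sa * \<beta>) / (h * h') = e1"
    using h by (simp add: e1_def b_def diff_divide_distrib)
  moreover have "4 * Q * h\<^sup>2 / (h * h') = 4 * Q * (h / h')" using h by (simp add: power2_eq_square)
  ultimately have e1: "\<bar>e1\<bar> \<le> 4 * Q * (h / h')" by simp
  have "\<bar>h' * G - I2 - h' * sb * g \<beta>\<bar> \<le> 4 * P * h'\<^sup>2"
    unfolding G_def K_def I2_def sb_def b_def using h \<beta> P by (intro inv.arc_sum_approx) (auto simp: \<beta>_def)
  then have "\<bar>h' * G - I2 - h' * sb * \<alpha>\<bar> / (h * h') \<le> 4 * P * h'\<^sup>2 / (h * h')"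
    unfolding g\<beta> using h by (intro divide_right_mono) auto
  moreover have "\<bar>h' * G - I2 - h' * sb * \<alpha>\<bar> / (h * h') = \<bar>(h' * G - I2 - h' * sb * \<alpha>) / (h * h')\<bar>"
    using h by (simp add: abs_mult)
  moreover have "(h' * G - I2 - h' * sb * \<alpha>) / (h * h') = e2"
    using h by (simp add: e2_def a_def diff_divide_distrib)
  moreover have "4 * P * h'\<^sup>2 / (h * h') = 4 * P * (h' / h)" using h by (simp add: power2_eq_square)
  ultimately have e2: "\<bar>e2\<bar> \<le> 4 * P * (h' / h)" by simp
  define nJ nK where "nJ = real (card J)" and "nK = real (card K)"
  have nJ: "\<bar>nJ - (L - \<alpha>) / h\<bar> \<le> 1" unfolding nJ_def J_def using h \<alpha> \<alpha>L by (intro card_columns_approx) auto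
  have nK: "\<bar>nK - (M - \<beta>) / h'\<bar> \<le> 1" unfolding nK_def K_def using h \<beta> by (intro card_columns_approx) auto
  have "real (card (lattice_points L f h h')) = (\<Sum>j\<in>J. f (real j * h) / h' - saw (f (real j * h) / h') + 1/2)
    + (\<Sum>k\<in>K. g (real k * h') / h - saw (g (real k * h') / h) + 1/2) + (a - sa + 1/2) * (b - sb + 1/2)"
    unfolding J_def K_def a_def b_def sa_def sb_def \<beta>_def by (rule card_lattice_points_split[OF h \<alpha>(1) \<alpha>L])
  also have "(\<Sum>j\<in>J. f (real j * h) / h' - saw (f (real j * h) / h') + 1/2) = F / h' - S + nJ / 2"
    by (simp add: F_def S_def nJ_def sum.distrib sum_subtractf sum_divide_distrib)
  also have "(\<Sum>k\<in>K. g (real k * h') / h - saw (g (real k * h') / h) + 1/2) = G / h - T + nK / 2"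
    by (simp add: G_def T_def nK_def sum.distrib sum_subtractf sum_divide_distrib)
  finally have card: "real (card (lattice_points L f h h')) = (F / h' - S + nJ / 2) + (G / h - T + nK / 2) + (a - sa + 1/2) * (b - sb + 1/2)" .
  have "integral {0..L} f = I1 + I2 + \<alpha> * \<beta>"
    unfolding I1_def I2_def \<beta>_def by (rule area_decomposition[OF \<alpha>(1) \<alpha>L])
  then have area: "integral {0..L} f / (h * h') = I1 / (h * h') + I2 / (h * h') + a * b"
    by (simp add: a_def b_def add_divide_distrib)
  have La: "L / (2 * h) = ((L - \<alpha>) / h + a) / 2" and Mb: "M / (2 * h') = ((M - \<beta>) / h' + b) / 2"
    using h by (simp_all add: a_def b_def field_simps)
  have prod: "(a - sa + 1/2) * (b - sb + 1/2) = a * b + a / 2 + b / 2 - sa * b - sb * a + (1/2 - sa) * (1/2 - sb)"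
    by (simp add: algebra_simps)
  have "0 \<le> 1/2 - sa" "1/2 - sa \<le> 1" "0 \<le> 1/2 - sb" "1/2 - sb \<le> 1"
    using abs_saw_le[of a] abs_saw_le[of b] unfolding sa_def sb_def by linarith+
  then have "0 \<le> (1/2 - sa) * (1/2 - sb)" "(1/2 - sa) * (1/2 - sb) \<le> 1 * 1"
    by (intro mult_nonneg_nonneg mult_mono; simp)+
  then have r: "0 \<le> (1/2 - sa) * (1/2 - sb)" "(1/2 - sa) * (1/2 - sb) \<le> 1" by auto
  define dJ dK u where "dJ = nJ - (L - \<alpha>) / h" and "dK = nK - (M - \<beta>) / h'" and "u = (1/2 - sa) * (1/2 - sb)"
  have "real (card (lattice_points L f h h')) - (integral {0..L} f / (h * h') + L / (2 * h) + M / (2 * h'))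
      = e1 + e2 - S - T + dJ / 2 + dK / 2 + u"
    unfolding card area La Mb prod e1_def e2_def dJ_def dK_def u_def by (simp add: field_simps)
  then have "\<bar>real (card (lattice_points L f h h')) - (integral {0..L} f / (h * h') + L / (2 * h) + M / (2 * h'))\<bar>
    \<le> \<bar>S\<bar> + \<bar>T\<bar> + \<bar>e1\<bar> + \<bar>e2\<bar> + 2"
    using nJ nK r unfolding dJ_def[symmetric] dK_def[symmetric] u_def[symmetric] by linarith
  then show ?thesis using e1 e2 unfolding S_def T_def J_def K_def \<beta>_def by linarith
qed

end

section \<open>Optimal stretch factors\<close>

text \<open>The mean value argument needs derivatives only inside the interval, so the bound reaches
  the endpoint \<open>L\<close>, where only continuity is given.\<close>

lemma C2_lipschitz:
  assumes C2: "has_C2_derivs_on f f' f'' {\<alpha>..<L}" and neg: "\<forall>x\<in>{\<alpha>..<L}. f' x < 0 \<and> f'' x > 0"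
    and cont: "continuous_on {\<alpha>..L} f" and xy: "\<alpha> \<le> x" "x \<le> y" "y \<le> L"
  shows "f x - f y \<le> (- f' \<alpha>) * (y - x)"
proof -
  have "f x - f' \<alpha> * x \<le> f y - f' \<alpha> * y"
  proof (rule DERIV_nonneg_imp_increasing_open[where f = "\<lambda>x. f x - f' \<alpha> * x"])
    show "continuous_on {x..y} (\<lambda>x. f x - f' \<alpha> * x)"
      using xy by (intro continuous_intros continuous_on_subset[OF cont]) auto
    fix z assume z: "x < z" "z < y"
    then have z': "\<alpha> < z" "z < L" using xy by auto
    have "((\<lambda>x. f x - f' \<alpha> * x) has_real_derivative f' z - f' \<alpha>) (at z)"
      using has_C2_derivs_on_interior(1)[OF C2 z'] by (auto intro!: derivative_eq_intros)
    moreover have "0 \<le> f' z - f' \<alpha>" using convex_C2_derivative_bound[OF C2 neg z'] by simp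
    ultimately show "\<exists>d. ((\<lambda>x. f x - f' \<alpha> * x) has_real_derivative d) (at z) \<and> 0 \<le> d" by blast
  qed (use xy in auto)
  then show ?thesis by (simp add: algebra_simps)
qed

lemma lattice_count_asymp:
  fixes L M \<alpha> \<beta> a1 a2 b1 b2 e :: real
    and f f' f'' g g' g'' \<delta> \<epsilon> :: "real \<Rightarrow> real"
    and p q :: "nat \<Rightarrow> real" and m n :: nat
  assumes curve: "convex_curve L M f g"
    and \<alpha>: "0 < \<alpha>" "\<alpha> < L" and \<beta>: "0 < \<beta>" "\<beta> < M" and f\<alpha>: "f \<alpha> = \<beta>"
    and f: "has_C2_derivs_on f f' f'' {\<alpha>..<L}" "\<forall>x\<in>{\<alpha>..<L}. f' x < 0 \<and> f'' x > 0"
    and g: "has_C2_derivs_on g g' g'' {\<beta>..<M}" "\<forall>y\<in>{\<beta>..<M}. g' y < 0 \<and> g'' y > 0"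
    and p: "p 0 = \<alpha>" "p m = L" "piecewise_monotonic f'' p m"
    and q: "q 0 = \<beta>" "q n = M" "piecewise_monotonic g'' q n"
    and \<delta>: "\<forall>r>0. 0 < \<delta> r" and \<epsilon>: "\<forall>r>0. 0 < \<epsilon> r"
    and pos: "a1 > 0" "b1 > 0"
    and O: "\<delta> \<in> O[at_top](\<lambda>r. r powr (- 2 * a1))"
      "(\<lambda>r. 1 / f'' (L - \<delta> r)) \<in> O[at_top](\<lambda>r. r powr (1 - 4 * a2))"
      "\<epsilon> \<in> O[at_top](\<lambda>r. r powr (- 2 * b1))"
      "(\<lambda>r. 1 / g'' (M - \<epsilon> r)) \<in> O[at_top](\<lambda>r. r powr (1 - 4 * b2))"
    and e: "e \<le> 1/6" "e \<le> a1" "e \<le> a2" "e \<le> b1" "e \<le> b2"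
  shows "\<exists>C. \<forall>\<^sub>F r in at_top. \<forall>s\<in>{1/3..3}.
    \<bar>real (lattice_count L f r s) - (r\<^sup>2 * integral {0..L} f + r * (L / s + M * s) / 2)\<bar> \<le> C * r powr (1 - 2 * e)"
proof -
  interpret convex_curve L M f g by (rule curve)
  interpret inv: convex_curve M L g f by (rule flip)
  define Q P where "Q = - f' \<alpha>" and "P = - g' \<beta>"
  have "f' \<alpha> < 0" "g' \<beta> < 0" using f(2) g(2) \<alpha> \<beta> by auto
  then have QP: "0 \<le> Q" "0 \<le> P" by (simp_all add: Q_def P_def)
  have Q: "f x - f y \<le> Q * (y - x)" if "\<alpha> \<le> x" "x \<le> y" "y \<le> L" for x y
    unfolding Q_def using C2_lipschitz[OF f f_cont_sub that] \<alpha> by simp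
  have P: "g x - g y \<le> P * (y - x)" if "f \<alpha> \<le> x" "x \<le> y" "y \<le> M" for x y
    unfolding P_def using C2_lipschitz[OF g inv.f_cont_sub] that \<beta> f\<alpha> by simp
  let ?S = "\<lambda>r s. \<Sum>j | \<alpha> < real j * (s / r) \<and> real j * (s / r) \<le> L. saw (r * s * f (real j * (s / r)))"
  let ?T = "\<lambda>r s. \<Sum>j | \<beta> < real j * (s / r) \<and> real j * (s / r) \<le> M. saw (r * s * g (real j * (s / r)))"
  obtain C1 where C1: "\<forall>\<^sub>F r in at_top. \<forall>s\<in>{1/3..3}. \<bar>?S r s\<bar> \<le> C1 * r powr (1 - 2 * e)"
    using sum_saw_curve_asymp[OF \<alpha> f p \<delta> pos(1) O(1,2) e(1,2,3)] by blast
  obtain C2 where C2: "\<forall>\<^sub>F r in at_top. \<forall>s\<in>{1/3..3}. \<bar>?T r s\<bar> \<le> C2 * r powr (1 - 2 * e)"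
    using sum_saw_curve_asymp[OF \<beta> g q \<epsilon> pos(2) O(3,4) e(1,4,5)] by blast
  define C where "C = C1 + C2 + 36 * Q + 36 * P + 2"
  \<comment> \<open>For such \<open>r\<close> a whole grid step fits between \<open>\<alpha>\<close>
    and \<open>L\<close> and between \<open>\<beta>\<close> and \<open>M\<close>, since
    \<open>s\<close> and \<open>1 / s\<close> are at most 3.\<close>
  have "\<forall>\<^sub>F r in at_top. r \<ge> 1 \<and> r \<ge> 3 / (L - \<alpha>) \<and> r \<ge> 3 / (M - \<beta>)"
    by (intro eventually_conj eventually_ge_at_top)
  with C1 C2 have "\<forall>\<^sub>F r in at_top. \<forall>s\<in>{1/3..3}.
    \<bar>real (lattice_count L f r s) - (r\<^sup>2 * integral {0..L} f + r * (L / s + M * s) / 2)\<bar> \<le> C * r powr (1 - 2 * e)"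
  proof eventually_elim
    case (elim r)
    have r: "r \<ge> 1" "3 / r \<le> L - \<alpha>" "3 / r \<le> M - \<beta>" using elim \<alpha> \<beta> by (auto simp: field_simps)
    show ?case
    proof
      fix s :: real assume s: "s \<in> {1/3..3}"
      then have s0: "s > 0" "1/3 \<le> s" "s \<le> 3" by auto
      \<comment> \<open>Rows are sampled at steps \<open>(1 / s) / r\<close> and scaled by
        \<open>r * (1 / s)\<close>, so the arc of \<open>g\<close> is the same problem with
        \<open>1 / s\<close> in place of \<open>s\<close>.\<close>
      have s': "1 / s \<in> {1/3..3}" using s0 by (simp add: field_simps)
      define h h' where "h = s / r" and "h' = 1 / (r * s)"
      have h: "0 < h" "0 < h'" using s0 r by (auto simp: h_def h'_def)
      have "h \<le> 3 / r" unfolding h_def using s0 r by (intro divide_right_mono) auto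
      moreover have "h' \<le> 3 / r"
      proof -
        have "h' = (1 / s) / r" by (simp add: h'_def mult.commute)
        also have "\<dots> \<le> 3 / r" using s' r by (intro divide_right_mono) auto
        finally show ?thesis .
      qed
      ultimately have hb: "\<alpha> + h \<le> L" "f \<alpha> + h' \<le> M" using r f\<alpha> by auto
      have "(\<Sum>j | \<alpha> < real j * h \<and> real j * h \<le> L. saw (f (real j * h) / h')) = ?S r s"
        by (simp add: h_def h'_def mult_ac)
      moreover have "(\<Sum>k | f \<alpha> < real k * h' \<and> real k * h' \<le> M. saw (g (real k * h') / h)) = ?T r (1 / s)"
        by (simp add: h_def h'_def f\<alpha> mult_ac)
      moreover have "h / h' = s * s" "h' / h = (1 / s) * (1 / s)"
        using s0 r by (simp_all add: h_def h'_def field_simps)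
      moreover have "integral {0..L} f / (h * h') + L / (2 * h) + M / (2 * h') = r\<^sup>2 * integral {0..L} f + r * (L / s + M * s) / 2"
        using s0 r by (simp add: h_def h'_def power2_eq_square field_simps)
      moreover have "lattice_count L f r s = card (lattice_points L f h h')"
        unfolding h_def h'_def using s0 r by (intro lattice_count_eq_card) auto
      ultimately have "\<bar>real (lattice_count L f r s) - (r\<^sup>2 * integral {0..L} f + r * (L / s + M * s) / 2)\<bar>
        \<le> \<bar>?S r s\<bar> + \<bar>?T r (1 / s)\<bar> + 4 * Q * (s * s) + 4 * P * ((1 / s) * (1 / s)) + 2"
        using card_lattice_points_approx[OF h \<alpha>(1) hb Q P] by simp
      moreover have "\<bar>?S r s\<bar> \<le> C1 * r powr (1 - 2 * e)" using elim s by blast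
      moreover have "\<bar>?T r (1 / s)\<bar> \<le> C2 * r powr (1 - 2 * e)" using elim s' by blast
      moreover have "4 * Q * (s * s) \<le> 4 * Q * (3 * 3)" using s0 QP by (intro mult_left_mono mult_mono) auto
      moreover have "4 * P * ((1 / s) * (1 / s)) \<le> 4 * P * (3 * 3)" using s' s0 QP by (intro mult_left_mono mult_mono) auto
      moreover have "1 \<le> r powr (1 - 2 * e)" using r e by (intro ge_one_powr_ge_zero) auto
      then have "(36 * Q + 36 * P + 2) * 1 \<le> (36 * Q + 36 * P + 2) * r powr (1 - 2 * e)"
        using QP by (intro mult_left_mono) auto
      ultimately show "\<bar>real (lattice_count L f r s) - (r\<^sup>2 * integral {0..L} f + r * (L / s + M * s) / 2)\<bar> \<le> C * r powr (1 - 2 * e)"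
        unfolding C_def distrib_right by linarith
    qed
  qed
  then show ?thesis by blast
qed

text \<open>The same lower bound read by columns, where the boundary term grows with
  \<open>s\<close>, and by rows through the inverse curve, where it grows with
  \<open>1 / s\<close>.\<close>

lemma lattice_count_lower_bounds:
  assumes curve: "convex_curve L M f g" and r: "0 < r" and s: "0 < s"
  shows "r\<^sup>2 * integral {0..L} f + r * M * s / 2 \<le> lattice_count L f r s"
    and "r\<^sup>2 * integral {0..L} f + r * L / (2 * s) \<le> lattice_count L f r s"
proof -
  interpret convex_curve L M f g by (rule curve)
  interpret inv: convex_curve M L g f by (rule flip)
  define h h' where "h = s / r" and "h' = 1 / (r * s)"
  have h: "0 < h" "0 < h'" using s r by (auto simp: h_def h'_def)
  have c: "lattice_count L f r s = card (lattice_points L f h h')"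
    unfolding h_def h'_def using s r by (intro lattice_count_eq_card) auto
  have I: "I / (h * h') = r\<^sup>2 * I" "I / (h' * h) = r\<^sup>2 * I" for I
    using s r by (simp_all add: h_def h'_def power2_eq_square)
  have "M / (2 * h') = r * M * s / 2" "L / (2 * h) = r * L / (2 * s)" by (simp_all add: h_def h'_def)
  then show "r\<^sup>2 * integral {0..L} f + r * M * s / 2 \<le> lattice_count L f r s"
    "r\<^sup>2 * integral {0..L} f + r * L / (2 * s) \<le> lattice_count L f r s"
    using integral_le_card_lattice_points[OF h] inv.integral_le_card_lattice_points[OF h(2,1)]
    unfolding c card_lattice_points_flip[OF h] I integral_inverse by simp_all
qed

theorem theorem4:
  fixes L M \<alpha> \<beta> a1 a2 b1 b2 e :: real
    and f f' f'' g g' g'' \<delta> \<epsilon> :: "real \<Rightarrow> real"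
    and p q :: "nat \<Rightarrow> real" and m n :: nat
  assumes "L > 0" and "M > 0"
    and "continuous_on {0..L} f" and "convex_on {0..L} f" and "strict_antimono_on {0..L} f"
    and "f 0 = M" and "f L = 0"
    and "\<forall>x\<in>{0..L}. g (f x) = x"
    and "0 < \<alpha>" and "\<alpha> < L / 2" and "0 < \<beta>" and "\<beta> < M / 2" and "f \<alpha> = \<beta>"
    and "has_C2_derivs_on f f' f'' {\<alpha>..<L}"
    and "\<forall>x\<in>{\<alpha>..<L}. f' x < 0 \<and> f'' x > 0"
    and "has_C2_derivs_on g g' g'' {\<beta>..<M}"
    and "\<forall>y\<in>{\<beta>..<M}. g' y < 0 \<and> g'' y > 0"
    and "p 0 = \<alpha>" and "p m = L" and "piecewise_monotonic f'' p m"
    and "q 0 = \<beta>" and "q n = M" and "piecewise_monotonic g'' q n"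
    and "\<forall>r>0. 0 < \<delta> r \<and> \<delta> r < L / 2 - \<alpha>"
    and "\<forall>r>0. 0 < \<epsilon> r \<and> \<epsilon> r < M / 2 - \<beta>"
    and "a1 > 0" and "a2 > 0" and "b1 > 0" and "b2 > 0"
    and "\<delta> \<in> O[at_top](\<lambda>r. r powr (- 2 * a1))"
    and "(\<lambda>r. 1 / f'' (L - \<delta> r)) \<in> O[at_top](\<lambda>r. r powr (1 - 4 * a2))"
    and "\<epsilon> \<in> O[at_top](\<lambda>r. r powr (- 2 * b1))"
    and "(\<lambda>r. 1 / g'' (M - \<epsilon> r)) \<in> O[at_top](\<lambda>r. r powr (1 - 4 * b2))"
    and "L = M"
    and "e = Min {1 / 6, a1, a2, b1, b2}"
  shows "(\<forall>\<eta>>0. \<forall>\<^sub>F r in at_top. \<forall>s\<in>optimal_stretches L f r. \<bar>s - 1\<bar> < \<eta>) \<and>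
    (\<exists>C>0. \<exists>r0>0. \<forall>r\<ge>r0. \<forall>s\<in>optimal_stretches L f r. \<bar>s - 1\<bar> \<le> C * r powr (- e)) \<and>
    (\<lambda>r. real (min_lattice_count L f r) - (r\<^sup>2 * integral {0..L} f + r * L))
       \<in> O[at_top](\<lambda>r. r powr (1 - 2 * e))"
proof -
  have curve: "convex_curve L M f g"
    by unfold_locales (use assms(1-8) in auto)
  have e: "e \<le> 1/6" "e \<le> a1" "e \<le> a2" "e \<le> b1" "e \<le> b2" "0 < e"
    unfolding assms(35) using assms(26-29) by auto
  define A where "A = integral {0..L} f"
  obtain C0 where C0: "\<forall>\<^sub>F r in at_top. \<forall>s\<in>{1/3..3}.
    \<bar>real (lattice_count L f r s) - (r\<^sup>2 * A + r * (L / s + M * s) / 2)\<bar> \<le> C0 * r powr (1 - 2 * e)"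
    using lattice_count_asymp[OF curve assms(9) _ assms(11) _ assms(13,14-23) _ _ assms(26,28,30-33) e(1-5)] assms(9-12,24,25)
    unfolding A_def by auto
  define C where "C = \<bar>C0\<bar> + 1"
  have C: "C > 0" by (simp add: C_def)
  \<comment> \<open>Solves
    \<open>L * (s - 1)\<^sup>2 / (2 * s) \<le> 2 * C * r powr (- 2 * e)\<close> for
    \<open>\<bar>s - 1\<bar>\<close>, using \<open>s \<le> 3\<close>.\<close>
  define K where "K = sqrt (12 * C / L)"
  have K: "K > 0" using C assms(1) by (simp add: K_def)
  have rho: "((\<lambda>r. C * r powr (- 2 * e)) \<longlongrightarrow> C * 0) at_top"
    using e by (intro tendsto_intros tendsto_neg_powr filterlim_ident) auto
  \<comment> \<open>The error at \<open>s = 1\<close> is then below \<open>r * L / 2\<close>.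
    Comparison with the lower bounds gives \<open>L * s / 2 \<le> L + L / 2\<close> and the same for
    \<open>1 / s\<close>: this is where 3 comes from.\<close>
  then have small_ev: "\<forall>\<^sub>F r in at_top. C * r powr (- 2 * e) < L / 2"
    using assms(1) by (intro order_tendstoD(2)) auto
  have main: "\<forall>\<^sub>F r in at_top. (\<forall>s\<in>optimal_stretches L f r. \<bar>s - 1\<bar> \<le> K * r powr (- e)) \<and>
    \<bar>real (min_lattice_count L f r) - (r\<^sup>2 * A + r * L)\<bar> \<le> C * r powr (1 - 2 * e)"
    using C0 small_ev eventually_gt_at_top[of 0]
  proof eventually_elim
    case (elim r)
    then have r: "r > 0" and small: "C * r powr (- 2 * e) < L / 2"
      and approx0: "\<forall>s\<in>{1/3..3}. \<bar>real (lattice_count L f r s) - (r\<^sup>2 * A + r * (L / s + M * s) / 2)\<bar> \<le> C0 * r powr (1 - 2 * e)"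
      by auto
    define \<rho> where "\<rho> = r powr (- 2 * e)"
    have \<rho>: "\<rho> > 0" "C * \<rho> < L / 2" using small r by (auto simp: \<rho>_def)
    have "r powr 1 * r powr (- 2 * e) = r powr (1 - 2 * e)" unfolding powr_add[symmetric] by simp
    then have E: "r powr (1 - 2 * e) = r * \<rho>" using r by (simp add: \<rho>_def)
    have \<rho>2: "\<rho> = (r powr (- e))\<^sup>2" unfolding \<rho>_def using r by (simp add: powr_power)
    have approx: "\<bar>real (lattice_count L f r s) - (r\<^sup>2 * A + r * L * ((1 / s + s) / 2))\<bar> \<le> C * (r * \<rho>)" if "s \<in> {1/3..3}" for s
    proof -
      have "C0 * (r * \<rho>) \<le> C * (r * \<rho>)" using r \<rho> by (intro mult_right_mono) (auto simp: C_def)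
      moreover have "r * (L / s + M * s) / 2 = r * L * ((1 / s + s) / 2)"
        unfolding assms(34)[symmetric] by (simp add: field_simps)
      ultimately show ?thesis using approx0 that unfolding E by (metis order_trans)
    qed
    have at1: "real (lattice_count L f r 1) \<le> r\<^sup>2 * A + r * L + C * (r * \<rho>)"
      using approx[of 1] by (simp add: abs_le_iff)
    have opt: "s \<in> {1/3..3} \<and> real (lattice_count L f r s) \<le> r\<^sup>2 * A + r * L + C * (r * \<rho>)"
      if s: "s \<in> optimal_stretches L f r" for s
    proof -
      have s0: "s > 0" and "\<not> lattice_count L f r 1 < lattice_count L f r s"
        using s by (auto simp: optimal_stretches_def is_arg_min_def)
      then have le: "real (lattice_count L f r s) \<le> r\<^sup>2 * A + r * L + C * (r * \<rho>)" using at1 by simp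
      have "r * (C * \<rho>) \<le> r * (L / 2)" using r \<rho> by (intro mult_left_mono) auto
      then have le': "real (lattice_count L f r s) \<le> r\<^sup>2 * A + r * L + r * (L / 2)" using le by (simp add: mult_ac)
      note lower = lattice_count_lower_bounds[OF curve r s0, folded A_def, folded assms(34)]
      have "r * L * s / 2 \<le> r * L + r * (L / 2)" using lower(1) le' by linarith
      then have "(r * L) * s \<le> (r * L) * 3" by (simp add: mult.commute mult.left_commute)
      then have "s \<le> 3" using r assms(1) by simp
      have "r * L / (2 * s) \<le> r * L + r * (L / 2)" using lower(2) le' by linarith
      then have "(r * L) * (1 / s) \<le> (r * L) * 3" using s0 by (simp add: field_simps)
      then have "1 / s \<le> 3" using r assms(1) by (subst (asm) mult_le_cancel_left_pos) auto
      then have "1/3 \<le> s" using s0 by (simp add: field_simps)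
      with \<open>s \<le> 3\<close> le show ?thesis by simp
    qed
    have am: "(1 / s + s) / 2 - 1 = (s - 1)\<^sup>2 / (2 * s)" if "s > 0" for s :: real
      using that by (simp add: power2_eq_square field_simps)
    have opt_bound: "\<bar>s - 1\<bar> \<le> K * r powr (- e)" if s: "s \<in> optimal_stretches L f r" for s
    proof -
      have s0: "s > 0" "s \<le> 3" using opt[OF s] by auto
      \<comment> \<open>The area terms cancel; the error is incurred once at \<open>s\<close> and
        once at 1.\<close>
      have "r * L * ((1 / s + s) / 2) \<le> r * L + 2 * (C * (r * \<rho>))"
        using approx[of s] opt[OF s] unfolding abs_le_iff by linarith
      then have "r * L * ((1 / s + s) / 2 - 1) \<le> r * (2 * (C * \<rho>))" by (simp add: algebra_simps)
      then have "L * ((s - 1)\<^sup>2 / (2 * s)) \<le> 2 * (C * \<rho>)"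
        unfolding am[OF s0(1)] mult.assoc using r by (subst (asm) mult_le_cancel_left_pos) auto
      then have "L * (s - 1)\<^sup>2 \<le> 2 * (C * \<rho>) * (2 * s)" using s0 by (simp add: field_simps)
      also have "\<dots> \<le> 2 * (C * \<rho>) * (2 * 3)" using s0 C \<rho> by (intro mult_left_mono) auto
      finally have "(s - 1)\<^sup>2 \<le> (12 * C / L) * \<rho>" using assms(1) by (simp add: field_simps)
      also have "\<dots> = (K * r powr (- e))\<^sup>2" unfolding K_def \<rho>2 power_mult_distrib using C assms(1) by simp
      finally show ?thesis by (rule power2_le_imp_le[of "\<bar>s - 1\<bar>", simplified]) (use K in auto)
    qed
    \<comment> \<open>The lower estimate of the minimum needs an actual minimizer, to which the
      approximation on [1/3, 3] applies; it exists because the counts are natural numbers.\<close>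
    obtain t where t: "t > 0" "min_lattice_count L f r = lattice_count L f r t"
    proof -
      have "(INF s\<in>{0<..}. lattice_count L f r s) \<in> lattice_count L f r ` {0<..}"
        by (intro Inf_nat_def1) auto
      then show ?thesis using that unfolding min_lattice_count_def by auto
    qed
    have tmin: "min_lattice_count L f r \<le> lattice_count L f r s" if "s > 0" for s
      unfolding min_lattice_count_def using that by (intro cINF_lower) auto
    have topt: "t \<in> optimal_stretches L f r"
      unfolding optimal_stretches_def is_arg_min_def using t(1) tmin[unfolded t(2)] by (auto dest: leD)
    \<comment> \<open>By the inequality of arithmetic and geometric means, the main term at
      \<open>t\<close> is not below its value at 1.\<close>
    have "1 \<le> (1 / t + t) / 2" using am[OF t(1)] t(1) by (smt (verit) divide_nonneg_pos zero_le_power2)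
    then have "r * L * 1 \<le> r * L * ((1 / t + t) / 2)" using r assms(1) by (intro mult_left_mono) auto
    then have "\<bar>real (min_lattice_count L f r) - (r\<^sup>2 * A + r * L)\<bar> \<le> C * (r * \<rho>)"
      using approx[of t] opt[OF topt] unfolding t(2) abs_le_iff by linarith
    then show ?case using opt_bound unfolding E by blast
  qed
  have 1: "\<forall>\<^sub>F r in at_top. \<forall>s\<in>optimal_stretches L f r. \<bar>s - 1\<bar> < \<eta>" if "\<eta> > 0" for \<eta>
  proof -
    have "((\<lambda>r. K * r powr (- e)) \<longlongrightarrow> K * 0) at_top"
      using e by (intro tendsto_intros tendsto_neg_powr filterlim_ident) auto
    then have "\<forall>\<^sub>F r in at_top. K * r powr (- e) < \<eta>"
      using that by (intro order_tendstoD(2)) auto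
    with main show ?thesis by eventually_elim (meson le_less_trans)
  qed
  have 2: "\<exists>C>0. \<exists>r0>0. \<forall>r\<ge>r0. \<forall>s\<in>optimal_stretches L f r. \<bar>s - 1\<bar> \<le> C * r powr (- e)"
  proof -
    obtain R where R: "\<And>r. r \<ge> R \<Longrightarrow> \<forall>s\<in>optimal_stretches L f r. \<bar>s - 1\<bar> \<le> K * r powr (- e)"
      using main unfolding eventually_at_top_linorder by blast
    show ?thesis
    proof (rule exI[of _ K], intro conjI K, rule exI[of _ "max 1 R"], intro conjI allI impI)
      show "0 < max 1 R" by simp
    next
      fix r assume "max 1 R \<le> r"
      then show "\<forall>s\<in>optimal_stretches L f r. \<bar>s - 1\<bar> \<le> K * r powr (- e)" by (intro R) simp
    qed
  qed
  have 3: "(\<lambda>r. real (min_lattice_count L f r) - (r\<^sup>2 * integral {0..L} f + r * L)) \<in> O[at_top](\<lambda>r. r powr (1 - 2 * e))"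
  proof (rule bigoI[where c = C])
    show "\<forall>\<^sub>F r in at_top. norm (real (min_lattice_count L f r) - (r\<^sup>2 * integral {0..L} f + r * L)) \<le> C * norm (r powr (1 - 2 * e))"
      using main unfolding A_def by eventually_elim simp
  qed
  show ?thesis using 1 2 3 by blast
qed

end
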